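(* Let $\alpha>0$. For any fragmentation kernel $\kappa$, any $\gamma\ge0$ and any admissible initial datum $\mu_0$ (with $\operatorname{supp}(\mu_0)\subset[0,L]$), there exists a measure-valued (weak) solution $\mu_t\in\mathcal C(\mathbb R^+,\mathcal M(\mathbb R^+))$ of the fragmentation equation with initial datum $\mu_0$. This solution is given by the following everywhere convergent series: $$\mu_t=e^{-\alpha x^\gamma t}\mu_0+\sum_{n=0}^\infty(\alpha t)^n\int_0^\infty \ell^{n\gamma}a_n\Big(\frac x\ell\Big)\mu_0(\ell)\frac{d\ell}{\ell},$$ where the sequence $a_n$ is defined, for $x\in[0,1]$, by $$a_0(x)=0,\qquad a_{n+1}(x)=\frac1{n+1}\Big(-x^\gamma a_n(x)+\int_x^\infty y^{\gamma-1}\kappa\Big(\frac xy\Big)a_n(y)\,dy+\kappa(x)\frac{(-1)^n}{n!}\Big).$$ In particular, $$\int_0^\infty\varphi(x)\,d\mu_t(x)=\int_0^L\int_0^1\varphi(\ell x)\,d\mu^F_{t\ell^\gamma}(x)\,d\mu_0(\ell)\qquad\forall\varphi\in\mathcal C(\mathbb R^+),$$ where $\mu^F_t=e^{-\alpha t}\delta(x-1)+\sum_{n=1}^\infty(\alpha t)^n a_n$ is the fundamental solution (the solution given by this series for the initial datum $\delta(x-1)$), and $$\operatorname{supp}(\mu_t)\subset\operatorname{supp}(\mu_0)\qquad\text{for all }t>0.$$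
   Context: $\mathbb R^+=[0,\infty)$. $\mathcal M(\mathbb R^+)$ is the space of signed Radon measures supported in $\mathbb R^+$, endowed with the total variation norm $\|\mu\|_{TV}=\sup\{\int\varphi\,d\mu:\ \varphi\in\mathcal C(\mathbb R^+)\cap L^1(d|\mu|),\ \|\varphi\|_\infty\le1\}$, for which it is a Banach space; $\mathcal M^+(\mathbb R^+)$ is the subset of non-negative measures. $\mathcal C(\mathbb R^+,\mathcal M(\mathbb R^+))$ denotes continuous maps $t\mapsto\mu_t$ for the TV norm. Fragmentation kernel: $\kappa\in\mathcal M^+(\mathbb R^+)$ with no atom at $0$ nor at $1$, $\operatorname{supp}(\kappa)\subset[0,1]$, $\int_0^1 d\kappa(z)=N<+\infty$, $\int_0^1 z\,d\kappa(z)=1$. Admissible initial datum: $\mu_0\in\mathcal M^+(\mathbb R^+)$ compactly supported, $\operatorname{supp}(\mu_0)\subset[0,L]$. Fragmentation equation (formally): $\partial_t\mu_t(x)=-\alpha x^\gamma\mu_t(x)+\alpha\int_x^\infty\kappa(x/y)\,y^{\gamma-1}d\mu_t(y)$, $\mu_{t=0}=\mu_0$. A measure-valued (weak) solution is a family $(\mu_t)_{t\ge0}\subset\mathcal M(\mathbb R^+)$ such that $t\mapsto\mu_t$ is narrowly continuous and, for all $\varphi\in\mathcal C(\mathbb R^+)$ such that $x\mapsto\varphi(x)/(1+x)$ is bounded on $[0,\infty)$ and all $t\ge0$, $$\int_{\mathbb R^+}\varphi\,d\mu_t=\int_{\mathbb R^+}\varphi\,d\mu_0+\int_0^t ds\int_{\mathbb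 R^+}d\mu_s(x)\,\alpha x^\gamma\Big(-\varphi(x)+\int_0^1 d\kappa(z)\varphi(xz)\Big).$$ Here $\kappa$, $\mu_0$ and $a_n$ may be measures, and the integrals in the series and in the recursion are then understood as Mellin (multiplicative) convolutions of measures: for compactly supported finite measures on $\mathbb R^+$, $\int\varphi\,d(\mu\ast\nu)=\iint\varphi(xy)\,d\mu(x)\,d\nu(y)$ for all $\varphi\in\mathcal C(\mathbb R^+)$ (for densities, $(f\ast g)(x)=\int f(y)g(x/y)\frac{dy}{y}$). Thus the series reads $\mu_t=e^{-\alpha x^\gamma t}\mu_0+\sum_{n\ge0}(\alpha t)^n a_n\ast b_n$ with $db_n(y)=y^{n\gamma}d\mu_0(y)$, and the integral term in the recursion is $\kappa\ast(y^\gamma a_n)$, where $y^\gamma a_n$ is $a_n$ multiplied by the function $y\mapsto y^\gamma$.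
   Formalization: The printed inclusion supp(μ_t) ⊂ supp(μ_0) fails (e.g. μ_0=δ(x−1), κ=2dx on [0,1], where fragments smaller than 1 appear); the formal theorem states supp(μ_t) ⊂ [0,1]·supp(μ_0), which gives supp(μ_t) ⊂ [0,L] and agrees with the printed claim when supp(μ_0)=[0,L]. *)

theory Defs
  imports "HOL-Probability.Probability"
begin

section \<open>Signed measures on the half line\<close>

abbreviation rplus :: "real measure" where
  "rplus \<equiv> restrict_space borel {0..}"

text \<open>
  Finite signed Borel measures on \<open>[0,\<infinity>)\<close>, as countably additive real set functions; they are
  automatically Radon. The value outside the Borel sets is fixed so that equality of measures is
  equality of set functions.
\<close>

typedef smeasure = "{m :: real set \<Rightarrow> real.
    (\<forall>A. A \<notin> sets rplus \<longrightarrow> m A = 0) \<and>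
    (\<forall>A :: nat \<Rightarrow> real set. range A \<subseteq> sets rplus \<longrightarrow> disjoint_family A \<longrightarrow>
        (\<lambda>i. m (A i)) sums m (\<Union>i. A i))}"
  morphisms smeas Abs_smeasure
  by (intro exI[of _ "\<lambda>_. 0"]) auto

instantiation smeasure :: real_vector
begin

definition "0 = Abs_smeasure (\<lambda>_. 0)"
definition "\<mu> + \<nu> = Abs_smeasure (\<lambda>A. smeas \<mu> A + smeas \<nu> A)"
definition "\<mu> - \<nu> = Abs_smeasure (\<lambda>A. smeas \<mu> A - smeas \<nu> A)"
definition "- \<mu> = Abs_smeasure (\<lambda>A. - smeas \<mu> A)"
definition "c *\<^sub>R \<mu> = Abs_smeasure (\<lambda>A. c * smeas \<mu> A)"

lemma smeas_notin: "A \<notin> sets rplus \<Longrightarrow> smeas \<mu> A = 0"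
  using smeas[of \<mu>] by auto

lemma smeas_sums:
  "range A \<subseteq> sets rplus \<Longrightarrow> disjoint_family A \<Longrightarrow>
    (\<lambda>i. smeas \<mu> (A i)) sums smeas \<mu> (\<Union>i::nat. A i)"
  using smeas[of \<mu>] by auto

lemma smeas_zero [simp]: "smeas 0 A = 0"
  unfolding zero_smeasure_def by (subst Abs_smeasure_inverse) auto

lemma smeas_add [simp]: "smeas (\<mu> + \<nu>) A = smeas \<mu> A + smeas \<nu> A"
  unfolding plus_smeasure_def
  by (subst Abs_smeasure_inverse) (auto simp: smeas_notin intro!: sums_add smeas_sums)

lemma smeas_diff [simp]: "smeas (\<mu> - \<nu>) A = smeas \<mu> A - smeas \<nu> A"
  unfolding minus_smeasure_def
  by (subst Abs_smeasure_inverse) (auto simp: smeas_notin intro!: sums_diff smeas_sums)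

lemma smeas_uminus [simp]: "smeas (- \<mu>) A = - smeas \<mu> A"
  unfolding uminus_smeasure_def
  by (subst Abs_smeasure_inverse) (auto simp: smeas_notin intro!: sums_minus smeas_sums)

lemma smeas_scaleR [simp]: "smeas (c *\<^sub>R \<mu>) A = c * smeas \<mu> A"
  unfolding scaleR_smeasure_def
  by (subst Abs_smeasure_inverse) (auto simp: smeas_notin intro!: sums_mult smeas_sums)

lemma smeasure_eqI:
  assumes "\<And>A. A \<in> sets rplus \<Longrightarrow> smeas \<mu> A = smeas \<nu> A"
  shows "\<mu> = \<nu>"
proof -
  have "smeas \<mu> = smeas \<nu>"
    using assms smeas_notin by (metis ext)
  then show ?thesis by (simp add: smeas_inject)
qed

instance
  by standard (auto intro!: smeasure_eqI simp: algebra_simps)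

end

lemma smeas_empty [simp]: "smeas \<mu> {} = 0"
proof -
  have "(\<lambda>i::nat. smeas \<mu> {}) sums smeas \<mu> (\<Union>i::nat. {})"
    by (rule smeas_sums) (auto simp: disjoint_family_on_def)
  then have "summable (\<lambda>i::nat. smeas \<mu> {})" by (simp add: sums_iff)
  then show ?thesis by (simp add: summable_const_iff)
qed

lemma smeas_Un:
  assumes "A \<in> sets rplus" "B \<in> sets rplus" "A \<inter> B = {}"
  shows "smeas \<mu> (A \<union> B) = smeas \<mu> A + smeas \<mu> B"
proof -
  have "(\<lambda>i. smeas \<mu> (binaryset A B i)) sums smeas \<mu> (\<Union>i. binaryset A B i)"
    using assms by (intro smeas_sums) (auto simp: binaryset_def disjoint_family_on_def)
  moreover have "(\<lambda>i. smeas \<mu> (binaryset A B i)) sums (smeas \<mu> A + smeas \<mu> B)"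
    by (rule binaryset_sums) simp
  ultimately show ?thesis by (simp add: UN_binaryset_eq sums_iff)
qed

lemma smeas_Diff:
  assumes "A \<in> sets rplus" "B \<in> sets rplus" "B \<subseteq> A"
  shows "smeas \<mu> (A - B) = smeas \<mu> A - smeas \<mu> B"
proof -
  have "(A - B) \<union> B = A" using assms by auto
  moreover have "smeas \<mu> ((A - B) \<union> B) = smeas \<mu> (A - B) + smeas \<mu> B"
    using assms by (intro smeas_Un sets.Diff) auto
  ultimately show ?thesis by simp
qed

lemma smeas_bounded:
  "\<exists>c. \<forall>B \<in> sets rplus. \<bar>smeas \<mu> B\<bar> \<le> c"
proof (rule ccontr)
  assume nb: "\<not> ?thesis"
  define bad where
    "bad A \<longleftrightarrow> A \<in> sets rplus \<and> (\<forall>c. \<exists>B \<in> sets rplus. B \<subseteq> A \<and> c < \<bar>smeas \<mu> B\<bar>)" for A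
  have bad_space: "bad {0..}"
    unfolding bad_def
  proof (intro conjI allI)
    show "{0..} \<in> sets rplus" using sets.top[of rplus] by (simp add: space_restrict_space)
    fix c
    obtain B where "B \<in> sets rplus" "c < \<bar>smeas \<mu> B\<bar>" using nb by (auto simp: not_le)
    then show "\<exists>B \<in> sets rplus. B \<subseteq> {0..} \<and> c < \<bar>smeas \<mu> B\<bar>"
      using sets.sets_into_space[of B rplus] by (auto simp: space_restrict_space)
  qed
  have step: "\<exists>A'. bad A' \<and> A' \<subseteq> A \<and> 1 < \<bar>smeas \<mu> (A - A')\<bar>" if A: "bad A" for A
  proof -
    have As: "A \<in> sets rplus" using A by (simp add: bad_def)
    obtain B where B: "B \<in> sets rplus" "B \<subseteq> A" "\<bar>smeas \<mu> A\<bar> + 1 < \<bar>smeas \<mu> B\<bar>"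
      using A unfolding bad_def by blast
    have AB: "A - B \<in> sets rplus" using As B by auto
    have d: "smeas \<mu> (A - B) = smeas \<mu> A - smeas \<mu> B" using smeas_Diff As B by simp
    have "bad B \<or> bad (A - B)"
    proof (rule ccontr)
      assume n: "\<not> ?thesis"
      have nb: "\<exists>c. \<forall>C \<in> sets rplus. C \<subseteq> E \<longrightarrow> \<bar>smeas \<mu> C\<bar> \<le> c"
        if "E \<in> sets rplus" "\<not> bad E" for E
        using that unfolding bad_def not_less[symmetric] by blast
      from n have n1: "\<not> bad B" and n2: "\<not> bad (A - B)" by simp_all
      from nb[OF B(1) n1] obtain c1 where
        c1: "\<And>C. C \<in> sets rplus \<Longrightarrow> C \<subseteq> B \<Longrightarrow> \<bar>smeas \<mu> C\<bar> \<le> c1" by blast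
      from nb[OF AB n2] obtain c2 where
        c2: "\<And>C. C \<in> sets rplus \<Longrightarrow> C \<subseteq> A - B \<Longrightarrow> \<bar>smeas \<mu> C\<bar> \<le> c2" by blast
      obtain C where C: "C \<in> sets rplus" "C \<subseteq> A" "c1 + c2 < \<bar>smeas \<mu> C\<bar>"
        using A unfolding bad_def by blast
      have CB: "C \<inter> B \<in> sets rplus" "C - B \<in> sets rplus" using C B by auto
      have "smeas \<mu> C = smeas \<mu> (C \<inter> B) + smeas \<mu> (C - B)"
        using smeas_Un[OF CB, of \<mu>] by (simp add: Int_Diff_Un Int_Diff_disjoint)
      moreover have "\<bar>smeas \<mu> (C \<inter> B)\<bar> \<le> c1" "\<bar>smeas \<mu> (C - B)\<bar> \<le> c2"
        using CB C by (auto intro!: c1 c2)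
      ultimately show False using C(3) by linarith
    qed
    then show ?thesis
    proof
      assume "bad B"
      moreover have "1 < \<bar>smeas \<mu> (A - B)\<bar>" using d B(3) by linarith
      ultimately show ?thesis using B by blast
    next
      assume "bad (A - B)"
      moreover have "A - (A - B) = B" using B by auto
      ultimately show ?thesis using B by (intro exI[of _ "A - B"]) auto
    qed
  qed
  have "\<exists>F. \<forall>n::nat. bad (F n) \<and> (F (Suc n) \<subseteq> F n \<and> 1 < \<bar>smeas \<mu> (F n - F (Suc n))\<bar>)"
    by (rule dependent_nat_choice) (use bad_space step in blast)+
  then obtain F where F: "\<And>n::nat. bad (F n)"
    and Fs: "\<And>n. F (Suc n) \<subseteq> F n \<and> 1 < \<bar>smeas \<mu> (F n - F (Suc n))\<bar>"
    by blast
  define D where "D n = F n - F (Suc n)" for n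
  have anti: "F n \<subseteq> F m" if "m \<le> n" for m n
    using lift_Suc_antimono_le[of F] Fs that by blast
  have "disjoint_family D"
    unfolding disjoint_family_on_def
  proof (intro ballI impI)
    fix m n :: nat assume "m \<noteq> n"
    then consider "Suc m \<le> n" | "Suc n \<le> m" by linarith
    then show "D m \<inter> D n = {}"
      using anti[of "Suc m" n] anti[of "Suc n" m] by cases (auto simp: D_def)
  qed
  moreover have "range D \<subseteq> sets rplus" using F by (auto simp: D_def bad_def)
  ultimately have "summable (\<lambda>n. smeas \<mu> (D n))"
    using smeas_sums[of D \<mu>] by (simp add: sums_iff)
  then have "(\<lambda>n. smeas \<mu> (D n)) \<longlonglongrightarrow> 0" by (rule summable_LIMSEQ_zero)
  then obtain n where "\<bar>smeas \<mu> (D n)\<bar> < 1"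
    by (metis LIMSEQ_D diff_zero le_refl real_norm_def zero_less_one)
  then show False using Fs[of n] by (simp add: D_def)
qed

subsection \<open>Jordan decomposition, integral, support\<close>

definition pos_part :: "smeasure \<Rightarrow> real measure" where
  "pos_part \<mu> = measure_of {0..} (sets rplus)
     (\<lambda>A. ennreal (SUP B\<in>{B \<in> sets rplus. B \<subseteq> A}. smeas \<mu> B))"

definition neg_part :: "smeasure \<Rightarrow> real measure" where
  "neg_part \<mu> = pos_part (- \<mu>)"

definition add_measure :: "'a measure \<Rightarrow> 'a measure \<Rightarrow> 'a measure" where
  "add_measure P Q = measure_of (space P) (sets P) (\<lambda>A. emeasure P A + emeasure Q A)"

definition variation :: "smeasure \<Rightarrow> real measure" where
  "variation \<mu> = add_measure (pos_part \<mu>) (neg_part \<mu>)"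

definition sintegrable :: "smeasure \<Rightarrow> (real \<Rightarrow> real) \<Rightarrow> bool" where
  "sintegrable \<mu> \<phi> \<longleftrightarrow> integrable (variation \<mu>) \<phi>"

definition sintegral :: "smeasure \<Rightarrow> (real \<Rightarrow> real) \<Rightarrow> real" where
  "sintegral \<mu> \<phi> = (\<integral>x. \<phi> x \<partial>pos_part \<mu>) - (\<integral>x. \<phi> x \<partial>neg_part \<mu>)"

definition msupp :: "real measure \<Rightarrow> real set" where
  "msupp M = {x \<in> space M. \<forall>U. open U \<longrightarrow> x \<in> U \<longrightarrow> emeasure M (U \<inter> space M) \<noteq> 0}"

definition ssupp :: "smeasure \<Rightarrow> real set" where
  "ssupp \<mu> = msupp (variation \<mu>)"

lemma space_rplus [simp]: "space rplus = {0..}"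
  by (simp add: space_restrict_space)

lemma atLeast_in_rplus [simp]: "{0..} \<in> sets rplus"
  using sets.top[of rplus] by simp

lemma space_eq_rplus: "sets M = sets rplus \<Longrightarrow> space M = {0..}"
  using sets_eq_imp_space_eq[of M rplus] by simp

lemma sets_pos_part [simp, measurable_cong]: "sets (pos_part \<mu>) = sets rplus"
  using sets.sets_measure_of_eq[of rplus] by (simp only: pos_part_def space_rplus)

lemma space_pos_part [simp]: "space (pos_part \<mu>) = {0..}"
  by (rule space_eq_rplus) simp

lemma sets_neg_part [simp, measurable_cong]: "sets (neg_part \<mu>) = sets rplus"
  by (simp add: neg_part_def)

lemma space_neg_part [simp]: "space (neg_part \<mu>) = {0..}"
  by (simp add: neg_part_def)

lemma bdd_above_smeas: "bdd_above (smeas \<mu> ` {B \<in> sets rplus. B \<subseteq> A})"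
proof -
  obtain c where "\<forall>B \<in> sets rplus. \<bar>smeas \<mu> B\<bar> \<le> c" using smeas_bounded by blast
  then show ?thesis by (intro bdd_aboveI[of _ c]) (auto simp: abs_le_iff)
qed

lemma emeasure_pos_part:
  assumes "A \<in> sets rplus"
  shows "emeasure (pos_part \<mu>) A = ennreal (SUP B\<in>{B \<in> sets rplus. B \<subseteq> A}. smeas \<mu> B)"
proof -
  define p where "p A = (SUP B\<in>{B \<in> sets rplus. B \<subseteq> A}. smeas \<mu> B)" for A
  have upper: "smeas \<mu> B \<le> p A" if "B \<in> sets rplus" "B \<subseteq> A" for A B
    unfolding p_def using that bdd_above_smeas by (intro cSUP_upper) auto
  have nonneg: "0 \<le> p A" for A using upper[of "{}" A] by simp
  have least: "p A \<le> c" if "\<And>B. B \<in> sets rplus \<Longrightarrow> B \<subseteq> A \<Longrightarrow> smeas \<mu> B \<le> c" for A c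
    unfolding p_def using that by (intro cSUP_least) auto
  have empty: "p {} = 0"
    using least[of "{}" 0] nonneg[of "{}"] by (simp add: subset_empty antisym)
  have mono: "p A \<le> p B" if "A \<subseteq> B" for A B
    using that by (intro least upper) auto
  have superadd: "p A + p B \<le> p (A \<union> B)"
    if "A \<in> sets rplus" "B \<in> sets rplus" "A \<inter> B = {}" for A B
  proof -
    have "p A \<le> p (A \<union> B) - p B"
    proof (rule least)
      fix C assume C: "C \<in> sets rplus" "C \<subseteq> A"
      have "p B \<le> p (A \<union> B) - smeas \<mu> C"
      proof (rule least)
        fix D assume D: "D \<in> sets rplus" "D \<subseteq> B"
        have "smeas \<mu> C + smeas \<mu> D = smeas \<mu> (C \<union> D)"
          using C D that by (intro smeas_Un[symmetric]) auto
        also have "\<dots> \<le> p (A \<union> B)" using C D by (intro upper) auto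
        finally show "smeas \<mu> D \<le> p (A \<union> B) - smeas \<mu> C" by simp
      qed
      then show "smeas \<mu> C \<le> p (A \<union> B) - p B" by simp
    qed
    then show ?thesis by simp
  qed
  have "countably_additive (sets rplus) (\<lambda>A. ennreal (p A))"
    unfolding countably_additive_def
  proof (intro allI impI)
    fix A :: "nat \<Rightarrow> real set"
    assume A: "range A \<subseteq> sets rplus" "disjoint_family A" "(\<Union>i. A i) \<in> sets rplus"
    have fin: "(\<Sum>i<n. p (A i)) \<le> p (\<Union>i<n. A i)" for n
    proof (induction n)
      case 0 then show ?case by (simp add: empty)
    next
      case (Suc n)
      have "p (\<Union>i<n. A i) + p (A n) \<le> p ((\<Union>i<n. A i) \<union> A n)"
      proof (rule superadd)
        show "(\<Union>i<n. A i) \<in> sets rplus" "A n \<in> sets rplus" using A by auto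
        have "A i \<inter> A n = {}" if "i < n" for i
          using A(2) that by (simp add: disjoint_family_on_def)
        then show "(\<Union>i<n. A i) \<inter> A n = {}" by blast
      qed
      then show ?case using Suc by (simp add: lessThan_Suc Un_commute)
    qed
    have bnd: "(\<Sum>i<n. p (A i)) \<le> p (\<Union>i. A i)" for n
      using fin[of n] mono[of "\<Union>i<n. A i" "\<Union>i. A i"] by (meson UN_mono order_trans subset_UNIV subset_refl)
    have summ: "summable (\<lambda>i. p (A i))"
      using bnd nonneg by (intro summableI_nonneg_bounded[where x = "p (\<Union>i. A i)"]) auto
    have "(\<Sum>i. p (A i)) = p (\<Union>i. A i)"
    proof (rule antisym)
      show "(\<Sum>i. p (A i)) \<le> p (\<Union>i. A i)"
        using summ bnd by (intro suminf_le_const) auto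
      show "p (\<Union>i. A i) \<le> (\<Sum>i. p (A i))"
      proof (rule least)
        fix B assume B: "B \<in> sets rplus" "B \<subseteq> (\<Union>i. A i)"
        have "(\<lambda>i. smeas \<mu> (B \<inter> A i)) sums smeas \<mu> (\<Union>i. B \<inter> A i)"
          using A B by (intro smeas_sums) (auto simp: disjoint_family_on_def)
        moreover have "(\<Union>i. B \<inter> A i) = B" using B by auto
        ultimately have s: "(\<lambda>i. smeas \<mu> (B \<inter> A i)) sums smeas \<mu> B" by simp
        have "smeas \<mu> (B \<inter> A i) \<le> p (A i)" for i using A B by (intro upper) auto
        then show "smeas \<mu> B \<le> (\<Sum>i. p (A i))"
          using s summ suminf_le[of "\<lambda>i. smeas \<mu> (B \<inter> A i)" "\<lambda>i. p (A i)"] by (simp add: sums_iff)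
      qed
    qed
    then show "(\<Sum>i. ennreal (p (A i))) = ennreal (p (\<Union>i. A i))"
      using summ nonneg by (simp add: suminf_ennreal2)
  qed
  moreover have "positive (sets rplus) (\<lambda>A. ennreal (p A))" by (simp add: positive_def empty)
  moreover have "sigma_algebra {0..} (sets rplus)"
    using sets.sigma_algebra_axioms[of rplus] by simp
  ultimately have "emeasure (measure_of {0..} (sets rplus) (\<lambda>A. ennreal (p A))) A = ennreal (p A)"
    using assms by (intro emeasure_measure_of_sigma)
  then show ?thesis unfolding pos_part_def p_def .
qed

lemma finite_pos_part: "finite_measure (pos_part \<mu>)"
  by (rule finite_measureI) (simp add: emeasure_pos_part)

lemma finite_neg_part: "finite_measure (neg_part \<mu>)"
  by (simp add: neg_part_def finite_pos_part)

lemma measure_pos_part: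
  assumes "A \<in> sets rplus"
  shows "measure (pos_part \<mu>) A = (SUP B\<in>{B \<in> sets rplus. B \<subseteq> A}. smeas \<mu> B)"
proof -
  have "smeas \<mu> {} \<le> (SUP B\<in>{B \<in> sets rplus. B \<subseteq> A}. smeas \<mu> B)"
    using bdd_above_smeas by (intro cSUP_upper) auto
  then show ?thesis using assms by (simp add: measure_def emeasure_pos_part)
qed

lemma smeas_Jordan:
  assumes A: "A \<in> sets rplus"
  shows "smeas \<mu> A = measure (pos_part \<mu>) A - measure (neg_part \<mu>) A"
proof -
  have le: "measure (neg_part \<nu>) A \<le> measure (pos_part \<nu>) A - smeas \<nu> A" for \<nu>
    unfolding neg_part_def measure_pos_part[OF A]
  proof (rule cSUP_least)
    fix B assume B: "B \<in> {B \<in> sets rplus. B \<subseteq> A}"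
    have "smeas \<nu> (A - B) \<le> (SUP B\<in>{B \<in> sets rplus. B \<subseteq> A}. smeas \<nu> B)"
      using A B bdd_above_smeas by (intro cSUP_upper) auto
    then show "smeas (- \<nu>) B \<le> (SUP B\<in>{B \<in> sets rplus. B \<subseteq> A}. smeas \<nu> B) - smeas \<nu> A"
      using A B by (simp add: smeas_Diff)
  qed auto
  show ?thesis using le[of \<mu>] le[of "- \<mu>"] by (simp add: neg_part_def)
qed

lemma emeasure_add_measure:
  assumes "sets Q = sets P" "A \<in> sets P"
  shows "emeasure (add_measure P Q) A = emeasure P A + emeasure Q A"
  unfolding add_measure_def
proof (rule emeasure_measure_of_sigma)
  show "sigma_algebra (space P) (sets P)" by (rule sets.sigma_algebra_axioms)
  show "positive (sets P) (\<lambda>A. emeasure P A + emeasure Q A)" by (simp add: positive_def)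
  show "countably_additive (sets P) (\<lambda>A. emeasure P A + emeasure Q A)"
    unfolding countably_additive_def
  proof (intro allI impI)
    fix A :: "nat \<Rightarrow> _" assume A: "range A \<subseteq> sets P" "disjoint_family A"
    have "(\<Sum>i. emeasure P (A i) + emeasure Q (A i)) = (\<Sum>i. emeasure P (A i)) + (\<Sum>i. emeasure Q (A i))"
      by (intro suminf_add[symmetric]) auto
    then show "(\<Sum>i. emeasure P (A i) + emeasure Q (A i)) = emeasure P (\<Union>i. A i) + emeasure Q (\<Union>i. A i)"
      using A assms by (simp add: suminf_emeasure)
  qed
qed fact

lemma sets_add_measure [simp, measurable_cong]: "sets (add_measure P Q) = sets P"
  by (simp add: add_measure_def)

lemma space_add_measure [simp]: "space (add_measure P Q) = space P"
  by (simp add: add_measure_def)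

lemma nn_integral_add_measure:
  assumes f: "f \<in> borel_measurable P" and s: "sets Q = sets P"
  shows "(\<integral>\<^sup>+x. f x \<partial>add_measure P Q) = (\<integral>\<^sup>+x. f x \<partial>P) + (\<integral>\<^sup>+x. f x \<partial>Q)"
  using f
proof induction
  case (cong f g)
  moreover have "space Q = space P" using s by (rule sets_eq_imp_space_eq)
  ultimately show ?case by (simp cong: nn_integral_cong_simp)
next
  case (set A)
  then show ?case using s by (simp add: emeasure_add_measure)
next
  case (mult f c)
  have "f \<in> borel_measurable Q" "f \<in> borel_measurable (add_measure P Q)"
    using mult.hyps s by (auto cong: measurable_cong_sets)
  then show ?case using mult by (simp add: nn_integral_cmult distrib_left)
next
  case (add f g)
  have "f \<in> borel_measurable Q" "f \<in> borel_measurable (add_measure P Q)"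
       "g \<in> borel_measurable Q" "g \<in> borel_measurable (add_measure P Q)"
    using add.hyps s by (auto cong: measurable_cong_sets)
  then show ?case using add by (simp add: nn_integral_add algebra_simps)
next
  case (seq U)
  have m: "U i \<in> borel_measurable Q" "U i \<in> borel_measurable (add_measure P Q)" for i
    using seq.hyps s by (auto cong: measurable_cong_sets)
  have "(\<Squnion>i. (\<integral>\<^sup>+x. U i x \<partial>P) + (\<integral>\<^sup>+x. U i x \<partial>Q)) =
      (\<Squnion>i. \<integral>\<^sup>+x. U i x \<partial>P) + (\<Squnion>i. \<integral>\<^sup>+x. U i x \<partial>Q)"
    using seq.hyps by (intro ennreal_SUP_add) (auto simp: incseq_def le_fun_def intro!: nn_integral_mono)
  then show ?case using seq m
    by (simp add: nn_integral_monotone_convergence_SUP image_comp)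
qed

lemma integral_add_measure:
  fixes f :: "'a \<Rightarrow> real"
  assumes P: "integrable P f" and Q: "integrable Q f" and s: "sets Q = sets P"
  shows "integrable (add_measure P Q) f"
    "(\<integral>x. f x \<partial>add_measure P Q) = (\<integral>x. f x \<partial>P) + (\<integral>x. f x \<partial>Q)"
proof -
  have m: "f \<in> borel_measurable P" "f \<in> borel_measurable Q" "f \<in> borel_measurable (add_measure P Q)"
    using P Q by (auto cong: measurable_cong_sets)
  show i: "integrable (add_measure P Q) f"
    using P Q m s by (simp add: integrable_iff_bounded nn_integral_add_measure)
  have fin: "(\<integral>\<^sup>+x. ennreal (f x) \<partial>M) \<noteq> \<top>" "(\<integral>\<^sup>+x. ennreal (- f x) \<partial>M) \<noteq> \<top>"
    if "integrable M f" for M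
    using that unfolding real_integrable_def by (auto simp: infinity_ennreal_def)
  show "(\<integral>x. f x \<partial>add_measure P Q) = (\<integral>x. f x \<partial>P) + (\<integral>x. f x \<partial>Q)"
    unfolding real_lebesgue_integral_def[OF P] real_lebesgue_integral_def[OF Q]
      real_lebesgue_integral_def[OF i]
    using m s fin[OF P] fin[OF Q]
    by (simp add: nn_integral_add_measure enn2real_plus less_top)
qed

lemma sets_variation [simp, measurable_cong]: "sets (variation \<mu>) = sets rplus"
  by (simp add: variation_def)

lemma space_variation [simp]: "space (variation \<mu>) = {0..}"
  by (simp add: variation_def)

lemma integrable_bounded_rplus:
  fixes f :: "real \<Rightarrow> real"
  assumes "finite_measure M" "sets M = sets rplus" "f \<in> borel_measurable rplus"
    "\<And>x. 0 \<le> x \<Longrightarrow> \<bar>f x\<bar> \<le> c"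
  shows "integrable M f"
proof -
  have "space M = {0..}" using assms(2) by (simp add: space_eq_rplus)
  then show ?thesis
    using assms
    by (intro finite_measure.integrable_const_bound[where B = c])
       (auto cong: measurable_cong_sets intro!: AE_I2)
qed

lemma sintegrable_bounded:
  assumes "f \<in> borel_measurable rplus" "\<And>x. 0 \<le> x \<Longrightarrow> \<bar>f x\<bar> \<le> c"
  shows "sintegrable \<mu> f"
  unfolding sintegrable_def variation_def
  using assms by (intro integral_add_measure integrable_bounded_rplus[where c = c])
    (auto simp: finite_pos_part finite_neg_part)

lemma sintegral_eqI:
  assumes P: "finite_measure P" "sets P = sets rplus" and M: "finite_measure M" "sets M = sets rplus"
    and eq: "\<And>A. A \<in> sets rplus \<Longrightarrow> smeas \<mu> A = measure P A - measure M A"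
    and f: "f \<in> borel_measurable rplus" "\<And>x. 0 \<le> x \<Longrightarrow> \<bar>f x\<bar> \<le> c"
  shows "sintegral \<mu> f = (\<integral>x. f x \<partial>P) - (\<integral>x. f x \<partial>M)"
proof -
  interpret P: finite_measure P by fact
  interpret M: finite_measure M by fact
  interpret p: finite_measure "pos_part \<mu>" by (rule finite_pos_part)
  interpret n: finite_measure "neg_part \<mu>" by (rule finite_neg_part)
  have "add_measure (pos_part \<mu>) M = add_measure P (neg_part \<mu>)"
  proof (rule measure_eqI)
    fix A assume "A \<in> sets (add_measure (pos_part \<mu>) M)"
    then have A: "A \<in> sets rplus" by simp
    have "measure (pos_part \<mu>) A + measure M A = measure P A + measure (neg_part \<mu>) A"
      using eq[OF A] smeas_Jordan[OF A, of \<mu>] by linarith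
    then have "ennreal (measure (pos_part \<mu>) A + measure M A) =
        ennreal (measure P A + measure (neg_part \<mu>) A)"
      by simp
    then show "emeasure (add_measure (pos_part \<mu>) M) A = emeasure (add_measure P (neg_part \<mu>)) A"
      using A P M
      by (simp add: emeasure_add_measure P.emeasure_eq_measure M.emeasure_eq_measure
          p.emeasure_eq_measure n.emeasure_eq_measure)
  qed (use P in simp)
  then have "(\<integral>x. f x \<partial>pos_part \<mu>) + (\<integral>x. f x \<partial>M) = (\<integral>x. f x \<partial>P) + (\<integral>x. f x \<partial>neg_part \<mu>)"
    using f P M
    by (subst (1 2) integral_add_measure(2)[symmetric])
       (auto intro!: integrable_bounded_rplus[where c = c] simp: finite_pos_part finite_neg_part)
  then show ?thesis by (simp add: sintegral_def)
qed

lemma sintegral_add: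
  assumes f: "f \<in> borel_measurable rplus" "\<And>x. 0 \<le> x \<Longrightarrow> \<bar>f x\<bar> \<le> c"
  shows "sintegral (\<mu> + \<nu>) f = sintegral \<mu> f + sintegral \<nu> f"
proof -
  let ?P = "add_measure (pos_part \<mu>) (pos_part \<nu>)" and ?M = "add_measure (neg_part \<mu>) (neg_part \<nu>)"
  note fin = finite_pos_part finite_neg_part
  have m: "measure (add_measure P Q) A = measure P A + measure Q A"
    if "finite_measure P" "finite_measure Q" "sets P = sets rplus" "sets Q = sets rplus"
       "A \<in> sets rplus" for P Q A
    using that
    by (intro measure_eq_emeasure_eq_ennreal)
       (simp_all add: emeasure_add_measure finite_measure.emeasure_eq_measure)
  have fa: "finite_measure (add_measure P Q)"
    if "finite_measure P" "finite_measure Q" "sets P = sets rplus" "sets Q = sets rplus" for P Q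
    using that by (intro finite_measureI)
      (simp add: emeasure_add_measure space_eq_rplus finite_measure.emeasure_finite)
  have "sintegral (\<mu> + \<nu>) f = (\<integral>x. f x \<partial>?P) - (\<integral>x. f x \<partial>?M)"
    using f by (intro sintegral_eqI[where c = c]) (auto intro!: fa simp: fin m smeas_Jordan)
  also have "\<dots> = sintegral \<mu> f + sintegral \<nu> f"
    using f by (subst (1 2) integral_add_measure(2))
      (auto intro!: integrable_bounded_rplus[where c = c] simp: fin sintegral_def)
  finally show ?thesis .
qed

lemma sintegral_uminus: "sintegral (- \<mu>) f = - sintegral \<mu> f"
  by (simp add: sintegral_def neg_part_def)

lemma sintegral_uminus_fun: "sintegral \<mu> (\<lambda>x. - f x) = - sintegral \<mu> f"
  by (simp add: sintegral_def)

lemma sintegral_scaleR: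
  assumes f: "f \<in> borel_measurable rplus" "\<And>x. 0 \<le> x \<Longrightarrow> \<bar>f x\<bar> \<le> c"
  shows "sintegral (r *\<^sub>R \<mu>) f = r * sintegral \<mu> f"
proof -
  have nn: "sintegral (r *\<^sub>R \<mu>) f = r * sintegral \<mu> f" if r: "0 \<le> r" for r
  proof -
    let ?S = "\<lambda>P. density P (\<lambda>_. ennreal r)"
    have fin: "finite_measure (?S (pos_part \<mu>))" "finite_measure (?S (neg_part \<mu>))"
      by (auto intro!: finite_measureI simp: emeasure_density_const ennreal_mult_eq_top_iff
          finite_measure.emeasure_finite finite_pos_part finite_neg_part)
    have m: "measure (?S P) A = r * measure P A" if "A \<in> sets P" for P :: "real measure" and A
      using that r by (simp add: measure_def emeasure_density nn_integral_cmult_indicator enn2real_mult)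
    have "sintegral (r *\<^sub>R \<mu>) f = (\<integral>x. f x \<partial>?S (pos_part \<mu>)) - (\<integral>x. f x \<partial>?S (neg_part \<mu>))"
      using f by (intro sintegral_eqI[where c = c]) (auto simp: fin m smeas_Jordan right_diff_distrib)
    also have "\<dots> = r * sintegral \<mu> f"
      using f r by (subst (1 2) integral_density)
        (auto simp: sintegral_def right_diff_distrib cong: measurable_cong_sets)
    finally show ?thesis .
  qed
  show ?thesis
  proof (cases "0 \<le> r")
    case False
    then have "sintegral (r *\<^sub>R \<mu>) f = - sintegral ((- r) *\<^sub>R \<mu>) f"
      by (metis scaleR_minus_left sintegral_uminus minus_minus)
    then show ?thesis using nn[of "- r"] False by simp
  qed (rule nn)
qed

subsection \<open>Total variation norm\<close>

definition tv_tests :: "smeasure \<Rightarrow> (real \<Rightarrow> real) set" where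
  "tv_tests \<mu> = {\<phi>. continuous_on {0..} \<phi> \<and> sintegrable \<mu> \<phi> \<and> (\<forall>x\<ge>0. \<bar>\<phi> x\<bar> \<le> 1)}"

lemma tv_tests_iff: "\<phi> \<in> tv_tests \<mu> \<longleftrightarrow> continuous_on {0..} \<phi> \<and> (\<forall>x\<ge>0. \<bar>\<phi> x\<bar> \<le> 1)"
  by (auto simp: tv_tests_def intro!: sintegrable_bounded[where c = 1]
      borel_measurable_continuous_on_restrict)

lemma tv_testsD:
  assumes "\<phi> \<in> tv_tests \<mu>"
  shows "\<phi> \<in> borel_measurable rplus" "\<And>x. 0 \<le> x \<Longrightarrow> \<bar>\<phi> x\<bar> \<le> 1"
  using assms by (auto simp: tv_tests_iff intro!: borel_measurable_continuous_on_restrict)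

lemma bdd_above_tv: "bdd_above (sintegral \<mu> ` tv_tests \<mu>)"
proof (rule bdd_aboveI2)
  fix \<phi> assume "\<phi> \<in> tv_tests \<mu>"
  note t = tv_testsD[OF this]
  have "\<bar>\<integral>x. \<phi> x \<partial>P\<bar> \<le> measure P {0..}" if P: "finite_measure P" "sets P = sets rplus" for P
  proof -
    have sp: "space P = {0..}" using P by (simp add: space_eq_rplus)
    have "\<bar>\<integral>x. \<phi> x \<partial>P\<bar> \<le> (\<integral>x. \<bar>\<phi> x\<bar> \<partial>P)" by (rule integral_abs_bound)
    also have "\<dots> \<le> (\<integral>x. 1 \<partial>P)"
      using P t sp by (intro integral_mono integrable_bounded_rplus[where c = 1] finite_measure.integrable_const) auto
    finally show ?thesis using sp by simp
  qed
  from this[OF finite_pos_part[of \<mu>]] this[OF finite_neg_part[of \<mu>]]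
  show "sintegral \<mu> \<phi> \<le> measure (pos_part \<mu>) {0..} + measure (neg_part \<mu>) {0..}"
    by (simp add: sintegral_def abs_le_iff)
qed

lemma sintegral_tests_zero:
  assumes z: "\<And>\<phi>. \<phi> \<in> tv_tests \<mu> \<Longrightarrow> sintegral \<mu> \<phi> = 0"
  shows "\<mu> = 0"
proof -
  let ?D = "\<lambda>P. distr P borel (\<lambda>x::real. x)"
  let ?p = "pos_part \<mu>" and ?n = "neg_part \<mu>"
  have id: "(\<lambda>x. x) \<in> measurable rplus borel"
    by (rule measurable_restrict_space1) simp
  have idm: "(\<lambda>x. x) \<in> measurable P borel" if "sets P = sets rplus" for P
    using id that by (simp cong: measurable_cong_sets)
  have fb: "finite_borel_measure (?D P)" if "finite_measure P" "sets P = sets rplus" for P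
    using that finite_measure.finite_measure_distr[OF that(1) idm[OF that(2)]]
    by (simp add: finite_borel_measure_def finite_borel_measure_axioms_def)
  have lim: "(\<lambda>k. \<integral>y. max 0 (1 - real k * max 0 (y - x)) \<partial>P) \<longlonglongrightarrow> cdf (?D P) x"
    if P: "finite_measure P" "sets P = sets rplus" for P x
  proof -
    have sp: "space P = {0..}" using P by (simp add: space_eq_rplus)
    have "(\<lambda>k. \<integral>y. max 0 (1 - real k * max 0 (y - x)) \<partial>P) \<longlonglongrightarrow> (\<integral>y. indicator {..x} y \<partial>P)"
    proof (rule integral_dominated_convergence[where w = "\<lambda>_. 1"])
      show "AE y in P. (\<lambda>k. max 0 (1 - real k * max 0 (y - x))) \<longlonglongrightarrow> indicator {..x} y"
      proof (rule AE_I2)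
        fix y
        show "(\<lambda>k. max 0 (1 - real k * max 0 (y - x))) \<longlonglongrightarrow> indicator {..x} y"
        proof (cases "y \<le> x")
          case False
          obtain K where K: "1 / (y - x) \<le> real K" using real_arch_simple by blast
          have "max 0 (1 - real k * max 0 (y - x)) = 0" if "K \<le> k" for k
          proof -
            have "1 / (y - x) \<le> real k" using K that by linarith
            then show ?thesis using False by (simp add: field_simps)
          qed
          then have "eventually (\<lambda>k. max 0 (1 - real k * max 0 (y - x)) = 0) sequentially"
            using eventually_sequentially by blast
          then show ?thesis using False by (simp add: tendsto_eventually)
        qed (simp add: max_def)
      qed
    qed (use P idm[OF P(2)] in \<open>auto intro!: finite_measure.integrable_const AE_I2 borel_measurable_indicator' simp: measurable_compose[OF idm[OF P(2)]]\<close>)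
    moreover have "(\<integral>y. indicator {..x} y \<partial>P) = cdf (?D P) x"
      using idm[OF P(2)] by (simp add: cdf_def measure_distr vimage_def atMost_def Int_commute)
    ultimately show ?thesis by simp
  qed
  have "cdf (?D ?p) = cdf (?D ?n)"
  proof
    fix x
    have "(\<integral>y. max 0 (1 - real k * max 0 (y - x)) \<partial>?p) = (\<integral>y. max 0 (1 - real k * max 0 (y - x)) \<partial>?n)" for k
    proof -
      have "(\<lambda>y. max 0 (1 - real k * max 0 (y - x))) \<in> tv_tests \<mu>"
        by (auto simp: tv_tests_iff intro!: continuous_intros)
      from z[OF this] show ?thesis by (simp add: sintegral_def)
    qed
    then show "cdf (?D ?p) x = cdf (?D ?n) x"
      using lim[of ?p x] lim[of ?n x] by (auto simp: finite_pos_part finite_neg_part intro: LIMSEQ_unique)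
  qed
  then have eq: "?D ?p = ?D ?n"
    by (intro cdf_unique' fb) (auto simp: finite_pos_part finite_neg_part)
  show ?thesis
  proof (rule smeasure_eqI)
    fix A assume A: "A \<in> sets rplus"
    then have Ab: "A \<in> sets borel" "A \<subseteq> {0..}" by (auto simp: sets_restrict_space_iff)
    have "measure (?D P) A = measure P A" if "sets P = sets rplus" for P
    proof -
      have "space P = {0..}" using that by (simp add: space_eq_rplus)
      then show ?thesis using Ab idm[OF that] by (simp add: measure_distr Int_absorb2)
    qed
    then have "measure ?p A = measure ?n A" using eq by (metis sets_pos_part sets_neg_part)
    then show "smeas \<mu> A = smeas 0 A" using A by (simp add: smeas_Jordan)
  qed
qed

instantiation smeasure :: real_normed_vector
begin

definition norm_smeasure :: "smeasure \<Rightarrow> real" where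
  "norm_smeasure \<mu> = (SUP \<phi>\<in>tv_tests \<mu>. sintegral \<mu> \<phi>)"

definition "sgn (\<mu> :: smeasure) = inverse (norm \<mu>) *\<^sub>R \<mu>"
definition "dist (\<mu> :: smeasure) \<nu> = norm (\<mu> - \<nu>)"
definition "(uniformity :: (smeasure \<times> smeasure) filter) =
  (INF e\<in>{0<..}. principal {(\<mu>, \<nu>). dist \<mu> \<nu> < e})"
definition "open (U :: smeasure set) \<longleftrightarrow>
  (\<forall>\<mu>\<in>U. \<forall>\<^sub>F (\<mu>', \<nu>) in uniformity. \<mu>' = \<mu> \<longrightarrow> \<nu> \<in> U)"

instance
proof
  have zero_test: "(\<lambda>_. 0) \<in> tv_tests \<mu>" for \<mu> by (simp add: tv_tests_iff)
  have upper: "sintegral \<mu> \<phi> \<le> norm \<mu>" if "\<phi> \<in> tv_tests \<mu>" for \<mu> \<phi>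
    unfolding norm_smeasure_def using that bdd_above_tv by (intro cSUP_upper) auto
  have least: "norm \<mu> \<le> c" if "\<And>\<phi>. \<phi> \<in> tv_tests \<mu> \<Longrightarrow> sintegral \<mu> \<phi> \<le> c" for \<mu> c
    unfolding norm_smeasure_def using that zero_test by (intro cSUP_least) auto
  have same: "\<phi> \<in> tv_tests \<mu> \<longleftrightarrow> \<phi> \<in> tv_tests \<nu>" for \<phi> \<mu> \<nu> by (simp add: tv_tests_iff)
  have nonneg: "0 \<le> norm \<mu>" for \<mu> :: smeasure
    using upper[OF zero_test, of \<mu>] by (simp add: sintegral_def)
  have abs: "\<bar>sintegral \<mu> \<phi>\<bar> \<le> norm \<mu>" if "\<phi> \<in> tv_tests \<mu>" for \<mu> \<phi>
  proof -
    have "(\<lambda>x. - \<phi> x) \<in> tv_tests \<mu>" using that by (auto simp: tv_tests_iff intro: continuous_on_minus)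
    from upper[OF this] upper[OF that] show ?thesis by (simp add: sintegral_uminus_fun abs_le_iff)
  qed
  show "norm (\<mu> + \<nu>) \<le> norm \<mu> + norm \<nu>" for \<mu> \<nu> :: smeasure
  proof (rule least)
    fix \<phi> assume t: "\<phi> \<in> tv_tests (\<mu> + \<nu>)"
    have "sintegral (\<mu> + \<nu>) \<phi> = sintegral \<mu> \<phi> + sintegral \<nu> \<phi>"
      using tv_testsD[OF t] by (rule sintegral_add)
    then show "sintegral (\<mu> + \<nu>) \<phi> \<le> norm \<mu> + norm \<nu>"
      using t upper[of \<phi> \<mu>] upper[of \<phi> \<nu>] same by (metis add_mono)
  qed
  show "(norm \<mu> = 0) = (\<mu> = 0)" for \<mu> :: smeasure
  proof
    assume "norm \<mu> = 0"
    then show "\<mu> = 0" using abs by (intro sintegral_tests_zero) fastforce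
  next
    assume \<mu>: "\<mu> = 0"
    have "sintegral \<mu> \<phi> = 0" for \<phi> using \<mu> by (simp add: sintegral_def neg_part_def)
    then show "norm \<mu> = 0" using least[of \<mu> 0] nonneg[of \<mu>] by simp
  qed
  show "norm (r *\<^sub>R \<mu>) = \<bar>r\<bar> * norm \<mu>" for r and \<mu> :: smeasure
  proof -
    have le: "norm (s *\<^sub>R \<nu>) \<le> \<bar>s\<bar> * norm \<nu>" for s and \<nu> :: smeasure
    proof (rule least)
      fix \<phi> assume t: "\<phi> \<in> tv_tests (s *\<^sub>R \<nu>)"
      have "sintegral (s *\<^sub>R \<nu>) \<phi> = s * sintegral \<nu> \<phi>"
        using tv_testsD[OF t] by (rule sintegral_scaleR)
      also have "\<dots> \<le> \<bar>s\<bar> * \<bar>sintegral \<nu> \<phi>\<bar>" by (metis abs_ge_self abs_mult)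
      also have "\<dots> \<le> \<bar>s\<bar> * norm \<nu>"
        using abs[of \<phi> \<nu>] t same by (metis abs_ge_zero mult_left_mono)
      finally show "sintegral (s *\<^sub>R \<nu>) \<phi> \<le> \<bar>s\<bar> * norm \<nu>" .
    qed
    show ?thesis
    proof (cases "r = 0")
      case True
      then show ?thesis using le[of 0 \<mu>] nonneg[of "r *\<^sub>R \<mu>"] by simp
    next
      case False
      have "\<bar>r\<bar> * norm \<mu> = \<bar>r\<bar> * norm (inverse r *\<^sub>R (r *\<^sub>R \<mu>))" using False by simp
      also have "\<dots> \<le> \<bar>r\<bar> * (\<bar>inverse r\<bar> * norm (r *\<^sub>R \<mu>))"
        by (intro mult_left_mono le) simp
      also have "\<dots> = norm (r *\<^sub>R \<mu>)" using False by simp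
      finally show ?thesis using le[of r \<mu>] by simp
    qed
  qed
qed (rule sgn_smeasure_def dist_smeasure_def uniformity_smeasure_def open_smeasure_def)+

end

subsection \<open>Non-negative measures, weights, Mellin convolution\<close>

definition nonneg_measures :: "real measure set" where
  "nonneg_measures = {M. sets M = sets rplus \<and> finite_measure M}"

definition of_measure :: "real measure \<Rightarrow> smeasure" where
  "of_measure M = Abs_smeasure (measure M)"

lemma smeas_of_measure:
  assumes "M \<in> nonneg_measures"
  shows "smeas (of_measure M) A = measure M A"
proof -
  interpret finite_measure M using assms by (simp add: nonneg_measures_def)
  have "sets M = sets rplus" using assms by (simp add: nonneg_measures_def)
  then show ?thesis unfolding of_measure_def
    by (subst Abs_smeasure_inverse) (auto simp: measure_notin_sets intro!: finite_measure_UNION)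
qed

lemma sintegral_of_measure:
  assumes M: "M \<in> nonneg_measures"
    and f: "f \<in> borel_measurable rplus" "\<And>x. 0 \<le> x \<Longrightarrow> \<bar>f x\<bar> \<le> c"
  shows "sintegral (of_measure M) f = (\<integral>x. f x \<partial>M)"
proof -
  have "sintegral (of_measure M) f = (\<integral>x. f x \<partial>M) - (\<integral>x. f x \<partial>null_measure M)"
    using M f
    by (intro sintegral_eqI[where c = c])
       (auto simp: nonneg_measures_def smeas_of_measure intro!: finite_measureI)
  then show ?thesis by simp
qed

text \<open>
  The measure \<open>f \<mu>\<close> for a function \<open>f \<ge> 0\<close> that is integrable with respect to \<open>\<mu>\<close>.
\<close>

definition weight :: "(real \<Rightarrow> real) \<Rightarrow> smeasure \<Rightarrow> smeasure" where
  "weight f \<mu> = of_measure (density (pos_part \<mu>) (\<lambda>x. ennreal (f x)))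
    - of_measure (density (neg_part \<mu>) (\<lambda>x. ennreal (f x)))"

definition mellin :: "real measure \<Rightarrow> real measure \<Rightarrow> real measure" where
  "mellin P Q = distr (P \<Otimes>\<^sub>M Q) rplus (\<lambda>(x, y). x * y)"

text \<open>
  Mellin (multiplicative) convolution; the characterisation by test functions is
  \<open>sintegral_mconv\<close> below.
\<close>

definition mconv :: "smeasure \<Rightarrow> smeasure \<Rightarrow> smeasure" (infixl "\<star>" 70) where
  "\<mu> \<star> \<nu> =
      of_measure (mellin (pos_part \<mu>) (pos_part \<nu>)) + of_measure (mellin (neg_part \<mu>) (neg_part \<nu>))
    - of_measure (mellin (pos_part \<mu>) (neg_part \<nu>)) - of_measure (mellin (neg_part \<mu>) (pos_part \<nu>))"

lemma measurable_mult_rplus: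
  assumes "sets P = sets rplus" "sets Q = sets rplus"
  shows "(\<lambda>(x, y). x * y) \<in> measurable (P \<Otimes>\<^sub>M Q) rplus"
proof -
  have id: "(\<lambda>x. x) \<in> measurable M borel" if "sets M = sets rplus" for M :: "real measure"
  proof -
    have "(\<lambda>x. x) \<in> measurable rplus (borel :: real measure)" by (rule measurable_restrict_space1) simp
    then show ?thesis using that by (simp cong: measurable_cong_sets)
  qed
  have sp: "space P = {0..}" "space Q = {0..}"
    using assms by (simp add: space_eq_rplus)+
  have "(\<lambda>z. fst z * snd z) \<in> borel_measurable (P \<Otimes>\<^sub>M Q)"
    using measurable_compose[OF measurable_fst id[OF assms(1)], of Q]
      measurable_compose[OF measurable_snd id[OF assms(2)], of P]
    by (rule borel_measurable_times)
  then show ?thesis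
    using sp by (intro measurable_restrict_space2) (auto simp: space_pair_measure split_beta')
qed

lemma mellin_nonneg:
  assumes "P \<in> nonneg_measures" "Q \<in> nonneg_measures"
  shows "mellin P Q \<in> nonneg_measures"
proof -
  have PQ: "finite_measure P" "finite_measure Q" "sets P = sets rplus" "sets Q = sets rplus"
    using assms by (auto simp: nonneg_measures_def)
  then show ?thesis
    by (auto simp: nonneg_measures_def mellin_def finite_measure_pair_measure
        intro!: finite_measure.finite_measure_distr measurable_mult_rplus)
qed

lemma integral_mellin:
  assumes "P \<in> nonneg_measures" "Q \<in> nonneg_measures"
    and f: "f \<in> borel_measurable rplus" "\<And>x. 0 \<le> x \<Longrightarrow> \<bar>f x\<bar> \<le> (c :: real)"
  shows "(\<integral>z. f z \<partial>mellin P Q) = (\<integral>x. (\<integral>y. f (x * y) \<partial>Q) \<partial>P)"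
proof -
  have PQ: "finite_measure P" "finite_measure Q" "sets P = sets rplus" "sets Q = sets rplus"
    using assms by (auto simp: nonneg_measures_def)
  interpret P: finite_measure P by fact
  interpret Q: finite_measure Q by fact
  interpret PQ: pair_sigma_finite P Q ..
  have sp: "space P = {0..}" "space Q = {0..}"
    using PQ by (simp_all add: space_eq_rplus)
  note m = measurable_mult_rplus[OF PQ(3,4)]
  have "integrable (mellin P Q) f"
    using mellin_nonneg[OF assms(1,2)] f
    by (intro integrable_bounded_rplus[where c = c]) (auto simp: nonneg_measures_def)
  then have "integrable (P \<Otimes>\<^sub>M Q) (\<lambda>z. f (case z of (x, y) \<Rightarrow> x * y))"
    unfolding mellin_def using m f by (simp add: integrable_distr_eq)
  then have "integrable (P \<Otimes>\<^sub>M Q) (\<lambda>(x, y). f (x * y))" by (simp add: split_beta')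
  from PQ.integral_fst[OF this] show ?thesis
    unfolding mellin_def using m f by (simp add: integral_distr split_beta')
qed

lemma sintegral_mconv:
  assumes f: "f \<in> borel_measurable rplus" "\<And>x. 0 \<le> x \<Longrightarrow> \<bar>f x\<bar> \<le> c"
  shows "sintegral (\<mu> \<star> \<nu>) f = sintegral \<mu> (\<lambda>x. sintegral \<nu> (\<lambda>y. f (x * y)))"
proof -
  have nn: "pos_part \<rho> \<in> nonneg_measures" "neg_part \<rho> \<in> nonneg_measures" for \<rho>
    by (auto simp: nonneg_measures_def finite_pos_part finite_neg_part)
  have diff: "sintegral (\<rho> - \<rho>') f = sintegral \<rho> f - sintegral \<rho>' f" for \<rho> \<rho>'
    using sintegral_add[OF f, of \<rho> "- \<rho>'"] by (simp add: sintegral_uminus)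
  have int: "integrable P (\<lambda>x. \<integral>y. f (x * y) \<partial>Q)"
    if "P \<in> nonneg_measures" "Q \<in> nonneg_measures" for P Q
  proof -
    have PQ: "finite_measure P" "finite_measure Q" "sets P = sets rplus" "sets Q = sets rplus"
      using that by (auto simp: nonneg_measures_def)
    interpret P: finite_measure P by fact
    interpret Q: finite_measure Q by fact
    interpret PQ: pair_sigma_finite P Q ..
    have "integrable (mellin P Q) f"
      using mellin_nonneg[OF that] f
      by (intro integrable_bounded_rplus[where c = c]) (auto simp: nonneg_measures_def)
    then have "integrable (P \<Otimes>\<^sub>M Q) (\<lambda>(x, y). f (x * y))"
      unfolding mellin_def using measurable_mult_rplus[OF PQ(3,4)] f
      by (simp add: integrable_distr_eq split_beta')
    then show ?thesis by (rule PQ.integrable_fst)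
  qed
  show ?thesis
    unfolding mconv_def using f
    by (simp add: diff sintegral_add[OF f] sintegral_of_measure[OF _ f] mellin_nonneg nn
        integral_mellin[OF _ _ f])
       (simp add: sintegral_def int nn)
qed

section \<open>The fragmentation equation\<close>

text \<open>
  \<open>x\<^sup>\<gamma>\<close> for \<open>x \<ge> 0\<close>, with \<open>0\<^sup>0 = 1\<close>; the library has \<open>0 powr 0 = 0\<close>, which would change the
  fragmentation rate at \<open>x = 0\<close> for \<open>\<gamma> = 0\<close>.
\<close>

definition rpow :: "real \<Rightarrow> real \<Rightarrow> real" where
  "rpow x \<gamma> = (if \<gamma> = 0 then 1 else x powr \<gamma>)"

definition fragmentation_kernel :: "real measure \<Rightarrow> bool" where
  "fragmentation_kernel \<kappa> \<longleftrightarrow> \<kappa> \<in> nonneg_measures \<and>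
    emeasure \<kappa> {0} = 0 \<and> emeasure \<kappa> {1} = 0 \<and> msupp \<kappa> \<subseteq> {0..1} \<and>
    (LINT z:{0..1}|\<kappa>. z) = 1"

definition admissible_datum :: "real measure \<Rightarrow> bool" where
  "admissible_datum \<mu>\<^sub>0 \<longleftrightarrow> \<mu>\<^sub>0 \<in> nonneg_measures \<and> compact (msupp \<mu>\<^sub>0)"

definition narrowly_continuous :: "(real \<Rightarrow> smeasure) \<Rightarrow> bool" where
  "narrowly_continuous \<mu> \<longleftrightarrow>
    (\<forall>\<phi>. continuous_on {0..} \<phi> \<longrightarrow> bounded (\<phi> ` {0..}) \<longrightarrow>
      continuous_on {0..} (\<lambda>t. sintegral (\<mu> t) \<phi>))"

definition frag_adjoint :: "real \<Rightarrow> real \<Rightarrow> real measure \<Rightarrow> (real \<Rightarrow> real) \<Rightarrow> real \<Rightarrow> real" where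
  "frag_adjoint \<alpha> \<gamma> \<kappa> \<phi> x = \<alpha> * rpow x \<gamma> * (- \<phi> x + (LINT z:{0..1}|\<kappa>. \<phi> (x * z)))"

text \<open>
  The integrability clauses are the standing requirement that all integrals in the weak
  formulation exist; without them an undefined integral would silently be \<open>0\<close>.
\<close>

definition weak_solution ::
    "real \<Rightarrow> real \<Rightarrow> real measure \<Rightarrow> real measure \<Rightarrow> (real \<Rightarrow> smeasure) \<Rightarrow> bool" where
  "weak_solution \<alpha> \<gamma> \<kappa> \<mu>\<^sub>0 \<mu> \<longleftrightarrow> narrowly_continuous \<mu> \<and>
    (\<forall>\<phi>. continuous_on {0..} \<phi> \<longrightarrow> bounded ((\<lambda>x. \<phi> x / (1 + x)) ` {0..}) \<longrightarrow>
      integrable \<mu>\<^sub>0 \<phi> \<and>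
      (\<forall>x\<ge>0. set_integrable \<kappa> {0..1} (\<lambda>z. \<phi> (x * z))) \<and>
      (\<forall>t\<ge>0. sintegrable (\<mu> t) \<phi> \<and> sintegrable (\<mu> t) (frag_adjoint \<alpha> \<gamma> \<kappa> \<phi>) \<and>
        set_integrable lborel {0..t} (\<lambda>s. sintegral (\<mu> s) (frag_adjoint \<alpha> \<gamma> \<kappa> \<phi>)) \<and>
        sintegral (\<mu> t) \<phi> = (\<integral>x. \<phi> x \<partial>\<mu>\<^sub>0) +
          (LINT s:{0..t}|lborel. sintegral (\<mu> s) (frag_adjoint \<alpha> \<gamma> \<kappa> \<phi>))))"

text \<open>
  For densities, \<open>\<integral>\<^sub>x\<^sup>\<infinity> y\<^sup>\<gamma>\<^sup>-\<^sup>1 \<kappa>(x/y) a(y) dy\<close> is the density of the Mellin convolution of \<open>\<kappa>\<close> with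
  \<open>y\<^sup>\<gamma> a\<close>.
\<close>

primrec frag_coeff :: "real \<Rightarrow> real measure \<Rightarrow> nat \<Rightarrow> smeasure" where
  "frag_coeff \<gamma> \<kappa> 0 = 0"
| "frag_coeff \<gamma> \<kappa> (Suc n) = (1 / (real n + 1)) *\<^sub>R
    (- weight (\<lambda>x. rpow x \<gamma>) (frag_coeff \<gamma> \<kappa> n)
     + of_measure \<kappa> \<star> weight (\<lambda>y. rpow y \<gamma>) (frag_coeff \<gamma> \<kappa> n)
     + ((-1) ^ n / fact n) *\<^sub>R of_measure \<kappa>)"

definition dirac_one :: "real measure" where
  "dirac_one = return rplus 1"

definition fundamental_solution :: "real \<Rightarrow> real \<Rightarrow> real measure \<Rightarrow> real \<Rightarrow> smeasure" where
  "fundamental_solution \<alpha> \<gamma> \<kappa> t = exp (- \<alpha> * t) *\<^sub>R of_measure dirac_one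
    + (\<Sum>n. (\<alpha> * t) ^ Suc n *\<^sub>R frag_coeff \<gamma> \<kappa> (Suc n))"

text \<open>
  Sizes reachable by fragmentation from sizes in \<open>S\<close>. The support of a solution is in general not
  contained in the support of the datum (a Dirac mass at \<open>1\<close> produces fragments of size
  \<open>< 1\<close>), only in its fragment hull; the two agree when the support is an interval \<open>[0,L]\<close>.
\<close>

definition fragment_hull :: "real set \<Rightarrow> real set" where
  "fragment_hull S = {z * l | z l. 0 \<le> z \<and> z \<le> 1 \<and> l \<in> S}"

end

theory Submission
  imports Defs
begin

text \<open>
  Up to the factor \<open>\<alpha>\<close>, the right-hand side of the fragmentation equation is the linear operator
  \<open>A \<mu> = - x\<^sup>\<gamma> \<mu> + \<kappa> \<star> (x\<^sup>\<gamma> \<mu>)\<close>. On measures carried by \<open>[0,L]\<close> it is bounded for the total variation,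
  with norm at most \<open>L\<^sup>\<gamma> (1 + N)\<close>, because fragments are never larger than their parent, so that \<open>A\<close>
  preserves such measures. The solution is therefore \<open>exp (\<alpha> t A) \<mu>\<^sub>0\<close>, a power series in \<open>t\<close> whose
  coefficients are bounded by \<open>C\<^sup>n / n!\<close>.

  For the datum \<open>\<delta>\<^sub>1\<close> the coefficients are \<open>b\<^sub>n = (-1)\<^sup>n / n! \<delta>\<^sub>1 + a\<^sub>n\<close>: since \<open>A \<delta>\<^sub>1 = \<kappa> - \<delta>\<^sub>1\<close>, the
  recursion for \<open>a\<^sub>n\<close> says exactly that \<open>(n + 1) b\<^sub>n\<^sub>+\<^sub>1 = A b\<^sub>n\<close> (\<open>sintegral_frag_term_Suc\<close>). For a general
  datum the homogeneity of the fragmentation rate gives \<open>A\<^sup>n \<delta>\<^sub>l / n! = l\<^sup>n\<^sup>\<gamma>\<close> times the dilation of \<open>b\<^sub>n\<close>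
  by \<open>l\<close>, so that the coefficients are the Mellin convolutions \<open>b\<^sub>n \<star> (l\<^sup>n\<^sup>\<gamma> \<mu>\<^sub>0)\<close>
  (\<open>sintegral_mixed_term_Suc\<close>). Splitting off the Dirac part of \<open>b\<^sub>n\<close>, which sums to
  \<open>exp (- \<alpha> x\<^sup>\<gamma> t) \<mu>\<^sub>0\<close>, leaves the stated series (\<open>solution_series_sums\<close>), and exchanging the sum over
  \<open>n\<close> with the integral over \<open>\<mu>\<^sub>0\<close> gives the representation by the fundamental solution
  (\<open>disintegration\<close>).

  All identities are proved after pairing with test functions. A signed measure is determined by
  the functional \<open>f \<mapsto> sintegral \<mu> f\<close> on bounded measurable functions, its total variation is the
  norm of that functional, and the dual of \<open>A\<close> is \<open>frag_adjoint 1 \<gamma> \<kappa>\<close>. In particular the pairing of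
  the solution with a test function is a real power series in \<open>\<alpha> t\<close>; its term-by-term derivative is
  the pairing with the dual operator, and the weak formulation is the fundamental theorem of
  calculus (\<open>weak_solution_power_sum\<close>).
\<close>

section \<open>Signed measures as functionals on bounded measurable functions\<close>

lemma interval_in_rplus [simp]: "{0..L :: real} \<in> sets rplus"
  by (auto simp: sets_restrict_space_iff)

lemma borel_measurable_indicator_rplus [simp]:
  "A \<in> sets rplus \<Longrightarrow> (indicator A :: real \<Rightarrow> real) \<in> borel_measurable rplus"
  by (rule borel_measurable_indicator)

lemma borel_measurable_pos_neg:
  assumes "f \<in> borel_measurable rplus"
  shows "f \<in> borel_measurable (pos_part \<mu>)" "f \<in> borel_measurable (neg_part \<mu>)"
    "f \<in> borel_measurable (variation \<mu>)"
  using assms by (auto cong: measurable_cong_sets)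

text \<open>
  The coefficients and solutions live on intervals \<open>[0,L]\<close>, where \<open>x\<^sup>\<gamma>\<close> and the test functions are
  bounded even though they need not be bounded on the half line.
\<close>

definition concentrated_on :: "real set \<Rightarrow> smeasure \<Rightarrow> bool" where
  "concentrated_on S \<mu> \<longleftrightarrow> (\<forall>A\<in>sets rplus. A \<inter> S = {} \<longrightarrow> smeas \<mu> A = 0)"

lemma concentrated_on_half_line: "concentrated_on {0..} \<mu>"
  unfolding concentrated_on_def
proof (intro ballI impI)
  fix A assume "A \<in> sets rplus" "A \<inter> {0..} = {}"
  then have "A = {}" using sets.sets_into_space[of A rplus] by auto
  then show "smeas \<mu> A = 0" by simp
qed

lemma concentrated_on_scaleR: "concentrated_on S \<mu> \<Longrightarrow> concentrated_on S (r *\<^sub>R \<mu>)"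
  and concentrated_on_add: "concentrated_on S \<mu> \<Longrightarrow> concentrated_on S \<nu> \<Longrightarrow> concentrated_on S (\<mu> + \<nu>)"
  and concentrated_on_uminus: "concentrated_on S \<mu> \<Longrightarrow> concentrated_on S (- \<mu>)"
  by (auto simp: concentrated_on_def)

lemma AE_pos_part:
  assumes S: "S \<in> sets rplus" and \<mu>: "concentrated_on S \<mu>"
  shows "AE x in pos_part \<mu>. x \<in> S"
proof (rule AE_I')
  have d: "{0..} - S \<in> sets rplus" using S by auto
  have "(SUP B\<in>{B \<in> sets rplus. B \<subseteq> {0..} - S}. smeas \<mu> B) =
      (SUP B\<in>{B \<in> sets rplus. B \<subseteq> {0..} - S}. 0)"
    using \<mu> by (intro SUP_cong) (auto simp: concentrated_on_def)
  also have "\<dots> = 0" by (rule cSUP_const) auto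
  finally show "{0..} - S \<in> null_sets (pos_part \<mu>)"
    using d by (simp add: null_sets_def emeasure_pos_part)
qed auto

lemma AE_neg_part:
  assumes S: "S \<in> sets rplus" and \<mu>: "concentrated_on S \<mu>"
  shows "AE x in neg_part \<mu>. x \<in> S"
  unfolding neg_part_def using assms by (intro AE_pos_part) (auto simp: concentrated_on_def)

lemma integrable_pos_neg:
  fixes f :: "real \<Rightarrow> real"
  assumes S: "S \<in> sets rplus" and \<mu>: "concentrated_on S \<mu>"
    and f: "f \<in> borel_measurable rplus" "\<And>x. x \<in> S \<Longrightarrow> \<bar>f x\<bar> \<le> c"
  shows "integrable (pos_part \<mu>) f" "integrable (neg_part \<mu>) f" "sintegrable \<mu> f"
proof -
  have "AE x in pos_part \<mu>. norm (f x) \<le> c" "AE x in neg_part \<mu>. norm (f x) \<le> c"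
    using AE_pos_part[OF S \<mu>] AE_neg_part[OF S \<mu>] by (auto simp: f elim!: eventually_mono)
  then show p: "integrable (pos_part \<mu>) f" and n: "integrable (neg_part \<mu>) f"
    using borel_measurable_pos_neg[OF f(1)]
    by (auto intro!: finite_measure.integrable_const_bound[where B = c] finite_pos_part finite_neg_part)
  show "sintegrable \<mu> f"
    unfolding sintegrable_def variation_def by (rule integral_add_measure(1)[OF p n]) simp
qed

lemma sintegral_cong_on:
  assumes S: "S \<in> sets rplus" and \<mu>: "concentrated_on S \<mu>"
    and f: "f \<in> borel_measurable rplus" "g \<in> borel_measurable rplus" "\<And>x. x \<in> S \<Longrightarrow> f x = g x"
  shows "sintegral \<mu> f = sintegral \<mu> g"
proof -
  have "AE x in pos_part \<mu>. f x = g x" "AE x in neg_part \<mu>. f x = g x"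
    using AE_pos_part[OF S \<mu>] AE_neg_part[OF S \<mu>] by (auto simp: f elim!: eventually_mono)
  then show ?thesis
    unfolding sintegral_def
    using borel_measurable_pos_neg[OF f(1)] borel_measurable_pos_neg[OF f(2)]
    by (metis integral_cong_AE)
qed

lemma sintegral_cong: "(\<And>x. 0 \<le> x \<Longrightarrow> f x = g x) \<Longrightarrow> sintegral \<mu> f = sintegral \<mu> g"
  unfolding sintegral_def by (intro arg_cong2[of _ _ _ _ "(-)"] Bochner_Integration.integral_cong) auto

lemma sintegral_cmult: "sintegral \<mu> (\<lambda>x. c * f x) = c * sintegral \<mu> f"
  by (simp add: sintegral_def algebra_simps)

lemma sintegral_add_fun:
  assumes S: "S \<in> sets rplus" and \<mu>: "concentrated_on S \<mu>"
    and f: "f \<in> borel_measurable rplus" "\<And>x. x \<in> S \<Longrightarrow> \<bar>f x\<bar> \<le> c"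
    and g: "g \<in> borel_measurable rplus" "\<And>x. x \<in> S \<Longrightarrow> \<bar>g x\<bar> \<le> d"
  shows "sintegral \<mu> (\<lambda>x. f x + g x) = sintegral \<mu> f + sintegral \<mu> g"
  using integrable_pos_neg[OF S \<mu> f] integrable_pos_neg[OF S \<mu> g] by (simp add: sintegral_def)

lemma sintegral_indicator:
  assumes "A \<in> sets rplus"
  shows "sintegral \<mu> (indicator A) = smeas \<mu> A"
  using assms sets.sets_into_space[OF assms]
  by (simp add: sintegral_def smeas_Jordan Int_absorb2)

text \<open>
  Indicator functions are among the test functions, and their integrals are the values of the
  set function.
\<close>

lemma smeasure_eqI_sintegral:
  assumes "\<And>f. f \<in> borel_measurable rplus \<Longrightarrow> (\<And>x. \<bar>f x\<bar> \<le> 1) \<Longrightarrow> sintegral \<mu> f = sintegral \<nu> f"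
  shows "\<mu> = \<nu>"
proof (rule smeasure_eqI)
  fix A assume "A \<in> sets rplus"
  then show "smeas \<mu> A = smeas \<nu> A"
    using assms[of "indicator A"] by (simp add: sintegral_indicator indicator_def)
qed

lemma concentrated_onI:
  assumes "S \<in> sets rplus"
    and "\<And>f. f \<in> borel_measurable rplus \<Longrightarrow> (\<And>x. \<bar>f x\<bar> \<le> 1) \<Longrightarrow> (\<And>x. x \<in> S \<Longrightarrow> f x = 0)
      \<Longrightarrow> sintegral \<mu> f = 0"
  shows "concentrated_on S \<mu>"
  unfolding concentrated_on_def
proof (intro ballI impI)
  fix A assume A: "A \<in> sets rplus" "A \<inter> S = {}"
  then have "sintegral \<mu> (indicator A) = 0"
    by (intro assms) (auto simp: indicator_def)
  then show "smeas \<mu> A = 0" using A by (simp add: sintegral_indicator)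
qed

subsection \<open>Total variation\<close>

text \<open>
  The mass of the variation measure. The norm of \<open>smeasure\<close> tests with continuous functions only; this
  quantity dominates it and also bounds integrals of discontinuous functions, such as indicators.
\<close>

definition total_variation :: "smeasure \<Rightarrow> real" where
  "total_variation \<mu> = measure (pos_part \<mu>) {0..} + measure (neg_part \<mu>) {0..}"

lemma abs_sintegral_le:
  assumes S: "S \<in> sets rplus" and \<mu>: "concentrated_on S \<mu>" and c: "0 \<le> c"
    and f: "f \<in> borel_measurable rplus" "\<And>x. x \<in> S \<Longrightarrow> \<bar>f x\<bar> \<le> c"
  shows "\<bar>sintegral \<mu> f\<bar> \<le> c * total_variation \<mu>"
proof -
  note int = integrable_pos_neg[OF S \<mu> f]
  have b: "\<bar>\<integral>x. f x \<partial>M\<bar> \<le> c * measure M {0..}"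
    if "finite_measure M" "sets M = sets rplus" "AE x in M. x \<in> S" "integrable M f" for M
  proof -
    interpret finite_measure M by fact
    have "AE x in M. \<bar>f x\<bar> \<le> c" using that(3) by eventually_elim (simp add: f)
    then have "(\<integral>x. \<bar>f x\<bar> \<partial>M) \<le> (\<integral>x. c \<partial>M)"
      using that by (intro integral_mono_AE) auto
    then show ?thesis
      using order_trans[OF integral_abs_bound] that(2) by (simp add: space_eq_rplus mult.commute)
  qed
  from b[OF finite_pos_part _ AE_pos_part[OF S \<mu>] int(1)]
    b[OF finite_neg_part _ AE_neg_part[OF S \<mu>] int(2)]
  show ?thesis by (simp add: sintegral_def total_variation_def algebra_simps abs_le_iff)
qed

lemma total_variation_nonneg: "0 \<le> total_variation \<mu>"
  by (simp add: total_variation_def)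

text \<open>
  Both Jordan parts are suprema of values of \<open>\<mu>\<close> and of \<open>- \<mu>\<close>. The sets \<open>B\<close> and \<open>C\<close> may overlap, so the two
  suprema can be estimated one after the other.
\<close>

lemma total_variation_le_sets:
  assumes "\<And>B C. B \<in> sets rplus \<Longrightarrow> C \<in> sets rplus \<Longrightarrow> smeas \<mu> B - smeas \<mu> C \<le> c"
  shows "total_variation \<mu> \<le> c"
proof -
  have "measure (pos_part \<mu>) {0..} \<le> c - measure (neg_part \<mu>) {0..}"
    unfolding measure_pos_part[OF atLeast_in_rplus]
  proof (rule cSUP_least)
    fix B assume B: "B \<in> {B \<in> sets rplus. B \<subseteq> {0..}}"
    have "measure (neg_part \<mu>) {0..} \<le> c - smeas \<mu> B"
      unfolding neg_part_def measure_pos_part[OF atLeast_in_rplus]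
    proof (rule cSUP_least)
      fix C assume "C \<in> {C \<in> sets rplus. C \<subseteq> {0..}}"
      then show "smeas (- \<mu>) C \<le> c - smeas \<mu> B" using assms[of B C] B by simp
    qed auto
    then show "smeas \<mu> B \<le> c - measure (neg_part \<mu>) {0..}" by simp
  qed auto
  then show ?thesis by (simp add: total_variation_def)
qed

lemma smeas_diff_eq_sintegral:
  assumes "B \<in> sets rplus" "C \<in> sets rplus"
  shows "smeas \<mu> B - smeas \<mu> C = sintegral \<mu> (\<lambda>x. indicator B x + (-1) * indicator C x)"
proof -
  have "sintegral \<mu> (\<lambda>x. indicator B x + (-1) * indicator C x)
      = sintegral \<mu> (indicator B) + sintegral \<mu> (\<lambda>x. (-1) * indicator C x)"
    using assms
    by (intro sintegral_add_fun[OF atLeast_in_rplus concentrated_on_half_line, where c = 1 and d = 1])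
       (auto simp: indicator_def[abs_def] intro!: borel_measurable_uminus borel_measurable_indicator_rplus)
  then show ?thesis using assms unfolding sintegral_cmult by (simp add: sintegral_indicator)
qed

lemma smeas_diff_le_total_variation:
  assumes "B \<in> sets rplus" "C \<in> sets rplus"
  shows "\<bar>smeas \<mu> B - smeas \<mu> C\<bar> \<le> total_variation \<mu>"
  unfolding smeas_diff_eq_sintegral[OF assms]
  using abs_sintegral_le[OF atLeast_in_rplus concentrated_on_half_line, of 1
      "\<lambda>x. indicator B x + (-1) * indicator C x" \<mu>] assms
  by (auto simp: indicator_def)

text \<open>
  The converse of \<open>abs_sintegral_le\<close>: it reduces bounds on the total variation to bounds on
  integrals, for which product and density formulas are available.
\<close>

lemma total_variation_le:
  assumes "\<And>f. f \<in> borel_measurable rplus \<Longrightarrow> (\<And>x. \<bar>f x\<bar> \<le> 1) \<Longrightarrow> sintegral \<mu> f \<le> c"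
  shows "total_variation \<mu> \<le> c"
proof (rule total_variation_le_sets)
  fix B C :: "real set" assume "B \<in> sets rplus" "C \<in> sets rplus"
  then show "smeas \<mu> B - smeas \<mu> C \<le> c"
    unfolding smeas_diff_eq_sintegral[OF \<open>B \<in> sets rplus\<close> \<open>C \<in> sets rplus\<close>]
    by (intro assms) (auto simp: indicator_def)
qed

lemma norm_le_total_variation: "norm \<mu> \<le> total_variation \<mu>"
  unfolding norm_smeasure_def
proof (rule cSUP_least)
  show "tv_tests \<mu> \<noteq> {}" using tv_tests_iff[of "\<lambda>_. 0"] by auto
next
  fix \<phi> assume "\<phi> \<in> tv_tests \<mu>"
  note t = tv_testsD[OF this]
  show "sintegral \<mu> \<phi> \<le> total_variation \<mu>"
    using abs_sintegral_le[OF atLeast_in_rplus concentrated_on_half_line, of 1 \<phi> \<mu>] t by auto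
qed

lemma total_variation_scaleR_le: "total_variation (r *\<^sub>R \<mu>) \<le> \<bar>r\<bar> * total_variation \<mu>"
proof (rule total_variation_le_sets)
  fix B C :: "real set" assume "B \<in> sets rplus" "C \<in> sets rplus"
  then have "\<bar>r\<bar> * \<bar>smeas \<mu> B - smeas \<mu> C\<bar> \<le> \<bar>r\<bar> * total_variation \<mu>"
    by (intro mult_left_mono smeas_diff_le_total_variation) auto
  then show "smeas (r *\<^sub>R \<mu>) B - smeas (r *\<^sub>R \<mu>) C \<le> \<bar>r\<bar> * total_variation \<mu>"
    by (simp add: abs_mult[symmetric] right_diff_distrib)
qed

subsection \<open>Series that converge in total variation\<close>

lemma smeas_sum: "smeas (\<Sum>i\<in>I. \<nu> i) A = (\<Sum>i\<in>I. smeas (\<nu> i) A)"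
  by (induction I rule: infinite_finite_induct) auto

text \<open>
  A bound that is uniform in \<open>k\<close>, as required for the dominated interchange of limit and sum in
  \<open>smeasure_series_limit\<close>.
\<close>

lemma abs_sum_smeas_disjoint_le:
  fixes A :: "nat \<Rightarrow> real set"
  assumes A: "range A \<subseteq> sets rplus" "disjoint_family A"
  shows "\<bar>\<Sum>i<k. smeas \<mu> (A i)\<bar> \<le> total_variation \<mu>"
proof -
  define A' where "A' i = (if i < k then A i else {})" for i
  have A': "range A' \<subseteq> sets rplus" "disjoint_family A'"
    using A by (auto simp: A'_def disjoint_family_on_def)
  have "(\<lambda>i. smeas \<mu> (A' i)) sums (\<Sum>i<k. smeas \<mu> (A' i))"
    by (rule sums_finite) (auto simp: A'_def)
  then have "(\<Sum>i<k. smeas \<mu> (A' i)) = smeas \<mu> (\<Union>i. A' i)"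
    using smeas_sums[OF A'] by (rule sums_unique2)
  then have "(\<Sum>i<k. smeas \<mu> (A i)) = smeas \<mu> (\<Union>i. A' i)" by (simp add: A'_def)
  moreover have "(\<Union>i. A' i) \<in> sets rplus" using A' by blast
  ultimately show ?thesis
    using smeas_diff_le_total_variation[of "\<Union>i. A' i" "{}" \<mu>] by simp
qed

lemma suminf_tail_tendsto_0:
  fixes \<beta> :: "nat \<Rightarrow> real"
  assumes "summable \<beta>"
  shows "(\<lambda>k. \<Sum>n. \<beta> (n + k)) \<longlonglongrightarrow> 0"
proof -
  have "(\<lambda>k. suminf \<beta> - (\<Sum>n<k. \<beta> n)) \<longlonglongrightarrow> suminf \<beta> - suminf \<beta>"
    by (intro tendsto_intros summable_LIMSEQ assms)
  then show ?thesis using suminf_minus_initial_segment[OF assms] by simp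
qed

text \<open>
  The limit is defined set by set. Its countable additivity is Tannery's theorem: the limit over
  finite subfamilies of a disjoint family passes through the sum over \<open>n\<close> because the \<open>n\<close>-th term
  is at most \<open>\<beta> n\<close> throughout.
\<close>

lemma smeasure_series_limit:
  fixes \<nu> :: "nat \<Rightarrow> smeasure"
  assumes le: "\<And>n. total_variation (\<nu> n) \<le> \<beta> n" and \<beta>: "summable \<beta>"
  obtains \<mu> where "\<And>k. total_variation ((\<Sum>n<k. \<nu> n) - \<mu>) \<le> (\<Sum>n. \<beta> (n + k))"
proof -
  have bd: "norm (smeas (\<nu> n) A) \<le> \<beta> n" for n A
  proof (cases "A \<in> sets rplus")
    case True
    then show ?thesis using smeas_diff_le_total_variation[of A "{}" "\<nu> n"] le[of n] by simp
  next
    case False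
    then show ?thesis using total_variation_nonneg[of "\<nu> n"] le[of n] by (simp add: smeas_notin)
  qed
  have sm: "summable (\<lambda>n. smeas (\<nu> n) A)" for A
    using \<beta> bd by (rule summable_comparison_test'[where N = 0])
  define m where "m A = (\<Sum>n. smeas (\<nu> n) A)" for A
  have madd: "(\<lambda>i. m (A i)) sums m (\<Union>i. A i)"
    if A: "range A \<subseteq> sets rplus" "disjoint_family A" for A :: "nat \<Rightarrow> real set"
  proof -
    have "(\<lambda>k. \<Sum>n. (\<Sum>i<k. smeas (\<nu> n) (A i))) \<longlonglongrightarrow> (\<Sum>n. smeas (\<nu> n) (\<Union>i. A i))"
    proof (rule tannerys_theorem[THEN conjunct2, THEN conjunct2])
      show "(\<lambda>k. \<Sum>i<k. smeas (\<nu> n) (A i)) \<longlonglongrightarrow> smeas (\<nu> n) (\<Union>i. A i)" for n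
        using smeas_sums[OF A] by (simp add: sums_def)
      show "\<forall>\<^sub>F (n, k) in sequentially \<times>\<^sub>F sequentially. norm (\<Sum>i<k. smeas (\<nu> n) (A i)) \<le> \<beta> n"
        using abs_sum_smeas_disjoint_le[OF A] le by (intro always_eventually) (auto intro: order_trans)
    qed (use \<beta> in auto)
    then show ?thesis
      unfolding sums_def m_def using sm by (subst (asm) suminf_sum) auto
  qed
  define \<mu> where "\<mu> = Abs_smeasure m"
  have \<mu>: "smeas \<mu> A = (\<Sum>n. smeas (\<nu> n) A)" for A
    unfolding \<mu>_def using madd by (subst Abs_smeasure_inverse) (auto simp: m_def smeas_notin)
  have "total_variation ((\<Sum>n<k. \<nu> n) - \<mu>) \<le> (\<Sum>n. \<beta> (n + k))" for k
  proof (rule total_variation_le_sets)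
    fix B C :: "real set" assume BC: "B \<in> sets rplus" "C \<in> sets rplus"
    have eq: "smeas ((\<Sum>n<k. \<nu> n) - \<mu>) D = - (\<Sum>n. smeas (\<nu> (n + k)) D)" for D :: "real set"
      using suminf_minus_initial_segment[OF sm[of D], of k] by (simp add: smeas_sum \<mu>)
    have sk: "summable (\<lambda>n. smeas (\<nu> (n + k)) D)" for D :: "real set"
      using summable_ignore_initial_segment[OF sm] .
    have "smeas (\<nu> n) C - smeas (\<nu> n) B \<le> \<beta> n" for n
      using smeas_diff_le_total_variation[OF BC, of "\<nu> n"] le[of n] by linarith
    then have "(\<Sum>n. smeas (\<nu> (n + k)) C - smeas (\<nu> (n + k)) B) \<le> (\<Sum>n. \<beta> (n + k))"
      using summable_ignore_initial_segment[OF \<beta>] sk by (intro suminf_le summable_diff) auto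
    then show "smeas ((\<Sum>n<k. \<nu> n) - \<mu>) B - smeas ((\<Sum>n<k. \<nu> n) - \<mu>) C \<le> (\<Sum>n. \<beta> (n + k))"
      unfolding eq using suminf_diff[OF sk[of C] sk[of B]] by simp
  qed
  then show thesis by (rule that)
qed

text \<open>
  An absolutely convergent series of measures may be integrated term by term. Together with
  \<open>norm_le_total_variation\<close> this gives convergence in norm directly from the explicit limit.
\<close>

lemma smeasure_series:
  fixes \<nu> :: "nat \<Rightarrow> smeasure"
  assumes le: "\<And>n. total_variation (\<nu> n) \<le> \<beta> n" and \<beta>: "summable \<beta>"
    and S: "S \<in> sets rplus" and conc: "\<And>n. concentrated_on S (\<nu> n)"
  shows "summable \<nu>" "concentrated_on S (\<Sum>n. \<nu> n)"
    "\<And>f c. f \<in> borel_measurable rplus \<Longrightarrow> (\<And>x. x \<in> S \<Longrightarrow> \<bar>f x\<bar> \<le> c)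
       \<Longrightarrow> (\<lambda>n. sintegral (\<nu> n) f) sums sintegral (\<Sum>n. \<nu> n) f"
proof -
  obtain \<mu> where t: "\<And>k. total_variation ((\<Sum>n<k. \<nu> n) - \<mu>) \<le> (\<Sum>n. \<beta> (n + k))"
    using smeasure_series_limit[OF le \<beta>] by blast
  note tail = suminf_tail_tendsto_0[OF \<beta>]
  have "(\<lambda>k. (\<Sum>n<k. \<nu> n) - \<mu>) \<longlonglongrightarrow> 0"
    using norm_le_total_variation t
    by (intro Lim_null_comparison[OF _ tail] always_eventually) (blast intro: order_trans)
  then have "\<nu> sums \<mu>" unfolding sums_def by (rule LIM_zero_cancel)
  then have \<mu>: "(\<Sum>n. \<nu> n) = \<mu>" and "summable \<nu>" by (auto simp: sums_iff)
  then show "summable \<nu>" by simp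
  \<comment> \<open>For test functions bounded on the half line; those bounded only on \<open>S\<close> are truncated at the end.\<close>
  have psum: "sintegral (\<Sum>n<k. \<nu> n) f = (\<Sum>n<k. sintegral (\<nu> n) f)"
    if f: "f \<in> borel_measurable rplus" "\<And>x. 0 \<le> x \<Longrightarrow> \<bar>f x\<bar> \<le> c" for f c k
  proof (induction k)
    case 0
    then show ?case using sintegral_scaleR[OF f, of 0 \<mu>] by simp
  next
    case (Suc k)
    then show ?case by (simp add: sintegral_add[OF f])
  qed
  have bdd: "(\<lambda>n. sintegral (\<nu> n) f) sums sintegral \<mu> f"
    if f: "f \<in> borel_measurable rplus" "\<And>x. 0 \<le> x \<Longrightarrow> \<bar>f x\<bar> \<le> c" for f c
    unfolding sums_def
  proof (rule LIM_zero_cancel, rule Lim_null_comparison)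
    show "(\<lambda>k. \<bar>c\<bar> * (\<Sum>n. \<beta> (n + k))) \<longlonglongrightarrow> 0"
      using tendsto_mult_left[OF tail, of "\<bar>c\<bar>"] by simp
    have "norm ((\<Sum>n<k. sintegral (\<nu> n) f) - sintegral \<mu> f) \<le> \<bar>c\<bar> * (\<Sum>n. \<beta> (n + k))" for k
    proof -
      have "(\<Sum>n<k. sintegral (\<nu> n) f) - sintegral \<mu> f = sintegral ((\<Sum>n<k. \<nu> n) - \<mu>) f"
        using sintegral_add[OF f, of "(\<Sum>n<k. \<nu> n)" "- \<mu>"] by (simp add: sintegral_uminus psum[OF f])
      also have "\<bar>\<dots>\<bar> \<le> \<bar>c\<bar> * total_variation ((\<Sum>n<k. \<nu> n) - \<mu>)"
        using order_trans[OF f(2) abs_ge_self]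
        by (intro abs_sintegral_le[OF atLeast_in_rplus concentrated_on_half_line _ f(1)]) auto
      also have "\<dots> \<le> \<bar>c\<bar> * (\<Sum>n. \<beta> (n + k))" by (intro mult_left_mono t) simp
      finally show ?thesis by simp
    qed
    then show "\<forall>\<^sub>F k in sequentially. norm ((\<Sum>n<k. sintegral (\<nu> n) f) - sintegral \<mu> f)
        \<le> \<bar>c\<bar> * (\<Sum>n. \<beta> (n + k))"
      by simp
  qed
  show c: "concentrated_on S (\<Sum>n. \<nu> n)"
  proof (rule concentrated_onI[OF S])
    fix f :: "real \<Rightarrow> real"
    assume f: "f \<in> borel_measurable rplus" "\<And>x. \<bar>f x\<bar> \<le> 1" "\<And>x. x \<in> S \<Longrightarrow> f x = 0"
    have "sintegral (\<nu> n) f = 0" for n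
      using sintegral_cong_on[OF S conc f(1), of "\<lambda>_. 0"] f(3) by (simp add: sintegral_def)
    then have "(\<lambda>n. 0) sums sintegral \<mu> f" using bdd[OF f(1,2)] by simp
    then show "sintegral (\<Sum>n. \<nu> n) f = 0" using \<mu> by (simp add: sums_0 sums_unique2)
  qed
  fix f :: "real \<Rightarrow> real" and c
  assume f: "f \<in> borel_measurable rplus" "\<And>x. x \<in> S \<Longrightarrow> \<bar>f x\<bar> \<le> c"
  have m: "(\<lambda>x. indicator S x * f x) \<in> borel_measurable rplus"
    using f(1) S by (intro borel_measurable_times) auto
  have "(\<lambda>n. sintegral (\<nu> n) (\<lambda>x. indicator S x * f x)) sums sintegral \<mu> (\<lambda>x. indicator S x * f x)"
    using order_trans[OF f(2) abs_ge_self] by (intro bdd[OF m, of "\<bar>c\<bar>"]) (auto simp: indicator_def)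
  moreover have "sintegral \<rho> (\<lambda>x. indicator S x * f x) = sintegral \<rho> f" if "concentrated_on S \<rho>" for \<rho>
    using that by (intro sintegral_cong_on[OF S _ m f(1)]) auto
  ultimately show "(\<lambda>n. sintegral (\<nu> n) f) sums sintegral (\<Sum>n. \<nu> n) f"
    using conc c \<mu> by simp
qed

section \<open>Product integrals, Mellin convolution and weights\<close>

lemma measurable_mult_compose:
  assumes "f \<in> borel_measurable rplus"
  shows "(\<lambda>(x, y). f (x * y)) \<in> borel_measurable (rplus \<Otimes>\<^sub>M rplus)"
  using measurable_compose[OF measurable_mult_rplus[OF refl refl] assms] by (simp add: split_beta')

lemma measurable_section:
  assumes "(\<lambda>(x, y). F x y) \<in> borel_measurable (rplus \<Otimes>\<^sub>M rplus)"
  shows "0 \<le> x \<Longrightarrow> F x \<in> borel_measurable rplus"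
    and "0 \<le> y \<Longrightarrow> (\<lambda>x. F x y) \<in> borel_measurable rplus"
  using measurable_compose[OF measurable_Pair1' assms, of x]
    measurable_compose[OF measurable_Pair2' assms, of y] by simp_all

lemma measurable_scale_arg:
  assumes "f \<in> borel_measurable rplus" "0 \<le> l"
  shows "(\<lambda>x. f (l * x)) \<in> borel_measurable rplus" "(\<lambda>x. f (x * l)) \<in> borel_measurable rplus"
  using measurable_section[OF measurable_mult_compose[OF assms(1)]] assms(2) by simp_all

lemma measurable_integral_param:
  fixes F :: "real \<Rightarrow> real \<Rightarrow> real"
  assumes F: "(\<lambda>(x, y). F x y) \<in> borel_measurable (rplus \<Otimes>\<^sub>M rplus)"
    and M: "finite_measure M" "sets M = sets rplus"
  shows "(\<lambda>x. \<integral>y. F x y \<partial>M) \<in> borel_measurable rplus"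
proof -
  interpret finite_measure M by fact
  have "sets (rplus \<Otimes>\<^sub>M M) = sets (rplus \<Otimes>\<^sub>M rplus)"
    using M(2) by (intro sets_pair_measure_cong) auto
  then have "case_prod F \<in> borel_measurable (rplus \<Otimes>\<^sub>M M)"
    using F by (simp cong: measurable_cong_sets)
  then show ?thesis by (rule borel_measurable_lebesgue_integral)
qed

lemma measurable_sintegral_param:
  assumes "(\<lambda>(x, y). F x y) \<in> borel_measurable (rplus \<Otimes>\<^sub>M rplus)"
  shows "(\<lambda>x. sintegral \<mu> (F x)) \<in> borel_measurable rplus"
  unfolding sintegral_def
  by (intro borel_measurable_diff measurable_integral_param[OF assms])
     (auto simp: finite_pos_part finite_neg_part)

text \<open>
  Fubini's theorem for signed measures, from the four pairs of Jordan parts.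
\<close>

lemma sintegral_Fubini:
  assumes F: "(\<lambda>(x, y). F x y) \<in> borel_measurable (rplus \<Otimes>\<^sub>M rplus)"
    and c: "\<And>x y. 0 \<le> x \<Longrightarrow> 0 \<le> y \<Longrightarrow> \<bar>F x y\<bar> \<le> c"
  shows "sintegral \<mu> (\<lambda>x. sintegral \<nu> (F x)) = sintegral \<nu> (\<lambda>y. sintegral \<mu> (\<lambda>x. F x y))"
proof -
  have *: "integrable P (\<lambda>x. \<integral>y. F x y \<partial>Q)" "integrable Q (\<lambda>y. \<integral>x. F x y \<partial>P)"
     "(\<integral>x. (\<integral>y. F x y \<partial>Q) \<partial>P) = (\<integral>y. (\<integral>x. F x y \<partial>P) \<partial>Q)"
    if P: "finite_measure P" "sets P = sets rplus" and Q: "finite_measure Q" "sets Q = sets rplus"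
    for P Q
  proof -
    interpret P: finite_measure P by fact
    interpret Q: finite_measure Q by fact
    interpret PQ: pair_sigma_finite P Q ..
    have s: "sets (P \<Otimes>\<^sub>M Q) = sets (rplus \<Otimes>\<^sub>M rplus)"
      using P Q by (intro sets_pair_measure_cong) auto
    have sp: "space P = {0..}" "space Q = {0..}" using P Q by (auto simp: space_eq_rplus)
    have i: "integrable (P \<Otimes>\<^sub>M Q) (case_prod F)"
    proof (rule finite_measure.integrable_const_bound[where B = c])
      show "finite_measure (P \<Otimes>\<^sub>M Q)" by (rule finite_measure_pair_measure) fact+
      show "case_prod F \<in> borel_measurable (P \<Otimes>\<^sub>M Q)" using F s by (simp cong: measurable_cong_sets)
      show "AE z in P \<Otimes>\<^sub>M Q. norm (case_prod F z) \<le> c"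
        by (rule AE_I2) (auto simp: space_pair_measure sp c)
    qed
    show "integrable P (\<lambda>x. \<integral>y. F x y \<partial>Q)" by (rule PQ.integrable_fst[OF i])
    show "integrable Q (\<lambda>y. \<integral>x. F x y \<partial>P)" by (rule PQ.integrable_snd[OF i])
    show "(\<integral>x. (\<integral>y. F x y \<partial>Q) \<partial>P) = (\<integral>y. (\<integral>x. F x y \<partial>P) \<partial>Q)"
      by (rule PQ.Fubini_integral[OF i, symmetric])
  qed
  note fin = finite_pos_part sets_pos_part finite_neg_part sets_neg_part
  show ?thesis
    unfolding sintegral_def using *(1,2)[of "pos_part \<mu>" "pos_part \<nu>"] *(1,2)[of "pos_part \<mu>" "neg_part \<nu>"]
      *(1,2)[of "neg_part \<mu>" "pos_part \<nu>"] *(1,2)[of "neg_part \<mu>" "neg_part \<nu>"]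
    by (simp add: fin *(3)[of "pos_part \<mu>" "pos_part \<nu>"] *(3)[of "pos_part \<mu>" "neg_part \<nu>"]
      *(3)[of "neg_part \<mu>" "pos_part \<nu>"] *(3)[of "neg_part \<mu>" "neg_part \<nu>"])
qed

lemma mult_mem_interval: "x \<in> {0..1} \<Longrightarrow> y \<in> {0..L} \<Longrightarrow> x * y \<in> {0..L :: real}"
  using mult_left_le_one_le[of y x] by auto

lemma measurable_indicator_times:
  assumes "S \<in> sets rplus" "f \<in> borel_measurable rplus"
  shows "(\<lambda>x. indicator S x * f x :: real) \<in> borel_measurable rplus"
  using assms by (intro borel_measurable_times) auto

lemma abs_indicator_times_le:
  assumes "\<And>x. x \<in> S \<Longrightarrow> \<bar>f x\<bar> \<le> c"
  shows "\<bar>indicator S x * f x\<bar> \<le> \<bar>c :: real\<bar>"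
  using order_trans[OF assms abs_ge_self] by (auto simp: indicator_def)

text \<open>
  Passing from \<open>f\<close> to its truncation turns a function that is bounded on \<open>S\<close> into one that is
  bounded on the half line, where integrals are linear in the measure.
\<close>

lemma sintegral_truncate:
  assumes "S \<in> sets rplus" "concentrated_on S \<mu>" "f \<in> borel_measurable rplus"
  shows "sintegral \<mu> f = sintegral \<mu> (\<lambda>x. indicator S x * f x)"
  using assms by (intro sintegral_cong_on measurable_indicator_times) auto

lemma concentrated_on_mconv:
  assumes \<mu>: "concentrated_on {0..1} \<mu>" and \<nu>: "concentrated_on {0..L} \<nu>"
  shows "concentrated_on {0..L} (\<mu> \<star> \<nu>)"
proof (rule concentrated_onI)
  fix f :: "real \<Rightarrow> real"
  assume f: "f \<in> borel_measurable rplus" "\<And>x. \<bar>f x\<bar> \<le> 1" "\<And>x. x \<in> {0..L} \<Longrightarrow> f x = 0"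
  have m: "(\<lambda>x. sintegral \<nu> (\<lambda>y. f (x * y))) \<in> borel_measurable rplus"
    by (rule measurable_sintegral_param[OF measurable_mult_compose[OF f(1)]])
  have "sintegral (\<mu> \<star> \<nu>) f = sintegral \<mu> (\<lambda>x. sintegral \<nu> (\<lambda>y. f (x * y)))"
    by (rule sintegral_mconv[OF f(1,2)])
  also have "\<dots> = sintegral \<mu> (\<lambda>x. sintegral \<nu> (\<lambda>y. 0))"
  proof (rule sintegral_cong_on[OF _ \<mu> m])
    fix x :: real assume x: "x \<in> {0..1}"
    show "sintegral \<nu> (\<lambda>y. f (x * y)) = sintegral \<nu> (\<lambda>y. 0)"
    proof (rule sintegral_cong_on[OF _ \<nu>])
      show "(\<lambda>y. f (x * y)) \<in> borel_measurable rplus" using x by (intro measurable_scale_arg(1) f(1)) simp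
      show "f (x * y) = 0" if "y \<in> {0..L}" for y by (rule f(3)[OF mult_mem_interval[OF x that]])
    qed auto
  qed auto
  also have "\<dots> = 0" by (simp add: sintegral_def)
  finally show "sintegral (\<mu> \<star> \<nu>) f = 0" .
qed simp

text \<open>
  The fragment size is integrated first. This order exhibits convolution as a mixture of dilations
  of \<open>\<mu>\<close> over the sizes distributed by \<open>\<nu>\<close>, which is the form in which the dual operator appears.
\<close>

lemma sintegral_mconv_swap:
  assumes \<mu>: "concentrated_on {0..1} \<mu>" and \<nu>: "concentrated_on {0..L} \<nu>"
    and f: "f \<in> borel_measurable rplus" "\<And>x. x \<in> {0..L} \<Longrightarrow> \<bar>f x\<bar> \<le> c"
  shows "sintegral (\<mu> \<star> \<nu>) f = sintegral \<nu> (\<lambda>y. sintegral \<mu> (\<lambda>x. f (x * y)))"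
proof -
  define g where "g x = indicator {0..L} x * f x" for x
  have g: "g \<in> borel_measurable rplus" "\<And>x. \<bar>g x\<bar> \<le> \<bar>c\<bar>"
    unfolding g_def using measurable_indicator_times[OF _ f(1)] abs_indicator_times_le[of "{0..L}" f c] f(2)
    by auto
  have swap: "(\<lambda>(y, x). h (x * y)) \<in> borel_measurable (rplus \<Otimes>\<^sub>M rplus)"
    if "h \<in> borel_measurable rplus" for h :: "real \<Rightarrow> real"
    using measurable_mult_compose[OF that] by (simp add: mult.commute)
  have "sintegral (\<mu> \<star> \<nu>) f = sintegral (\<mu> \<star> \<nu>) g"
    unfolding g_def by (rule sintegral_truncate[OF _ concentrated_on_mconv[OF \<mu> \<nu>] f(1)]) simp
  also have "\<dots> = sintegral \<mu> (\<lambda>x. sintegral \<nu> (\<lambda>y. g (x * y)))"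
    by (rule sintegral_mconv[OF g])
  also have "\<dots> = sintegral \<nu> (\<lambda>y. sintegral \<mu> (\<lambda>x. g (x * y)))"
    by (rule sintegral_Fubini[OF measurable_mult_compose[OF g(1)] g(2)])
  also have "\<dots> = sintegral \<nu> (\<lambda>y. sintegral \<mu> (\<lambda>x. f (x * y)))"
  proof (rule sintegral_cong_on[OF _ \<nu>])
    fix y assume y: "y \<in> {0..L}"
    show "sintegral \<mu> (\<lambda>x. g (x * y)) = sintegral \<mu> (\<lambda>x. f (x * y))"
    proof (rule sintegral_cong_on[OF _ \<mu>])
      fix x :: real assume "x \<in> {0..1}"
      then show "g (x * y) = f (x * y)" using mult_mem_interval[OF _ y] by (simp add: g_def del: atLeastAtMost_iff)
    qed (use y in \<open>simp_all add: measurable_scale_arg(2)[OF g(1)] measurable_scale_arg(2)[OF f(1)]\<close>)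
  qed (rule interval_in_rplus measurable_sintegral_param[OF swap[OF g(1)]]
      measurable_sintegral_param[OF swap[OF f(1)]])+
  finally show ?thesis .
qed

lemma sintegral_diff_measure:
  assumes "f \<in> borel_measurable rplus" "\<And>x. 0 \<le> x \<Longrightarrow> \<bar>f x\<bar> \<le> c"
  shows "sintegral (\<mu> - \<nu>) f = sintegral \<mu> f - sintegral \<nu> f"
proof -
  have "sintegral (\<mu> + - \<nu>) f = sintegral \<mu> f + sintegral (- \<nu>) f"
    by (rule sintegral_add[OF assms])
  then show ?thesis by (simp add: sintegral_uminus)
qed

text \<open>
  The weight need only be bounded where \<open>\<mu>\<close> lives: that already makes the two densities in the
  definition finite measures.
\<close>

lemma
  assumes S: "S \<in> sets rplus" and \<mu>: "concentrated_on S \<mu>"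
    and w: "w \<in> borel_measurable rplus" "\<And>x. 0 \<le> x \<Longrightarrow> 0 \<le> w x" "\<And>x. x \<in> S \<Longrightarrow> w x \<le> C"
  shows concentrated_on_weight: "concentrated_on S (weight w \<mu>)"
    and sintegral_weight: "\<And>f c. f \<in> borel_measurable rplus \<Longrightarrow> (\<And>x. x \<in> S \<Longrightarrow> \<bar>f x\<bar> \<le> c)
        \<Longrightarrow> sintegral (weight w \<mu>) f = sintegral \<mu> (\<lambda>x. w x * f x)"
proof -
  let ?D = "\<lambda>P. density P (\<lambda>x. ennreal (w x))"
  have D: "?D P \<in> nonneg_measures"
    if P: "finite_measure P" "sets P = sets rplus" "AE x in P. x \<in> S" for P
  proof -
    have wP: "w \<in> borel_measurable P" using w(1) P(2) by (simp cong: measurable_cong_sets)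
    have "(\<integral>\<^sup>+x. ennreal (w x) \<partial>P) \<le> (\<integral>\<^sup>+x. ennreal C \<partial>P)"
      using P(3) w(3) by (intro nn_integral_mono_AE) (auto elim!: eventually_mono intro: ennreal_leI)
    moreover have "(\<integral>\<^sup>+x. ennreal C \<partial>P) \<noteq> \<top>"
      using finite_measure.emeasure_finite[OF P(1)] by (simp add: ennreal_mult_eq_top_iff)
    ultimately have "(\<integral>\<^sup>+x. ennreal (w x) \<partial>P) \<noteq> \<top>" by (metis top_unique)
    moreover have "emeasure (?D P) (space (?D P)) = (\<integral>\<^sup>+x. ennreal (w x) \<partial>P)"
      using wP by (subst emeasure_density) (auto intro!: nn_integral_cong)
    ultimately have "emeasure (?D P) (space (?D P)) \<noteq> \<infinity>" by simp
    then show ?thesis using P(2) by (auto simp: nonneg_measures_def intro!: finite_measureI)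
  qed
  note Dp = D[OF finite_pos_part sets_pos_part AE_pos_part[OF S \<mu>]]
  note Dn = D[OF finite_neg_part sets_neg_part AE_neg_part[OF S \<mu>]]
  have b: "sintegral (weight w \<mu>) f = sintegral \<mu> (\<lambda>x. w x * f x)"
    if f: "f \<in> borel_measurable rplus" "\<And>x. 0 \<le> x \<Longrightarrow> \<bar>f x\<bar> \<le> c" for f c
  proof -
    have i: "(\<integral>x. f x \<partial>?D P) = (\<integral>x. w x * f x \<partial>P)" if "sets P = sets rplus" for P
      using w f that space_eq_rplus[OF that] by (subst integral_density) (auto cong: measurable_cong_sets)
    have "sintegral (weight w \<mu>) f =
        sintegral (of_measure (?D (pos_part \<mu>))) f - sintegral (of_measure (?D (neg_part \<mu>))) f"
      unfolding weight_def by (rule sintegral_diff_measure[OF f])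
    then show ?thesis
      by (simp add: sintegral_of_measure[OF Dp f] sintegral_of_measure[OF Dn f] i)
         (simp add: sintegral_def)
  qed
  show c: "concentrated_on S (weight w \<mu>)"
  proof (rule concentrated_onI[OF S])
    fix f :: "real \<Rightarrow> real"
    assume f: "f \<in> borel_measurable rplus" "\<And>x. \<bar>f x\<bar> \<le> 1" "\<And>x. x \<in> S \<Longrightarrow> f x = 0"
    have "sintegral (weight w \<mu>) f = sintegral \<mu> (\<lambda>x. w x * f x)" using f by (intro b) auto
    also have "\<dots> = sintegral \<mu> (\<lambda>x. 0)"
      using f w by (intro sintegral_cong_on[OF S \<mu>]) auto
    finally show "sintegral (weight w \<mu>) f = 0" by (simp add: sintegral_def)
  qed
  fix f :: "real \<Rightarrow> real" and d :: real
  assume f: "f \<in> borel_measurable rplus" "\<And>x. x \<in> S \<Longrightarrow> \<bar>f x\<bar> \<le> d"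
  have m: "(\<lambda>x. indicator S x * f x) \<in> borel_measurable rplus"
    by (rule measurable_indicator_times[OF S f(1)])
  have "sintegral (weight w \<mu>) f = sintegral (weight w \<mu>) (\<lambda>x. indicator S x * f x)"
    by (rule sintegral_truncate[OF S c f(1)])
  also have "\<dots> = sintegral \<mu> (\<lambda>x. w x * (indicator S x * f x))"
    by (rule b[OF m]) (rule abs_indicator_times_le[OF f(2)])
  also have "\<dots> = sintegral \<mu> (\<lambda>x. w x * f x)"
    using f w m by (intro sintegral_cong_on[OF S \<mu>]) auto
  finally show "sintegral (weight w \<mu>) f = sintegral \<mu> (\<lambda>x. w x * f x)" .
qed

lemma concentrated_on_of_measure:
  assumes M: "M \<in> nonneg_measures" and AE: "AE x in M. x \<in> S"
  shows "concentrated_on S (of_measure M)"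
  unfolding concentrated_on_def
proof (intro ballI impI)
  fix A assume A: "A \<in> sets rplus" "A \<inter> S = {}"
  have AM: "A \<in> sets M" using A M by (simp add: nonneg_measures_def)
  have "AE x in M. x \<notin> A" using AE A by (auto elim!: eventually_mono)
  then have "A \<in> null_sets M" using AE_iff_null_sets[OF AM] by simp
  then have "emeasure M A = 0" by (simp add: null_sets_def)
  then show "smeas (of_measure M) A = 0" by (simp add: smeas_of_measure[OF M] measure_def)
qed

lemma
  fixes f :: "real \<Rightarrow> real"
  assumes M: "M \<in> nonneg_measures" and S: "S \<in> sets rplus" and AE: "AE x in M. x \<in> S"
    and f: "f \<in> borel_measurable rplus" "\<And>x. x \<in> S \<Longrightarrow> \<bar>f x\<bar> \<le> c"
  shows integrable_on_of_measure: "integrable M f"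
    and sintegral_of_measure_on: "sintegral (of_measure M) f = (\<integral>x. f x \<partial>M)"
proof -
  have Ms: "sets M = sets rplus" "finite_measure M" using M by (auto simp: nonneg_measures_def)
  have m: "(\<lambda>x. indicator S x * f x) \<in> borel_measurable rplus"
    by (rule measurable_indicator_times[OF S f(1)])
  have fM: "f \<in> borel_measurable M" "(\<lambda>x. indicator S x * f x) \<in> borel_measurable M"
    using f(1) m Ms(1) by (simp_all cong: measurable_cong_sets)
  show "integrable M f"
    using AE f(2) Ms fM by (intro finite_measure.integrable_const_bound[where B = c])
      (auto elim!: eventually_mono)
  have "sintegral (of_measure M) f = sintegral (of_measure M) (\<lambda>x. indicator S x * f x)"
    by (rule sintegral_truncate[OF S concentrated_on_of_measure[OF M AE] f(1)])
  also have "\<dots> = (\<integral>x. indicator S x * f x \<partial>M)"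
    by (rule sintegral_of_measure[OF M m]) (rule abs_indicator_times_le[OF f(2)])
  also have "\<dots> = (\<integral>x. f x \<partial>M)"
    using AE fM by (intro integral_cong_AE) (auto elim!: eventually_mono)
  finally show "sintegral (of_measure M) f = (\<integral>x. f x \<partial>M)" .
qed

lemma sintegral_add_on:
  assumes S: "S \<in> sets rplus" and \<mu>: "concentrated_on S \<mu>" and \<nu>: "concentrated_on S \<nu>"
    and f: "f \<in> borel_measurable rplus" "\<And>x. x \<in> S \<Longrightarrow> \<bar>f x\<bar> \<le> c"
  shows "sintegral (\<mu> + \<nu>) f = sintegral \<mu> f + sintegral \<nu> f"
proof -
  note g = measurable_indicator_times[OF S f(1)] abs_indicator_times_le[of S f c, OF f(2)]
  have "concentrated_on S (\<mu> + \<nu>)" using \<mu> \<nu> by (auto simp: concentrated_on_def)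
  then show ?thesis
    using \<mu> \<nu> sintegral_add[OF g] by (simp add: sintegral_truncate[OF S _ f(1)])
qed

lemma sintegral_scaleR_on:
  assumes S: "S \<in> sets rplus" and \<mu>: "concentrated_on S \<mu>"
    and f: "f \<in> borel_measurable rplus" "\<And>x. x \<in> S \<Longrightarrow> \<bar>f x\<bar> \<le> c"
  shows "sintegral (r *\<^sub>R \<mu>) f = r * sintegral \<mu> f"
proof -
  note g = measurable_indicator_times[OF S f(1)] abs_indicator_times_le[of S f c, OF f(2)]
  have "concentrated_on S (r *\<^sub>R \<mu>)" using \<mu> by (auto simp: concentrated_on_def)
  then show ?thesis
    using \<mu> sintegral_scaleR[OF g] by (simp add: sintegral_truncate[OF S _ f(1)])
qed

lemma sintegral_sums:
  fixes g :: "nat \<Rightarrow> real \<Rightarrow> real"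
  assumes S: "S \<in> sets rplus" and \<mu>: "concentrated_on S \<mu>"
    and g: "\<And>n. g n \<in> borel_measurable rplus" "\<And>n x. x \<in> S \<Longrightarrow> \<bar>g n x\<bar> \<le> \<beta> n"
    and \<beta>: "summable \<beta>"
  shows "(\<lambda>n. sintegral \<mu> (g n)) sums sintegral \<mu> (\<lambda>x. \<Sum>n. g n x)"
proof -
  have *: "(\<lambda>n. integral\<^sup>L M (g n)) sums (\<integral>x. (\<Sum>n. g n x) \<partial>M)"
    if M: "finite_measure M" "sets M = sets rplus" "AE x in M. x \<in> S" for M
  proof (rule sums_integral)
    interpret finite_measure M by fact
    have gM: "g n \<in> borel_measurable M" for n using g(1) M(2) by (simp cong: measurable_cong_sets)
    have bd: "AE x in M. norm (g n x) \<le> \<beta> n" for n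
      using M(3) by eventually_elim (simp add: g(2))
    show i: "integrable M (g n)" for n
      using bd gM by (rule integrable_const_bound)
    show "AE x in M. summable (\<lambda>n. norm (g n x))"
      using M(3) by eventually_elim (rule summable_comparison_test'[OF \<beta>, of 0], simp add: g(2))
    have "(\<integral>x. norm (g n x) \<partial>M) \<le> (\<integral>x. \<beta> n \<partial>M)" for n
      using i bd by (intro integral_mono_AE) auto
    then have "norm (\<integral>x. norm (g n x) \<partial>M) \<le> measure M (space M) * \<beta> n" for n by simp
    then show "summable (\<lambda>n. \<integral>x. norm (g n x) \<partial>M)"
      by (intro summable_comparison_test'[OF summable_mult[OF \<beta>], of 0]) simp
  qed
  show ?thesis
    unfolding sintegral_def
    using *[OF finite_pos_part sets_pos_part AE_pos_part[OF S \<mu>]]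
      *[OF finite_neg_part sets_neg_part AE_neg_part[OF S \<mu>]]
    by (rule sums_diff)
qed

text \<open>
  The complement of the support is a union of open null sets; by Lindelof's theorem countably many
  of them suffice, so it is a null set.
\<close>

lemma AE_msupp:
  assumes "sets M = sets rplus"
  shows "AE x in M. x \<in> msupp M"
proof -
  define \<F> where "\<F> = {U. open U \<and> emeasure M (U \<inter> space M) = 0}"
  obtain \<F>' where F': "\<F>' \<subseteq> \<F>" "countable \<F>'" "\<Union>\<F>' = \<Union>\<F>"
    by (rule Lindelof[of \<F>]) (auto simp: \<F>_def)
  have "(\<Union>U\<in>\<F>'. U \<inter> space M) \<in> null_sets M"
  proof (rule null_sets_UN'[OF F'(2)])
    fix U assume "U \<in> \<F>'"
    then have U: "open U" "emeasure M (U \<inter> space M) = 0" using F' by (auto simp: \<F>_def)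
    have "U \<inter> space M \<in> sets M"
      using U(1) assms space_eq_rplus[OF assms] by (auto simp: sets_restrict_space)
    then show "U \<inter> space M \<in> null_sets M" using U by (simp add: null_sets_def)
  qed
  moreover have "{x \<in> space M. x \<notin> msupp M} \<subseteq> (\<Union>U\<in>\<F>'. U \<inter> space M)"
    using F'(3) unfolding msupp_def \<F>_def by blast
  ultimately show ?thesis by (rule AE_I')
qed

lemma ssupp_subset_interval:
  assumes "concentrated_on {0..L} \<mu>"
  shows "ssupp \<mu> \<subseteq> {0..L}"
proof
  fix x assume x: "x \<in> ssupp \<mu>"
  have x0: "0 \<le> x" using x by (simp add: ssupp_def msupp_def)
  show "x \<in> {0..L}"
  proof (rule ccontr)
    assume "x \<notin> {0..L}"
    then have "x \<in> {L<..}" using x0 by simp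
    moreover have A: "{L<..} \<inter> {0..} \<in> sets rplus" by (auto simp: sets_restrict_space_iff)
    have "emeasure M ({L<..} \<inter> {0..}) = 0"
      if M: "AE y in M. y \<in> {0..L}" "sets M = sets rplus" for M
    proof -
      have "AE y in M. y \<notin> {L<..} \<inter> {0..}" using M(1) by eventually_elim simp
      then show ?thesis using A M(2) AE_iff_null_sets[of "{L<..} \<inter> {0..}" M] by (simp add: null_sets_def)
    qed
    then have "emeasure (pos_part \<mu>) ({L<..} \<inter> {0..}) = 0" "emeasure (neg_part \<mu>) ({L<..} \<inter> {0..}) = 0"
      using AE_pos_part[OF _ assms] AE_neg_part[OF _ assms] by simp_all
    then have "emeasure (variation \<mu>) ({L<..} \<inter> space (variation \<mu>)) = 0"
      using A by (simp add: variation_def emeasure_add_measure)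
    ultimately show False using x open_greaterThan[of L] unfolding ssupp_def msupp_def by blast
  qed
qed

section \<open>The dual fragmentation operator\<close>

lemma rpow_nonneg [simp]: "0 \<le> rpow x \<gamma>"
  by (simp add: rpow_def)

lemma rpow_one [simp]: "rpow 1 \<gamma> = 1"
  by (simp add: rpow_def)

lemma rpow_mono: "0 \<le> x \<Longrightarrow> x \<le> y \<Longrightarrow> 0 \<le> \<gamma> \<Longrightarrow> rpow x \<gamma> \<le> rpow y \<gamma>"
  by (simp add: rpow_def powr_mono2)

lemma rpow_mult: "0 \<le> x \<Longrightarrow> 0 \<le> y \<Longrightarrow> rpow (x * y) \<gamma> = rpow x \<gamma> * rpow y \<gamma>"
  by (simp add: rpow_def powr_mult)

lemma rpow_power: "rpow x (real n * \<gamma>) = rpow x \<gamma> ^ n"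
proof (induction n)
  case (Suc n)
  have "\<gamma> + real n * \<gamma> = (1 + real n) * \<gamma>" by (simp add: algebra_simps)
  then have "\<gamma> + real n * \<gamma> = 0 \<longleftrightarrow> \<gamma> = 0" by simp
  then show ?case
    using Suc
    by (cases "\<gamma> = 0 \<or> n = 0") (auto simp: rpow_def distrib_right powr_add split: if_splits)
qed (simp add: rpow_def)

lemma measurable_rpow [simp]: "(\<lambda>x. rpow x \<gamma>) \<in> borel_measurable rplus"
proof (cases "\<gamma> = 0")
  case False
  then show ?thesis unfolding rpow_def by (auto intro!: measurable_restrict_space1)
qed (simp add: rpow_def)

lemma dirac_one_nonneg: "dirac_one \<in> nonneg_measures"
  unfolding nonneg_measures_def dirac_one_def
  by (auto intro!: prob_space.finite_measure prob_space_return)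

lemma AE_dirac_one: "AE x in dirac_one. x \<in> {1}"
proof -
  have "{1 :: real} \<in> sets rplus" by (auto simp: sets_restrict_space_iff)
  then show ?thesis
    unfolding dirac_one_def by (subst AE_return) auto
qed

lemma concentrated_on_dirac_one: "concentrated_on {0..1} (of_measure dirac_one)"
  using AE_dirac_one by (intro concentrated_on_of_measure dirac_one_nonneg) (auto elim!: eventually_mono)

lemma sintegral_dirac_one:
  assumes "f \<in> borel_measurable rplus"
  shows "sintegral (of_measure dirac_one) f = f 1"
proof -
  have "sintegral (of_measure dirac_one) f = (\<integral>x. f x \<partial>dirac_one)"
    using assms by (intro sintegral_of_measure_on[OF dirac_one_nonneg _ AE_dirac_one, where c = "\<bar>f 1\<bar>"])
      (auto simp: sets_restrict_space_iff)
  also have "\<dots> = f 1" unfolding dirac_one_def using assms by (intro integral_return) auto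
  finally show ?thesis .
qed

text \<open>
  The rate \<open>\<alpha>\<close> only rescales time, so everything is done with \<open>\<alpha> = 1\<close> and evaluated at \<open>\<alpha> t\<close>.
\<close>

lemma frag_adjoint_scale_rate: "frag_adjoint \<alpha> \<gamma> \<kappa> f = (\<lambda>x. \<alpha> * frag_adjoint 1 \<gamma> \<kappa> f x)"
  by (simp add: frag_adjoint_def fun_eq_iff)

locale fragmentation =
  fixes \<gamma> :: real and \<kappa> :: "real measure"
  assumes \<gamma>: "0 \<le> \<gamma>" and kernel: "fragmentation_kernel \<kappa>"
begin

lemma kernel_nonneg: "\<kappa> \<in> nonneg_measures"
  using kernel by (simp add: fragmentation_kernel_def)

lemma sets_kernel: "sets \<kappa> = sets rplus" and finite_kernel: "finite_measure \<kappa>"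
  using kernel_nonneg by (auto simp: nonneg_measures_def)

lemma AE_kernel: "AE z in \<kappa>. z \<in> {0..1}"
  using AE_msupp[OF sets_kernel] kernel by (auto simp: fragmentation_kernel_def elim!: eventually_mono)

lemma concentrated_on_kernel: "concentrated_on {0..1} (of_measure \<kappa>)"
  by (rule concentrated_on_of_measure[OF kernel_nonneg AE_kernel])

text \<open>
  Since \<open>\<kappa>\<close> lives on \<open>[0,1]\<close>, the integral over fragments of a parent of size \<open>x \<le> L\<close> only sees values
  of \<open>f\<close> on \<open>[0,L]\<close>.
\<close>

lemma kernel_integral:
  assumes f: "f \<in> borel_measurable rplus" and x: "x \<in> {0..L}" and c: "\<And>y. y \<in> {0..L} \<Longrightarrow> \<bar>f y\<bar> \<le> c"
  shows "set_integrable \<kappa> {0..1} (\<lambda>z. f (x * z))"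
    and "(LINT z:{0..1}|\<kappa>. f (x * z)) = sintegral (of_measure \<kappa>) (\<lambda>z. f (x * z))"
    and "\<bar>LINT z:{0..1}|\<kappa>. f (x * z)\<bar> \<le> c * total_variation (of_measure \<kappa>)"
proof -
  have xz: "\<bar>f (x * z)\<bar> \<le> c" if "z \<in> {0..1}" for z
    using mult_mem_interval[OF that x] by (intro c) (simp add: mult.commute)
  have m: "(\<lambda>z. f (x * z)) \<in> borel_measurable rplus" using x f by (intro measurable_scale_arg) auto
  note M = measurable_indicator_times[OF interval_in_rplus m, of 1]
  have b: "\<bar>indicator {0..1} z * f (x * z)\<bar> \<le> \<bar>c\<bar>" for z by (rule abs_indicator_times_le[OF xz])
  show "set_integrable \<kappa> {0..1} (\<lambda>z. f (x * z))"
    unfolding set_integrable_def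
    using integrable_bounded_rplus[OF finite_kernel sets_kernel M b] by simp
  have "(LINT z:{0..1}|\<kappa>. f (x * z)) = sintegral (of_measure \<kappa>) (\<lambda>z. indicator {0..1} z * f (x * z))"
    unfolding set_lebesgue_integral_def using sintegral_of_measure[OF kernel_nonneg M b] by simp
  also have "\<dots> = sintegral (of_measure \<kappa>) (\<lambda>z. f (x * z))"
    by (rule sintegral_truncate[OF interval_in_rplus concentrated_on_kernel m, symmetric])
  finally show eq: "(LINT z:{0..1}|\<kappa>. f (x * z)) = sintegral (of_measure \<kappa>) (\<lambda>z. f (x * z))" .
  have "0 \<le> c" using c[OF x] by linarith
  then show "\<bar>LINT z:{0..1}|\<kappa>. f (x * z)\<bar> \<le> c * total_variation (of_measure \<kappa>)"
    unfolding eq using m xz by (intro abs_sintegral_le[OF interval_in_rplus concentrated_on_kernel]) auto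
qed

lemma measurable_kernel_integral:
  fixes f :: "real \<Rightarrow> real"
  assumes f: "f \<in> borel_measurable rplus"
  shows "(\<lambda>x. LINT z:{0..1}|\<kappa>. f (x * z)) \<in> borel_measurable rplus"
proof -
  have "(\<lambda>p. indicat_real {0..1} (snd p)) \<in> borel_measurable (rplus \<Otimes>\<^sub>M rplus)"
    using measurable_compose[OF measurable_snd borel_measurable_indicator_rplus[OF interval_in_rplus[of 1]]] .
  then have "(\<lambda>(x, z). indicator {0..1} z * f (x * z)) \<in> borel_measurable (rplus \<Otimes>\<^sub>M rplus)"
    using measurable_mult_compose[OF f] by (simp add: split_beta')
  from measurable_integral_param[OF this finite_kernel sets_kernel] show ?thesis
    by (simp add: set_lebesgue_integral_def)
qed

lemma measurable_frag_adjoint: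
  assumes f: "f \<in> borel_measurable rplus"
  shows "frag_adjoint \<alpha> \<gamma> \<kappa> f \<in> borel_measurable rplus"
proof -
  have "(\<lambda>x. \<alpha> * rpow x \<gamma> * (- f x + (LINT z:{0..1}|\<kappa>. f (x * z)))) \<in> borel_measurable rplus"
    by (intro borel_measurable_times borel_measurable_add borel_measurable_uminus
        borel_measurable_const f measurable_rpow measurable_kernel_integral)
  then show ?thesis by (simp add: frag_adjoint_def[abs_def])
qed

text \<open>
  A bound for the norm of \<open>A\<close> on measures carried by \<open>[0,1]\<close>: unit loss plus \<open>N\<close> fragments gained.
\<close>

definition rate :: real where
  "rate = 1 + total_variation (of_measure \<kappa>)"

lemma rate_ge_1: "1 \<le> rate"
  by (simp add: rate_def total_variation_nonneg)

lemma frag_adjoint_bound: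
  assumes f: "f \<in> borel_measurable rplus" and c: "\<And>y. y \<in> {0..L} \<Longrightarrow> \<bar>f y\<bar> \<le> c" and x: "x \<in> {0..L}"
  shows "\<bar>frag_adjoint 1 \<gamma> \<kappa> f x\<bar> \<le> rpow L \<gamma> * (rate * c)"
proof -
  have "\<bar>- f x + (LINT z:{0..1}|\<kappa>. f (x * z))\<bar> \<le> rate * c"
    using kernel_integral(3)[OF f x c] c[OF x] by (simp add: rate_def algebra_simps)
  moreover have "rpow x \<gamma> \<le> rpow L \<gamma>" using x \<gamma> by (intro rpow_mono) auto
  ultimately show ?thesis by (simp add: frag_adjoint_def abs_mult mult_mono)
qed

text \<open>
  Self-similarity: a parent of size \<open>l\<close> behaves like one of size \<open>1\<close> on a time scale shortened by
  \<open>l\<^sup>\<gamma>\<close>. It also holds for \<open>l = 0\<close>, where both sides vanish if \<open>\<gamma> > 0\<close> and where the convention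
  \<open>0\<^sup>0 = 1\<close> makes it trivial if \<open>\<gamma> = 0\<close>.
\<close>

lemma frag_adjoint_dilation:
  assumes "0 \<le> l" "0 \<le> x"
  shows "rpow l \<gamma> * frag_adjoint 1 \<gamma> \<kappa> (\<lambda>y. f (y * l)) x = frag_adjoint 1 \<gamma> \<kappa> f (x * l)"
  using assms by (simp add: frag_adjoint_def rpow_mult ac_simps)

section \<open>The coefficients of the fundamental solution\<close>

lemma concentrated_on_frag_coeff: "concentrated_on {0..1} (frag_coeff \<gamma> \<kappa> n)"
proof (induction n)
  case 0
  show ?case by (simp add: concentrated_on_def)
next
  case (Suc n)
  let ?w = "weight (\<lambda>x. rpow x \<gamma>) (frag_coeff \<gamma> \<kappa> n)"
  have "rpow x \<gamma> \<le> 1" if "x \<in> {0..1}" for x using rpow_mono[of x 1 \<gamma>] that \<gamma> by simp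
  then have w: "concentrated_on {0..1} ?w"
    by (intro concentrated_on_weight[OF interval_in_rplus Suc]) auto
  from concentrated_on_mconv[OF concentrated_on_kernel w] w concentrated_on_kernel
  show ?case by (simp add: concentrated_on_def)
qed

text \<open>
  The coefficient \<open>b\<^sub>n = A\<^sup>n \<delta>\<^sub>1 / n!\<close> of \<open>exp (t A) \<delta>\<^sub>1\<close>. The coefficient \<open>a\<^sub>n\<close> omits the atom at \<open>1\<close>, and the
  inhomogeneous term \<open>(-1)\<^sup>n / n! \<kappa>\<close> of its recursion is what that atom contributes.
\<close>

definition frag_term :: "nat \<Rightarrow> smeasure" where
  "frag_term n = ((-1) ^ n / fact n) *\<^sub>R of_measure dirac_one + frag_coeff \<gamma> \<kappa> n"

lemma concentrated_on_frag_term: "concentrated_on {0..1} (frag_term n)"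
  using concentrated_on_frag_coeff[of n] concentrated_on_dirac_one
  by (simp add: frag_term_def concentrated_on_def)

lemma sintegral_frag_term:
  assumes f: "f \<in> borel_measurable rplus" "\<And>x. x \<in> {0..1} \<Longrightarrow> \<bar>f x\<bar> \<le> c"
  shows "sintegral (frag_term n) f = (-1) ^ n / fact n * f 1 + sintegral (frag_coeff \<gamma> \<kappa> n) f"
  unfolding frag_term_def
  using sintegral_dirac_one[OF f(1)]
    sintegral_add_on[OF interval_in_rplus
      concentrated_on_scaleR[OF concentrated_on_dirac_one] concentrated_on_frag_coeff f]
    sintegral_scaleR_on[OF interval_in_rplus concentrated_on_dirac_one f]
  by simp

text \<open>
  The recursion in dual form. The loss and gain terms combine into \<open>frag_adjoint\<close>, since the gain
  term is a convolution whose kernel variable is integrated first.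
\<close>

lemma sintegral_frag_coeff_Suc:
  assumes f: "f \<in> borel_measurable rplus" "\<And>x. x \<in> {0..1} \<Longrightarrow> \<bar>f x\<bar> \<le> c"
  shows "real (Suc n) * sintegral (frag_coeff \<gamma> \<kappa> (Suc n)) f =
    sintegral (frag_coeff \<gamma> \<kappa> n) (frag_adjoint 1 \<gamma> \<kappa> f)
    + (-1) ^ n / fact n * (LINT z:{0..1}|\<kappa>. f (1 * z))"
proof -
  let ?a = "frag_coeff \<gamma> \<kappa> n"
  let ?W = "weight (\<lambda>x. rpow x \<gamma>) ?a" and ?K = "\<lambda>x. LINT z:{0..1}|\<kappa>. f (x * z)"
  note a = concentrated_on_frag_coeff[of n]
  have w1: "rpow x \<gamma> \<le> 1" if "x \<in> {0..1}" for x using rpow_mono[of x 1 \<gamma>] that \<gamma> by simp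
  have W: "concentrated_on {0..1} ?W"
    by (rule concentrated_on_weight[OF interval_in_rplus a measurable_rpow rpow_nonneg w1])
  have sW: "sintegral ?W g = sintegral ?a (\<lambda>x. rpow x \<gamma> * g x)"
    if "g \<in> borel_measurable rplus" "\<And>x. x \<in> {0..1} \<Longrightarrow> \<bar>g x\<bar> \<le> d" for g d
    by (rule sintegral_weight[OF interval_in_rplus a measurable_rpow rpow_nonneg w1 that])
  note conc = W concentrated_on_uminus[OF W] concentrated_on_mconv[OF concentrated_on_kernel W]
    concentrated_on_kernel
  have mK: "?K \<in> borel_measurable rplus" by (rule measurable_kernel_integral[OF f(1)])
  have bK: "\<bar>?K x\<bar> \<le> c * total_variation (of_measure \<kappa>)" if "x \<in> {0..1}" for x
    by (rule kernel_integral(3)[OF f(1) that f(2)])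
  have "sintegral (of_measure \<kappa> \<star> ?W) f = sintegral ?W (\<lambda>y. sintegral (of_measure \<kappa>) (\<lambda>x. f (x * y)))"
    by (rule sintegral_mconv_swap[OF concentrated_on_kernel W f])
  also have "\<dots> = sintegral ?W ?K"
  proof (rule sintegral_cong_on[OF interval_in_rplus W _ mK])
    have "(\<lambda>(y, x). f (x * y)) \<in> borel_measurable (rplus \<Otimes>\<^sub>M rplus)"
      using measurable_mult_compose[OF f(1)] by (simp add: mult.commute)
    then show "(\<lambda>y. sintegral (of_measure \<kappa>) (\<lambda>x. f (x * y))) \<in> borel_measurable rplus"
      by (rule measurable_sintegral_param)
    show "sintegral (of_measure \<kappa>) (\<lambda>x. f (x * y)) = ?K y" if "y \<in> {0..1}" for y
      using kernel_integral(2)[OF f(1) that f(2)] by (simp add: mult.commute)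
  qed
  also have "\<dots> = sintegral ?a (\<lambda>x. rpow x \<gamma> * ?K x)"
    by (rule sW[OF mK bK])
  finally have conv: "sintegral (of_measure \<kappa> \<star> ?W) f = sintegral ?a (\<lambda>x. rpow x \<gamma> * ?K x)" .
  have wt: "sintegral ?W f = sintegral ?a (\<lambda>x. rpow x \<gamma> * f x)"
    by (rule sW[OF f])
  have K1: "sintegral (of_measure \<kappa>) f = ?K 1"
    using kernel_integral(2)[OF f(1) _ f(2), of 1 1] by simp
  have b: "\<bar>rpow x \<gamma> * g x\<bar> \<le> d" if "x \<in> {0..1}" "\<bar>g x\<bar> \<le> d" for g d x
    using mult_mono[OF w1[OF that(1)] that(2)] by (simp add: abs_mult)
  have adj: "frag_adjoint 1 \<gamma> \<kappa> f = (\<lambda>x. (-1) * (rpow x \<gamma> * f x) + rpow x \<gamma> * ?K x)"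
    by (simp add: frag_adjoint_def fun_eq_iff algebra_simps)
  have "sintegral ?a (frag_adjoint 1 \<gamma> \<kappa> f) =
      sintegral ?a (\<lambda>x. (-1) * (rpow x \<gamma> * f x)) + sintegral ?a (\<lambda>x. rpow x \<gamma> * ?K x)"
    unfolding adj
  proof (rule sintegral_add_fun[OF interval_in_rplus a])
    show "\<bar>(-1) * (rpow x \<gamma> * f x)\<bar> \<le> c" if "x \<in> {0..1}" for x
      using b[of x f c] f(2) that by simp
    show "\<bar>rpow x \<gamma> * ?K x\<bar> \<le> c * total_variation (of_measure \<kappa>)" if "x \<in> {0..1}" for x
      using that by (intro b bK)
  qed (use f(1) mK in \<open>auto intro!: borel_measurable_times\<close>)
  also have "\<dots> = - sintegral ?W f + sintegral (of_measure \<kappa> \<star> ?W) f"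
    by (simp only: sintegral_cmult conv wt)
  finally have A: "sintegral ?a (frag_adjoint 1 \<gamma> \<kappa> f) =
      - sintegral ?W f + sintegral (of_measure \<kappa> \<star> ?W) f" .
  have add: "sintegral (\<mu> + \<nu>) f = sintegral \<mu> f + sintegral \<nu> f"
    if "concentrated_on {0..1} \<mu>" "concentrated_on {0..1} \<nu>" for \<mu> \<nu>
    by (rule sintegral_add_on[OF interval_in_rplus that f])
  have scale: "sintegral (r *\<^sub>R \<mu>) f = r * sintegral \<mu> f" if "concentrated_on {0..1} \<mu>" for r \<mu>
    by (rule sintegral_scaleR_on[OF interval_in_rplus that f])
  let ?Z = "((-1) ^ n / fact n) *\<^sub>R of_measure \<kappa>"
  have "sintegral (frag_coeff \<gamma> \<kappa> (Suc n)) f =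
     (1 / (real n + 1)) * sintegral (- ?W + of_measure \<kappa> \<star> ?W + ?Z) f"
    unfolding frag_coeff.simps
    by (intro scale concentrated_on_add concentrated_on_scaleR conc)
  moreover have "sintegral (- ?W + of_measure \<kappa> \<star> ?W + ?Z) f =
      sintegral (- ?W + of_measure \<kappa> \<star> ?W) f + sintegral ?Z f"
    by (intro add concentrated_on_add concentrated_on_scaleR conc)
  moreover have "sintegral (- ?W + of_measure \<kappa> \<star> ?W) f =
      sintegral (- ?W) f + sintegral (of_measure \<kappa> \<star> ?W) f"
    by (intro add conc)
  moreover have "sintegral ?Z f = (-1) ^ n / fact n * sintegral (of_measure \<kappa>) f"
    by (intro scale conc)
  ultimately show ?thesis unfolding A K1 by (simp add: sintegral_uminus add.commute[of "real n" 1])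
qed

text \<open>
  With the atom restored the recursion is homogeneous: the value of \<open>frag_adjoint 1 \<gamma> \<kappa> f\<close> at \<open>1\<close>
  supplies both the next atom, through \<open>- f 1\<close>, and the inhomogeneous term, through the integral
  against \<open>\<kappa>\<close>.
\<close>

lemma sintegral_frag_term_Suc:
  assumes f: "f \<in> borel_measurable rplus" "\<And>x. x \<in> {0..1} \<Longrightarrow> \<bar>f x\<bar> \<le> c"
  shows "real (Suc n) * sintegral (frag_term (Suc n)) f = sintegral (frag_term n) (frag_adjoint 1 \<gamma> \<kappa> f)"
proof -
  have A: "frag_adjoint 1 \<gamma> \<kappa> f 1 = - f 1 + (LINT z:{0..1}|\<kappa>. f (1 * z))"
    by (simp add: frag_adjoint_def)
  have "real (Suc n) * ((-1) ^ Suc n / fact (Suc n)) = - ((-1) ^ n / fact n)"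
    by (simp add: divide_simps)
  then have e: "real (Suc n) * ((-1) ^ Suc n / fact (Suc n) * f 1) = - ((-1) ^ n / fact n * f 1)"
    by (metis (no_types, lifting) mult.assoc mult_minus_left)
  have "sintegral (frag_term n) (frag_adjoint 1 \<gamma> \<kappa> f) =
      (-1) ^ n / fact n * frag_adjoint 1 \<gamma> \<kappa> f 1 + sintegral (frag_coeff \<gamma> \<kappa> n) (frag_adjoint 1 \<gamma> \<kappa> f)"
    by (rule sintegral_frag_term[OF measurable_frag_adjoint[OF f(1)] frag_adjoint_bound[OF f]])
  moreover have "sintegral (frag_term (Suc n)) f =
      (-1) ^ Suc n / fact (Suc n) * f 1 + sintegral (frag_coeff \<gamma> \<kappa> (Suc n)) f"
    by (rule sintegral_frag_term[OF f])
  moreover have "real (Suc n) * sintegral (frag_coeff \<gamma> \<kappa> (Suc n)) f =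
      sintegral (frag_coeff \<gamma> \<kappa> n) (frag_adjoint 1 \<gamma> \<kappa> f)
      + (-1) ^ n / fact n * (LINT z:{0..1}|\<kappa>. f (1 * z))"
    by (rule sintegral_frag_coeff_Suc[OF f])
  ultimately show ?thesis
    unfolding A by (simp only: distrib_left e)
qed

lemma sintegral_frag_term_0:
  assumes f: "f \<in> borel_measurable rplus"
  shows "sintegral (frag_term 0) f = f 1"
  using sintegral_dirac_one[OF f] by (simp add: frag_term_def)

lemma total_variation_frag_term: "total_variation (frag_term n) \<le> rate ^ n / fact n"
proof (induction n)
  case 0
  show ?case
  proof (rule total_variation_le)
    fix f :: "real \<Rightarrow> real" assume "f \<in> borel_measurable rplus" "\<And>x. \<bar>f x\<bar> \<le> 1"
    then show "sintegral (frag_term 0) f \<le> rate ^ 0 / fact 0"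
      by (simp add: sintegral_frag_term_0 abs_le_iff)
  qed
next
  case (Suc n)
  show ?case
  proof (rule total_variation_le)
    fix f :: "real \<Rightarrow> real" assume f: "f \<in> borel_measurable rplus" "\<And>x. \<bar>f x\<bar> \<le> 1"
    have "\<bar>sintegral (frag_term n) (frag_adjoint 1 \<gamma> \<kappa> f)\<bar> \<le> rate * total_variation (frag_term n)"
      using frag_adjoint_bound[OF f(1) f(2), of _ 1] measurable_frag_adjoint[OF f(1)] rate_ge_1
      by (intro abs_sintegral_le[OF interval_in_rplus concentrated_on_frag_term]) auto
    also have "\<dots> \<le> rate * (rate ^ n / fact n)"
      using Suc rate_ge_1 by (intro mult_left_mono) auto
    finally have "real (Suc n) * sintegral (frag_term (Suc n)) f \<le> rate * (rate ^ n / fact n)"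
      using sintegral_frag_term_Suc[OF f] by simp
    then have "sintegral (frag_term (Suc n)) f \<le> rate * (rate ^ n / fact n) / real (Suc n)"
      by (subst pos_le_divide_eq) (auto simp: mult.commute)
    also have "\<dots> = rate ^ Suc n / fact (Suc n)" by (simp add: mult.commute)
    finally show "sintegral (frag_term (Suc n)) f \<le> rate ^ Suc n / fact (Suc n)" .
  qed
qed

end

section \<open>Entire series of measures\<close>

lemma norm_sums_le:
  fixes f :: "nat \<Rightarrow> 'a :: real_normed_vector"
  assumes "f sums s" "g sums c" "\<And>n. norm (f n) \<le> g n"
  shows "norm s \<le> c"
proof (rule LIMSEQ_le)
  show "(\<lambda>n. norm (\<Sum>i<n. f i)) \<longlonglongrightarrow> norm s" using assms(1) unfolding sums_def by (rule tendsto_norm)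
  show "(\<lambda>n. \<Sum>i<n. g i) \<longlonglongrightarrow> c" using assms(2) unfolding sums_def .
  show "\<exists>N. \<forall>n\<ge>N. norm (\<Sum>i<n. f i) \<le> (\<Sum>i<n. g i)" using assms(3) by (auto intro: sum_norm_le)
qed

text \<open>
  For coefficients \<open>A\<^sup>n \<mu>\<^sub>0 / n!\<close> this is \<open>exp (y A) \<mu>\<^sub>0\<close>.
\<close>

definition power_sum :: "(nat \<Rightarrow> smeasure) \<Rightarrow> real \<Rightarrow> smeasure" where
  "power_sum \<nu> y = (\<Sum>n. y ^ n *\<^sub>R \<nu> n)"

locale entire_series =
  fixes \<nu> :: "nat \<Rightarrow> smeasure" and S :: "real set" and K D :: real
  assumes S: "S \<in> sets rplus"
    and conc: "\<And>n. concentrated_on S (\<nu> n)"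
    and tv: "\<And>n. total_variation (\<nu> n) \<le> K * (D ^ n / fact n)"
begin

lemma tv_term: "total_variation (y ^ n *\<^sub>R \<nu> n) \<le> K * ((\<bar>y\<bar> * D) ^ n / fact n)"
proof -
  have "total_variation (y ^ n *\<^sub>R \<nu> n) \<le> \<bar>y ^ n\<bar> * total_variation (\<nu> n)"
    by (rule total_variation_scaleR_le)
  also have "\<dots> \<le> \<bar>y ^ n\<bar> * (K * (D ^ n / fact n))"
    by (rule mult_left_mono[OF tv abs_ge_zero])
  also have "\<dots> = K * ((\<bar>y\<bar> * D) ^ n / fact n)"
    unfolding power_abs power_mult_distrib by simp
  finally show ?thesis .
qed

lemma majorant_sums: "(\<lambda>n. K * (x ^ n / fact n)) sums (K * exp x)"
  using sums_mult[OF exp_converges[of x], of K] by (simp add: divide_inverse mult.commute)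

lemma summable_power_sum: "summable (\<lambda>n. y ^ n *\<^sub>R \<nu> n)"
  and concentrated_on_power_sum: "concentrated_on S (power_sum \<nu> y)"
  and sintegral_power_sum_aux: "\<And>f c. f \<in> borel_measurable rplus \<Longrightarrow> (\<And>x. x \<in> S \<Longrightarrow> \<bar>f x\<bar> \<le> c)
       \<Longrightarrow> (\<lambda>n. sintegral (y ^ n *\<^sub>R \<nu> n) f) sums sintegral (power_sum \<nu> y) f"
proof -
  have cy: "concentrated_on S (y ^ n *\<^sub>R \<nu> n)" for n by (rule concentrated_on_scaleR[OF conc])
  note ser = tv_term[of y] sums_summable[OF majorant_sums[of "\<bar>y\<bar> * D"]] S cy
  show "summable (\<lambda>n. y ^ n *\<^sub>R \<nu> n)" by (rule smeasure_series(1)[OF ser])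
  show "concentrated_on S (power_sum \<nu> y)"
    unfolding power_sum_def by (rule smeasure_series(2)[OF ser])
  fix f :: "real \<Rightarrow> real" and c
  assume "f \<in> borel_measurable rplus" "\<And>x. x \<in> S \<Longrightarrow> \<bar>f x\<bar> \<le> c"
  then show "(\<lambda>n. sintegral (y ^ n *\<^sub>R \<nu> n) f) sums sintegral (power_sum \<nu> y) f"
    unfolding power_sum_def by (rule smeasure_series(3)[OF ser])
qed

lemma sintegral_power_sum:
  assumes f: "f \<in> borel_measurable rplus" "\<And>x. x \<in> S \<Longrightarrow> \<bar>f x\<bar> \<le> c"
  shows "(\<lambda>n. sintegral (\<nu> n) f * y ^ n) sums sintegral (power_sum \<nu> y) f"
proof -
  have "sintegral (y ^ n *\<^sub>R \<nu> n) f = sintegral (\<nu> n) f * y ^ n" for n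
    unfolding mult.commute[of _ "y ^ n"] by (rule sintegral_scaleR_on[OF S conc f])
  then show ?thesis using sintegral_power_sum_aux[OF f, of y] by simp
qed

text \<open>
  Increments are bounded by those of the majorant, the scalar function \<open>y \<mapsto> K exp (D y)\<close>. Only times
  \<open>0 \<le> x \<le> y\<close> are considered, where all the powers are ordered in the same way.
\<close>

lemma norm_power_sum_diff_le:
  assumes "0 \<le> x" "x \<le> y"
  shows "norm (power_sum \<nu> y - power_sum \<nu> x) \<le> K * exp (y * D) - K * exp (x * D)"
proof (rule norm_sums_le)
  show "(\<lambda>n. y ^ n *\<^sub>R \<nu> n - x ^ n *\<^sub>R \<nu> n) sums (power_sum \<nu> y - power_sum \<nu> x)"
    unfolding power_sum_def by (intro sums_diff summable_sums summable_power_sum)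
  show "(\<lambda>n. K * ((y * D) ^ n / fact n) - K * ((x * D) ^ n / fact n)) sums (K * exp (y * D) - K * exp (x * D))"
    by (intro sums_diff majorant_sums)
  fix n
  have p: "x ^ n \<le> y ^ n" using assms by (intro power_mono) auto
  have "norm (y ^ n *\<^sub>R \<nu> n - x ^ n *\<^sub>R \<nu> n) = (y ^ n - x ^ n) * norm (\<nu> n)"
    using p by (simp add: scaleR_left_diff_distrib[symmetric])
  also have "\<dots> \<le> (y ^ n - x ^ n) * (K * (D ^ n / fact n))"
    using p order_trans[OF norm_le_total_variation tv] by (intro mult_left_mono) auto
  finally show "norm (y ^ n *\<^sub>R \<nu> n - x ^ n *\<^sub>R \<nu> n) \<le> K * ((y * D) ^ n / fact n) - K * ((x * D) ^ n / fact n)"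
    by (simp add: power_mult_distrib algebra_simps diff_divide_distrib)
qed

lemma continuous_power_sum: "continuous_on {0..} (power_sum \<nu>)"
  unfolding continuous_on_def
proof
  fix x :: real assume x: "x \<in> {0..}"
  have "norm (power_sum \<nu> y - power_sum \<nu> x) \<le> \<bar>K * exp (y * D) - K * exp (x * D)\<bar>" if "y \<in> {0..}" for y
  proof (cases "x \<le> y")
    case True
    then show ?thesis using norm_power_sum_diff_le[of x y] x by simp
  next
    case False
    then show ?thesis using norm_power_sum_diff_le[of y x] that by (simp add: norm_minus_commute)
  qed
  then have ev: "\<forall>\<^sub>F y in at x within {0..}. norm (power_sum \<nu> y - power_sum \<nu> x)
      \<le> \<bar>K * exp (y * D) - K * exp (x * D)\<bar>"
    unfolding eventually_at_filter by (intro always_eventually) blast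
  have "((\<lambda>y. \<bar>K * exp (y * D) - K * exp (x * D)\<bar>) \<longlongrightarrow> \<bar>K * exp (x * D) - K * exp (x * D)\<bar>) (at x within {0..})"
    by (intro tendsto_intros)
  then have "((\<lambda>y. \<bar>K * exp (y * D) - K * exp (x * D)\<bar>) \<longlongrightarrow> 0) (at x within {0..})" by simp
  from Lim_null_comparison[OF ev this]
  have "((\<lambda>y. power_sum \<nu> y - power_sum \<nu> x) \<longlongrightarrow> 0) (at x within {0..})" .
  then show "(power_sum \<nu> \<longlongrightarrow> power_sum \<nu> x) (at x within {0..})" by (rule LIM_zero_cancel)
qed

lemma sintegral_power_sum_eq:
  assumes f: "f \<in> borel_measurable rplus" "\<And>x. x \<in> S \<Longrightarrow> \<bar>f x\<bar> \<le> c"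
  shows "(\<lambda>y. sintegral (power_sum \<nu> y) f) = (\<lambda>y. \<Sum>n. sintegral (\<nu> n) f * y ^ n)"
  using sintegral_power_sum[OF f] by (auto simp: sums_iff)

lemma isCont_sintegral_power_sum:
  assumes f: "f \<in> borel_measurable rplus" "\<And>x. x \<in> S \<Longrightarrow> \<bar>f x\<bar> \<le> c"
  shows "isCont (\<lambda>y. sintegral (power_sum \<nu> y) f) y"
proof -
  have eq: "(\<lambda>y. sintegral (power_sum \<nu> y) f) = (\<lambda>y. \<Sum>n. sintegral (\<nu> n) f * y ^ n)"
    by (rule sintegral_power_sum_eq[OF f])
  show ?thesis
    unfolding eq
    by (rule isCont_powser_converges_everywhere) (rule sums_summable[OF sintegral_power_sum[OF f]])
qed

lemma sintegral_power_sum_0: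
  assumes f: "f \<in> borel_measurable rplus" "\<And>x. x \<in> S \<Longrightarrow> \<bar>f x\<bar> \<le> c"
  shows "sintegral (power_sum \<nu> 0) f = sintegral (\<nu> 0) f"
  using fun_cong[OF sintegral_power_sum_eq[of f c, OF f], of 0] by simp

text \<open>
  Term-by-term differentiation of a real power series. The assumption on \<open>f\<close> and \<open>g\<close> is the dual form
  of \<open>(n + 1) \<nu>\<^sub>n\<^sub>+\<^sub>1 = A \<nu>\<^sub>n\<close>.
\<close>

lemma has_derivative_sintegral_power_sum:
  assumes f: "f \<in> borel_measurable rplus" "\<And>x. x \<in> S \<Longrightarrow> \<bar>f x\<bar> \<le> c"
    and g: "g \<in> borel_measurable rplus" "\<And>x. x \<in> S \<Longrightarrow> \<bar>g x\<bar> \<le> d"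
    and rec: "\<And>n. real (Suc n) * sintegral (\<nu> (Suc n)) f = sintegral (\<nu> n) g"
  shows "((\<lambda>y. sintegral (power_sum \<nu> y) f) has_real_derivative sintegral (power_sum \<nu> y) g) (at y)"
proof -
  have "((\<lambda>y. \<Sum>n. sintegral (\<nu> n) f * y ^ n) has_real_derivative
      (\<Sum>n. diffs (\<lambda>n. sintegral (\<nu> n) f) n * y ^ n)) (at y)"
    by (rule termdiffs_strong_converges_everywhere) (rule sums_summable[OF sintegral_power_sum[OF f]])
  moreover have "diffs (\<lambda>n. sintegral (\<nu> n) f) = (\<lambda>n. sintegral (\<nu> n) g)"
    using rec by (simp add: diffs_def fun_eq_iff)
  ultimately show ?thesis
    using fun_cong[OF sintegral_power_sum_eq[of g d, OF g], of y]
    by (simp add: sintegral_power_sum_eq[of f c, OF f])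
qed

end

lemma continuous_bounded_on_interval:
  fixes \<phi> :: "real \<Rightarrow> real"
  assumes "continuous_on {0..} \<phi>"
  obtains c where "\<And>x. x \<in> {0..L} \<Longrightarrow> \<bar>\<phi> x\<bar> \<le> c"
proof -
  have "compact (\<phi> ` {0..L})"
    by (intro compact_continuous_image compact_Icc continuous_on_subset[OF assms]) auto
  then have "bounded (\<phi> ` {0..L})" by (rule compact_imp_bounded)
  then obtain c where "\<forall>x\<in>{0..L}. \<bar>\<phi> x\<bar> \<le> c" by (auto simp: bounded_iff)
  then show thesis by (intro that) auto
qed

context fragmentation
begin

text \<open>
  Any entire series whose coefficients satisfy the homogeneous recursion is a weak solution. Test
  functions are continuous, hence bounded on \<open>[0,L]\<close>, and so is their image under the dual operator;
  integrating the derivative in time yields the weak formulation.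
\<close>

lemma weak_solution_power_sum:
  assumes series: "entire_series \<nu> {0..L} K D"
    and M: "M \<in> nonneg_measures" "AE x in M. x \<in> {0..L}"
    and rec: "\<And>n f c. f \<in> borel_measurable rplus \<Longrightarrow> (\<And>x. x \<in> {0..L} \<Longrightarrow> \<bar>f x\<bar> \<le> c) \<Longrightarrow>
      real (Suc n) * sintegral (\<nu> (Suc n)) f = sintegral (\<nu> n) (frag_adjoint 1 \<gamma> \<kappa> f)"
    and init: "\<And>f c. f \<in> borel_measurable rplus \<Longrightarrow> (\<And>x. x \<in> {0..L} \<Longrightarrow> \<bar>f x\<bar> \<le> c) \<Longrightarrow>
      sintegral (\<nu> 0) f = sintegral (of_measure M) f"
  shows "weak_solution \<alpha> \<gamma> \<kappa> M (\<lambda>t. power_sum \<nu> (\<alpha> * t))"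
  unfolding weak_solution_def
proof (intro conjI allI impI)
  interpret entire_series \<nu> "{0..L}" K D by (rule series)
  show "narrowly_continuous (\<lambda>t. power_sum \<nu> (\<alpha> * t))"
    unfolding narrowly_continuous_def
  proof (intro allI impI)
    fix \<phi> :: "real \<Rightarrow> real" assume c: "continuous_on {0..} \<phi>"
    obtain c where c: "\<And>x. x \<in> {0..L} \<Longrightarrow> \<bar>\<phi> x\<bar> \<le> c"
      using continuous_bounded_on_interval[OF c] by blast
    have m: "\<phi> \<in> borel_measurable rplus"
      using \<open>continuous_on {0..} \<phi>\<close> by (rule borel_measurable_continuous_on_restrict)
    have "isCont (\<lambda>t. sintegral (power_sum \<nu> (\<alpha> * t)) \<phi>) t" for t
      using isCont_o2[OF _ isCont_sintegral_power_sum[OF m c], of t "\<lambda>t. \<alpha> * t"] by simp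
    then show "continuous_on {0..} (\<lambda>t. sintegral (power_sum \<nu> (\<alpha> * t)) \<phi>)"
      by (simp add: continuous_at_imp_continuous_on)
  qed
  fix \<phi> :: "real \<Rightarrow> real" assume cont: "continuous_on {0..} \<phi>"
  obtain c where c: "\<And>x. x \<in> {0..L} \<Longrightarrow> \<bar>\<phi> x\<bar> \<le> c"
    using continuous_bounded_on_interval[OF cont] by blast
  have m: "\<phi> \<in> borel_measurable rplus"
    using cont by (rule borel_measurable_continuous_on_restrict)
  show "integrable M \<phi>"
    by (rule integrable_on_of_measure[OF M(1) interval_in_rplus M(2) m c])
  show "set_integrable \<kappa> {0..1} (\<lambda>z. \<phi> (x * z))" if "0 \<le> x" for x
  proof -
    obtain d where "\<And>y. y \<in> {0..x} \<Longrightarrow> \<bar>\<phi> y\<bar> \<le> d"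
      using continuous_bounded_on_interval[OF cont] by blast
    then show ?thesis using that by (intro kernel_integral(1)[OF m, of x x d]) auto
  qed
  fix t :: real assume t: "0 \<le> t"
  define \<psi> where "\<psi> = frag_adjoint 1 \<gamma> \<kappa> \<phi>"
  have m': "\<psi> \<in> borel_measurable rplus" unfolding \<psi>_def by (rule measurable_frag_adjoint[OF m])
  have c': "\<bar>\<psi> x\<bar> \<le> rpow L \<gamma> * (rate * c)" if "x \<in> {0..L}" for x
    unfolding \<psi>_def by (rule frag_adjoint_bound[OF m c that])
  have adj: "frag_adjoint \<alpha> \<gamma> \<kappa> \<phi> = (\<lambda>x. \<alpha> * \<psi> x)"
    unfolding \<psi>_def by (rule frag_adjoint_scale_rate)
  show "sintegrable (power_sum \<nu> (\<alpha> * t)) \<phi>"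
    by (rule integrable_pos_neg(3)[OF interval_in_rplus concentrated_on_power_sum m c])
  have "sintegrable (power_sum \<nu> (\<alpha> * t)) \<psi>"
    by (rule integrable_pos_neg(3)[OF interval_in_rplus concentrated_on_power_sum m' c'])
  then show "sintegrable (power_sum \<nu> (\<alpha> * t)) (frag_adjoint \<alpha> \<gamma> \<kappa> \<phi>)"
    unfolding adj by (simp add: sintegrable_def)
  define F where "F s = sintegral (power_sum \<nu> (\<alpha> * s)) \<phi>" for s
  define G where "G s = sintegral (power_sum \<nu> (\<alpha> * s)) (frag_adjoint \<alpha> \<gamma> \<kappa> \<phi>)" for s
  have G: "G s = sintegral (power_sum \<nu> (\<alpha> * s)) \<psi> * \<alpha>" for s
    unfolding G_def adj by (simp add: sintegral_cmult)
  have "isCont G s" for s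
    unfolding G using isCont_o2[OF _ isCont_sintegral_power_sum[OF m' c'], of s "\<lambda>s. \<alpha> * s"] by simp
  then have contG: "continuous_on {0..t} G" by (simp add: continuous_at_imp_continuous_on)
  then show "set_integrable lborel {0..t} (\<lambda>s. sintegral (power_sum \<nu> (\<alpha> * s)) (frag_adjoint \<alpha> \<gamma> \<kappa> \<phi>))"
    unfolding G_def by (rule borel_integrable_atLeastAtMost')
  have "real (Suc n) * sintegral (\<nu> (Suc n)) \<phi> = sintegral (\<nu> n) \<psi>" for n
    unfolding \<psi>_def by (rule rec[OF m c])
  note deriv = has_derivative_sintegral_power_sum[OF m c m' c' this]
  have "(F has_real_derivative G s) (at s)" for s
    unfolding F_def G
    by (rule DERIV_chain2[where f = "\<lambda>y. sintegral (power_sum \<nu> y) \<phi>" and g = "\<lambda>s. \<alpha> * s", OF deriv])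
      (auto intro!: derivative_eq_intros)
  then have "(F has_vector_derivative G s) (at s within {0..t})" for s
    by (metis has_real_derivative_iff_has_vector_derivative has_vector_derivative_at_within)
  then have "(LINT s:{0..t}|lborel. G s) = F t - F 0"
    unfolding set_lebesgue_integral_def using t contG by (intro integral_FTC_atLeastAtMost) auto
  moreover have "F 0 = (\<integral>x. \<phi> x \<partial>M)"
    unfolding F_def
    using sintegral_power_sum_0[OF m c] init[OF m c] sintegral_of_measure_on[OF M(1) interval_in_rplus M(2) m c]
    by simp
  ultimately show "sintegral (power_sum \<nu> (\<alpha> * t)) \<phi> = (\<integral>x. \<phi> x \<partial>M) +
      (LINT s:{0..t}|lborel. sintegral (power_sum \<nu> (\<alpha> * s)) (frag_adjoint \<alpha> \<gamma> \<kappa> \<phi>))"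
    by (simp add: F_def G_def)
qed

sublocale fundamental: entire_series frag_term "{0..1}" 1 rate
  by unfold_locales (use concentrated_on_frag_term total_variation_frag_term in auto)

lemma weak_solution_fundamental:
  "weak_solution \<alpha> \<gamma> \<kappa> dirac_one (\<lambda>t. power_sum frag_term (\<alpha> * t))"
proof (rule weak_solution_power_sum[OF fundamental.entire_series_axioms dirac_one_nonneg])
  show "AE x in dirac_one. x \<in> {0..1}" using AE_dirac_one by eventually_elim simp
  fix f :: "real \<Rightarrow> real" and c n
  assume f: "f \<in> borel_measurable rplus" "\<And>x. x \<in> {0..1} \<Longrightarrow> \<bar>f x\<bar> \<le> c"
  show "real (Suc n) * sintegral (frag_term (Suc n)) f = sintegral (frag_term n) (frag_adjoint 1 \<gamma> \<kappa> f)"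
    by (rule sintegral_frag_term_Suc[OF f])
  show "sintegral (frag_term 0) f = sintegral (of_measure dirac_one) f"
    by (simp add: sintegral_frag_term_0 sintegral_dirac_one f)
qed

lemma frag_coeff_series_sums:
  "(\<lambda>n. y ^ n *\<^sub>R frag_coeff \<gamma> \<kappa> n) sums (power_sum frag_term y - exp (- y) *\<^sub>R of_measure dirac_one)"
proof -
  have "(\<lambda>n. (- y) ^ n / fact n) sums exp (- y)"
    using exp_converges[of "- y"] by (simp add: divide_inverse mult.commute)
  then have "(\<lambda>n. ((- y) ^ n / fact n) *\<^sub>R of_measure dirac_one) sums (exp (- y) *\<^sub>R of_measure dirac_one)"
    by (rule bounded_linear.sums[OF bounded_linear_scaleR_left])
  from sums_diff[OF summable_sums[OF fundamental.summable_power_sum[of y]] this]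
  have "(\<lambda>n. y ^ n *\<^sub>R frag_term n - ((- y) ^ n / fact n) *\<^sub>R of_measure dirac_one) sums
      (power_sum frag_term y - exp (- y) *\<^sub>R of_measure dirac_one)"
    unfolding power_sum_def .
  moreover have "y ^ n *\<^sub>R frag_term n - ((- y) ^ n / fact n) *\<^sub>R of_measure dirac_one = y ^ n *\<^sub>R frag_coeff \<gamma> \<kappa> n" for n
  proof -
    have "(- y) ^ n / fact n = y ^ n * ((-1) ^ n / fact n)"
      by (subst power_minus) (simp add: mult.commute)
    then show ?thesis unfolding frag_term_def scaleR_add_right scaleR_scaleR by simp
  qed
  ultimately show ?thesis by simp
qed

lemma summable_frag_coeff: "summable (\<lambda>n. y ^ Suc n *\<^sub>R frag_coeff \<gamma> \<kappa> (Suc n))"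
  and fundamental_solution_eq: "fundamental_solution \<alpha> \<gamma> \<kappa> t = power_sum frag_term (\<alpha> * t)"
proof -
  have *: "(\<lambda>n. y ^ Suc n *\<^sub>R frag_coeff \<gamma> \<kappa> (Suc n)) sums
      (power_sum frag_term y - exp (- y) *\<^sub>R of_measure dirac_one)" for y
    using frag_coeff_series_sums[of y] by (subst sums_Suc_iff) simp
  show "summable (\<lambda>n. y ^ Suc n *\<^sub>R frag_coeff \<gamma> \<kappa> (Suc n))" using * by (rule sums_summable)
  show "fundamental_solution \<alpha> \<gamma> \<kappa> t = power_sum frag_term (\<alpha> * t)"
    unfolding fundamental_solution_def using *[of "\<alpha> * t"] by (simp add: sums_iff)
qed

end

section \<open>General initial data\<close>

text \<open>
  The Dirac mass at \<open>1\<close> is the unit of Mellin convolution.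
\<close>

lemma mconv_dirac_one_add:
  "(c *\<^sub>R of_measure dirac_one + \<mu>) \<star> \<nu> = c *\<^sub>R \<nu> + \<mu> \<star> \<nu>"
proof (rule smeasure_eqI_sintegral)
  fix f :: "real \<Rightarrow> real" assume f: "f \<in> borel_measurable rplus" "\<And>x. \<bar>f x\<bar> \<le> 1"
  let ?h = "\<lambda>x. sintegral \<nu> (\<lambda>y. f (x * y))"
  have mh: "?h \<in> borel_measurable rplus"
    by (rule measurable_sintegral_param[OF measurable_mult_compose[OF f(1)]])
  have bh: "\<bar>?h x\<bar> \<le> 1 * total_variation \<nu>" if "0 \<le> x" for x
    by (rule abs_sintegral_le[OF atLeast_in_rplus concentrated_on_half_line])
       (use f measurable_scale_arg(1)[OF f(1) that] in auto)
  have "sintegral ((c *\<^sub>R of_measure dirac_one + \<mu>) \<star> \<nu>) f = sintegral (c *\<^sub>R of_measure dirac_one + \<mu>) ?h"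
    by (rule sintegral_mconv[OF f])
  also have "\<dots> = sintegral (c *\<^sub>R of_measure dirac_one) ?h + sintegral \<mu> ?h"
    by (rule sintegral_add[OF mh bh])
  also have "sintegral (c *\<^sub>R of_measure dirac_one) ?h = c * sintegral (of_measure dirac_one) ?h"
    by (rule sintegral_scaleR[OF mh bh])
  also have "sintegral (of_measure dirac_one) ?h = sintegral \<nu> f"
    by (simp add: sintegral_dirac_one[OF mh])
  also have "c * sintegral \<nu> f = sintegral (c *\<^sub>R \<nu>) f"
    by (rule sintegral_scaleR[OF f, symmetric])
  also have "sintegral \<mu> ?h = sintegral (\<mu> \<star> \<nu>) f"
    by (rule sintegral_mconv[OF f, symmetric])
  also have "sintegral (c *\<^sub>R \<nu>) f + sintegral (\<mu> \<star> \<nu>) f = sintegral (c *\<^sub>R \<nu> + \<mu> \<star> \<nu>) f"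
    by (rule sintegral_add[OF f, symmetric])
  finally show "sintegral ((c *\<^sub>R of_measure dirac_one + \<mu>) \<star> \<nu>) f = sintegral (c *\<^sub>R \<nu> + \<mu> \<star> \<nu>) f" .
qed

locale fragmentation_datum = fragmentation +
  fixes \<mu>\<^sub>0 :: "real measure" and L :: real
  assumes datum: "\<mu>\<^sub>0 \<in> nonneg_measures" and AE_datum: "AE l in \<mu>\<^sub>0. l \<in> {0..L}"
begin

definition size_weight :: "nat \<Rightarrow> smeasure" where
  "size_weight n = weight (\<lambda>l. rpow l (real n * \<gamma>)) (of_measure \<mu>\<^sub>0)"

text \<open>
  The coefficient \<open>A\<^sup>n \<mu>\<^sub>0 / n!\<close> of the solution with datum \<open>\<mu>\<^sub>0\<close>, as a mixture over the initial sizes \<open>l\<close>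
  of dilated coefficients \<open>b\<^sub>n\<close>; the factor \<open>l\<^sup>n\<^sup>\<gamma>\<close> comes from self-similarity.
\<close>

definition mixed_term :: "nat \<Rightarrow> smeasure" where
  "mixed_term n = frag_term n \<star> size_weight n"

lemma concentrated_on_datum: "concentrated_on {0..L} (of_measure \<mu>\<^sub>0)"
  by (rule concentrated_on_of_measure[OF datum AE_datum])

lemma rpow_le_datum: "l \<in> {0..L} \<Longrightarrow> rpow l (real n * \<gamma>) \<le> rpow L \<gamma> ^ n"
  unfolding rpow_power using \<gamma> by (intro power_mono rpow_mono) auto

lemma concentrated_on_size_weight: "concentrated_on {0..L} (size_weight n)"
  unfolding size_weight_def
  by (rule concentrated_on_weight[OF interval_in_rplus concentrated_on_datum measurable_rpow rpow_nonneg
        rpow_le_datum])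

lemma sintegral_size_weight:
  assumes f: "f \<in> borel_measurable rplus" "\<And>x. x \<in> {0..L} \<Longrightarrow> \<bar>f x\<bar> \<le> c"
  shows "sintegral (size_weight n) f = sintegral (of_measure \<mu>\<^sub>0) (\<lambda>l. rpow l \<gamma> ^ n * f l)"
proof -
  have "sintegral (size_weight n) f = sintegral (of_measure \<mu>\<^sub>0) (\<lambda>l. rpow l (real n * \<gamma>) * f l)"
    unfolding size_weight_def
    by (rule sintegral_weight[OF interval_in_rplus concentrated_on_datum measurable_rpow rpow_nonneg
          rpow_le_datum f])
  then show ?thesis by (simp only: rpow_power)
qed

lemma concentrated_on_mixed_term: "concentrated_on {0..L} (mixed_term n)"
  unfolding mixed_term_def by (rule concentrated_on_mconv[OF concentrated_on_frag_term concentrated_on_size_weight])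

lemma measurable_fragment_integral:
  assumes f: "f \<in> borel_measurable rplus"
  shows "(\<lambda>l. sintegral \<mu> (\<lambda>x. f (x * l))) \<in> borel_measurable rplus"
proof (rule measurable_sintegral_param)
  show "(\<lambda>(l, x). f (x * l)) \<in> borel_measurable (rplus \<Otimes>\<^sub>M rplus)"
    using measurable_mult_compose[OF f] by (simp add: mult.commute)
qed

lemma fragment_integral_le:
  assumes f: "f \<in> borel_measurable rplus" "\<And>x. x \<in> {0..L} \<Longrightarrow> \<bar>f x\<bar> \<le> c" and l: "l \<in> {0..L}"
  shows "\<bar>sintegral (frag_term n) (\<lambda>x. f (x * l))\<bar> \<le> c * (rate ^ n / fact n)"
proof -
  have c: "0 \<le> c" using f(2)[OF l] by linarith
  have "\<bar>sintegral (frag_term n) (\<lambda>x. f (x * l))\<bar> \<le> c * total_variation (frag_term n)"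
  proof (rule abs_sintegral_le[OF interval_in_rplus concentrated_on_frag_term c])
    show "(\<lambda>x. f (x * l)) \<in> borel_measurable rplus" using l f(1) by (intro measurable_scale_arg(2)) auto
    show "\<bar>f (x * l)\<bar> \<le> c" if "x \<in> {0..1}" for x by (rule f(2)[OF mult_mem_interval[OF that l]])
  qed
  also have "\<dots> \<le> c * (rate ^ n / fact n)" by (rule mult_left_mono[OF total_variation_frag_term c])
  finally show ?thesis .
qed

lemma sintegral_mixed_term:
  assumes f: "f \<in> borel_measurable rplus" "\<And>x. x \<in> {0..L} \<Longrightarrow> \<bar>f x\<bar> \<le> c"
  shows "sintegral (mixed_term n) f =
    sintegral (of_measure \<mu>\<^sub>0) (\<lambda>l. rpow l \<gamma> ^ n * sintegral (frag_term n) (\<lambda>x. f (x * l)))"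
proof -
  have "sintegral (mixed_term n) f = sintegral (size_weight n) (\<lambda>l. sintegral (frag_term n) (\<lambda>x. f (x * l)))"
    unfolding mixed_term_def
    by (rule sintegral_mconv_swap[OF concentrated_on_frag_term concentrated_on_size_weight f])
  also have "\<dots> = sintegral (of_measure \<mu>\<^sub>0) (\<lambda>l. rpow l \<gamma> ^ n * sintegral (frag_term n) (\<lambda>x. f (x * l)))"
    by (rule sintegral_size_weight[OF measurable_fragment_integral[OF f(1)] fragment_integral_le[OF f]])
  finally show ?thesis .
qed

lemma measurable_rpow_power_times:
  assumes "g \<in> borel_measurable rplus"
  shows "(\<lambda>l. rpow l \<gamma> ^ n * g l) \<in> borel_measurable rplus"
  by (intro borel_measurable_times borel_measurable_power measurable_rpow assms)

lemma mixed_integrand_le: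
  assumes f: "f \<in> borel_measurable rplus" "\<And>x. x \<in> {0..L} \<Longrightarrow> \<bar>f x\<bar> \<le> c" and l: "l \<in> {0..L}"
  shows "\<bar>rpow l \<gamma> ^ n * sintegral (frag_term n) (\<lambda>x. f (x * l))\<bar> \<le> c * ((rpow L \<gamma> * rate) ^ n / fact n)"
proof -
  have "\<bar>rpow l \<gamma> ^ n * sintegral (frag_term n) (\<lambda>x. f (x * l))\<bar> \<le> rpow L \<gamma> ^ n * (c * (rate ^ n / fact n))"
    unfolding abs_mult
  proof (rule mult_mono)
    show "\<bar>rpow l \<gamma> ^ n\<bar> \<le> rpow L \<gamma> ^ n" using rpow_le_datum[OF l, of n] by (simp add: rpow_power)
    show "\<bar>sintegral (frag_term n) (\<lambda>x. f (x * l))\<bar> \<le> c * (rate ^ n / fact n)"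
      by (rule fragment_integral_le[OF f l])
  qed auto
  also have "\<dots> = c * ((rpow L \<gamma> * rate) ^ n / fact n)" by (simp add: power_mult_distrib)
  finally show ?thesis .
qed

lemma total_variation_mixed_term:
  "total_variation (mixed_term n) \<le> total_variation (of_measure \<mu>\<^sub>0) * ((rpow L \<gamma> * rate) ^ n / fact n)"
proof (rule total_variation_le)
  fix f :: "real \<Rightarrow> real" assume f: "f \<in> borel_measurable rplus" "\<And>x. \<bar>f x\<bar> \<le> 1"
  have "\<bar>sintegral (mixed_term n) f\<bar> \<le> (1 * ((rpow L \<gamma> * rate) ^ n / fact n)) * total_variation (of_measure \<mu>\<^sub>0)"
    unfolding sintegral_mixed_term[of f 1, OF f(1) f(2)]
  proof (rule abs_sintegral_le[OF interval_in_rplus concentrated_on_datum])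
    show "0 \<le> 1 * ((rpow L \<gamma> * rate) ^ n / fact n)" using rate_ge_1 by simp
    show "(\<lambda>l. rpow l \<gamma> ^ n * sintegral (frag_term n) (\<lambda>x. f (x * l))) \<in> borel_measurable rplus"
      by (rule measurable_rpow_power_times[OF measurable_fragment_integral[OF f(1)]])
    show "\<bar>rpow l \<gamma> ^ n * sintegral (frag_term n) (\<lambda>x. f (x * l))\<bar> \<le> 1 * ((rpow L \<gamma> * rate) ^ n / fact n)"
      if "l \<in> {0..L}" for l
      by (rule mixed_integrand_le[OF f(1) f(2) that])
  qed
  then show "sintegral (mixed_term n) f \<le> total_variation (of_measure \<mu>\<^sub>0) * ((rpow L \<gamma> * rate) ^ n / fact n)"
    by (simp add: mult.commute)
qed

sublocale mixed: entire_series mixed_term "{0..L}" "total_variation (of_measure \<mu>\<^sub>0)" "rpow L \<gamma> * rate"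
  by unfold_locales (rule interval_in_rplus concentrated_on_mixed_term total_variation_mixed_term)+

lemma sintegral_mixed_term_0:
  assumes f: "f \<in> borel_measurable rplus" "\<And>x. x \<in> {0..L} \<Longrightarrow> \<bar>f x\<bar> \<le> c"
  shows "sintegral (mixed_term 0) f = sintegral (of_measure \<mu>\<^sub>0) f"
proof -
  have "sintegral (mixed_term 0) f =
      sintegral (of_measure \<mu>\<^sub>0) (\<lambda>l. rpow l \<gamma> ^ 0 * sintegral (frag_term 0) (\<lambda>x. f (x * l)))"
    by (rule sintegral_mixed_term[OF f])
  also have "\<dots> = sintegral (of_measure \<mu>\<^sub>0) f"
    using sintegral_frag_term_0[OF measurable_scale_arg(2)[OF f(1)]] by (intro sintegral_cong) simp
  finally show ?thesis .
qed

text \<open>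
  The recursion for \<open>b\<^sub>n\<close>, applied to the dilated test function \<open>x \<mapsto> f (x l)\<close>. One of the \<open>n + 1\<close> factors
  \<open>l\<^sup>\<gamma>\<close> is absorbed by \<open>frag_adjoint_dilation\<close>, which leaves the weight \<open>l\<^sup>n\<^sup>\<gamma>\<close> of the preceding coefficient.
\<close>

lemma sintegral_mixed_term_Suc:
  assumes f: "f \<in> borel_measurable rplus" "\<And>x. x \<in> {0..L} \<Longrightarrow> \<bar>f x\<bar> \<le> c"
  shows "real (Suc n) * sintegral (mixed_term (Suc n)) f = sintegral (mixed_term n) (frag_adjoint 1 \<gamma> \<kappa> f)"
proof -
  let ?A = "frag_adjoint 1 \<gamma> \<kappa>"
  have mA: "?A f \<in> borel_measurable rplus" by (rule measurable_frag_adjoint[OF f(1)])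
  have bA: "\<bar>?A f x\<bar> \<le> rpow L \<gamma> * (rate * c)" if "x \<in> {0..L}" for x
    by (rule frag_adjoint_bound[OF f that])
  have "real (Suc n) * sintegral (mixed_term (Suc n)) f =
      real (Suc n) * sintegral (of_measure \<mu>\<^sub>0) (\<lambda>l. rpow l \<gamma> ^ Suc n * sintegral (frag_term (Suc n)) (\<lambda>x. f (x * l)))"
    by (rule arg_cong[OF sintegral_mixed_term[OF f]])
  also have "\<dots> = sintegral (of_measure \<mu>\<^sub>0)
      (\<lambda>l. real (Suc n) * (rpow l \<gamma> ^ Suc n * sintegral (frag_term (Suc n)) (\<lambda>x. f (x * l))))"
    by (rule sintegral_cmult[symmetric])
  also have "\<dots> = sintegral (of_measure \<mu>\<^sub>0) (\<lambda>l. rpow l \<gamma> ^ n * sintegral (frag_term n) (\<lambda>x. ?A f (x * l)))"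
  proof (rule sintegral_cong_on[OF interval_in_rplus concentrated_on_datum])
    show "(\<lambda>l. real (Suc n) * (rpow l \<gamma> ^ Suc n * sintegral (frag_term (Suc n)) (\<lambda>x. f (x * l)))) \<in> borel_measurable rplus"
      by (intro borel_measurable_times borel_measurable_const measurable_rpow_power_times
          measurable_fragment_integral f(1))
    show "(\<lambda>l. rpow l \<gamma> ^ n * sintegral (frag_term n) (\<lambda>x. ?A f (x * l))) \<in> borel_measurable rplus"
      by (rule measurable_rpow_power_times[OF measurable_fragment_integral[OF mA]])
    fix l assume l: "l \<in> {0..L}"
    let ?g = "\<lambda>x. f (x * l)"
    have g: "?g \<in> borel_measurable rplus" using l f(1) by (intro measurable_scale_arg(2)) auto
    have bg: "\<bar>?g x\<bar> \<le> c" if "x \<in> {0..1}" for x by (rule f(2)[OF mult_mem_interval[OF that l]])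
    have "real (Suc n) * (rpow l \<gamma> ^ Suc n * sintegral (frag_term (Suc n)) ?g) =
        rpow l \<gamma> ^ n * (rpow l \<gamma> * (real (Suc n) * sintegral (frag_term (Suc n)) ?g))"
      by simp
    also have "real (Suc n) * sintegral (frag_term (Suc n)) ?g = sintegral (frag_term n) (?A ?g)"
      by (rule sintegral_frag_term_Suc[OF g bg])
    also have "rpow l \<gamma> * sintegral (frag_term n) (?A ?g) = sintegral (frag_term n) (\<lambda>x. rpow l \<gamma> * ?A ?g x)"
      by (rule sintegral_cmult[symmetric])
    also have "\<dots> = sintegral (frag_term n) (\<lambda>x. ?A f (x * l))"
      using l by (intro sintegral_cong frag_adjoint_dilation) auto
    finally show "real (Suc n) * (rpow l \<gamma> ^ Suc n * sintegral (frag_term (Suc n)) ?g) =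
        rpow l \<gamma> ^ n * sintegral (frag_term n) (\<lambda>x. ?A f (x * l))" .
  qed
  also have "\<dots> = sintegral (mixed_term n) (?A f)"
    by (rule sintegral_mixed_term[OF mA bA, symmetric])
  finally show ?thesis .
qed

lemma weak_solution_mixed: "weak_solution \<alpha> \<gamma> \<kappa> \<mu>\<^sub>0 (\<lambda>t. power_sum mixed_term (\<alpha> * t))"
  by (rule weak_solution_power_sum[OF mixed.entire_series_axioms datum AE_datum
      sintegral_mixed_term_Suc sintegral_mixed_term_0])

text \<open>
  The mass that has not yet fragmented at time \<open>y\<close>: the exponential series in \<open>- y l\<^sup>\<gamma>\<close>, integrated term
  by term against \<open>\<mu>\<^sub>0\<close>.
\<close>

lemma size_weight_exp_sums:
  "(\<lambda>n. ((- y) ^ n / fact n) *\<^sub>R size_weight n) sums weight (\<lambda>l. exp (- y * rpow l \<gamma>)) (of_measure \<mu>\<^sub>0)"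
proof -
  let ?\<nu> = "\<lambda>n. ((-1) ^ n / fact n) *\<^sub>R size_weight n"
  let ?w = "\<lambda>l. exp (- y * rpow l \<gamma>)"
  interpret exp_series: entire_series ?\<nu> "{0..L}" "total_variation (of_measure \<mu>\<^sub>0)" "rpow L \<gamma>"
  proof
    show "concentrated_on {0..L} (?\<nu> n)" for n
      by (rule concentrated_on_scaleR[OF concentrated_on_size_weight])
    fix n
    have "total_variation (size_weight n) \<le> rpow L \<gamma> ^ n * total_variation (of_measure \<mu>\<^sub>0)"
    proof (rule total_variation_le)
      fix f :: "real \<Rightarrow> real" assume f: "f \<in> borel_measurable rplus" "\<And>x. \<bar>f x\<bar> \<le> 1"
      have "\<bar>sintegral (of_measure \<mu>\<^sub>0) (\<lambda>l. rpow l \<gamma> ^ n * f l)\<bar> \<le> rpow L \<gamma> ^ n * total_variation (of_measure \<mu>\<^sub>0)"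
      proof (rule abs_sintegral_le[OF interval_in_rplus concentrated_on_datum])
        show "(\<lambda>l. rpow l \<gamma> ^ n * f l) \<in> borel_measurable rplus" by (rule measurable_rpow_power_times[OF f(1)])
        fix l assume "l \<in> {0..L}"
        then have "rpow l \<gamma> ^ n * \<bar>f l\<bar> \<le> rpow L \<gamma> ^ n * 1"
          using rpow_le_datum[of l n] f(2) by (intro mult_mono) (auto simp: rpow_power)
        then show "\<bar>rpow l \<gamma> ^ n * f l\<bar> \<le> rpow L \<gamma> ^ n" by (simp add: abs_mult)
      qed simp
      moreover have "sintegral (size_weight n) f = sintegral (of_measure \<mu>\<^sub>0) (\<lambda>l. rpow l \<gamma> ^ n * f l)"
        by (rule sintegral_size_weight[OF f])
      ultimately show "sintegral (size_weight n) f \<le> rpow L \<gamma> ^ n * total_variation (of_measure \<mu>\<^sub>0)" by simp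
    qed
    note tv = this
    have "total_variation (?\<nu> n) \<le> \<bar>(-1) ^ n / fact n\<bar> * total_variation (size_weight n)"
      by (rule total_variation_scaleR_le)
    also have "\<dots> \<le> \<bar>(-1) ^ n / fact n\<bar> * (rpow L \<gamma> ^ n * total_variation (of_measure \<mu>\<^sub>0))"
      by (rule mult_left_mono[OF tv abs_ge_zero])
    also have "\<dots> = total_variation (of_measure \<mu>\<^sub>0) * (rpow L \<gamma> ^ n / fact n)" by simp
    finally show "total_variation (?\<nu> n) \<le> total_variation (of_measure \<mu>\<^sub>0) * (rpow L \<gamma> ^ n / fact n)" .
  qed simp
  have "power_sum ?\<nu> y = weight ?w (of_measure \<mu>\<^sub>0)"
  proof (rule smeasure_eqI_sintegral)
    fix f :: "real \<Rightarrow> real" assume f: "f \<in> borel_measurable rplus" "\<And>x. \<bar>f x\<bar> \<le> 1"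
    let ?g = "\<lambda>n l. (- y * rpow l \<gamma>) ^ n / fact n * f l"
    have mw: "?w \<in> borel_measurable rplus"
      by (rule measurable_compose[OF _ borel_measurable_exp])
         (intro borel_measurable_times borel_measurable_const measurable_rpow)
    have bw: "?w l \<le> exp (\<bar>y\<bar> * rpow L \<gamma>)" if "l \<in> {0..L}" for l
    proof -
      have "- y * rpow l \<gamma> \<le> \<bar>y\<bar> * rpow L \<gamma>"
        using that rpow_mono[of l L \<gamma>] \<gamma> by (intro mult_mono) auto
      then show ?thesis by simp
    qed
    have "(\<lambda>n. sintegral (of_measure \<mu>\<^sub>0) (?g n)) sums sintegral (of_measure \<mu>\<^sub>0) (\<lambda>l. \<Sum>n. ?g n l)"
    proof (rule sintegral_sums[OF interval_in_rplus concentrated_on_datum])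
      show "?g n \<in> borel_measurable rplus" for n
        by (intro borel_measurable_times borel_measurable_divide borel_measurable_power
            borel_measurable_const measurable_rpow f(1))
      show "\<bar>?g n l\<bar> \<le> 1 * ((\<bar>y\<bar> * rpow L \<gamma>) ^ n / fact n)" if "l \<in> {0..L}" for n l
      proof -
        have "(\<bar>y\<bar> * rpow l \<gamma>) ^ n / fact n * \<bar>f l\<bar> \<le> (\<bar>y\<bar> * rpow L \<gamma>) ^ n / fact n * 1"
          using that rpow_mono[of l L \<gamma>] \<gamma> f(2)
          by (intro mult_mono divide_right_mono power_mono) auto
        then show ?thesis by (simp add: abs_mult power_abs)
      qed
      show "summable (\<lambda>n. 1 * ((\<bar>y\<bar> * rpow L \<gamma>) ^ n / fact n))"
        using exp_converges[of "\<bar>y\<bar> * rpow L \<gamma>"] by (simp add: divide_inverse mult.commute sums_iff)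
    qed
    moreover have "(\<lambda>l. \<Sum>n. ?g n l) = (\<lambda>l. ?w l * f l)"
    proof
      fix l
      have "(\<lambda>n. (- y * rpow l \<gamma>) ^ n / fact n) sums ?w l"
        using exp_converges[of "- y * rpow l \<gamma>"] by (simp add: divide_inverse mult.commute)
      then show "(\<Sum>n. ?g n l) = ?w l * f l" by (intro sums_unique[symmetric] sums_mult2)
    qed
    moreover have "sintegral (of_measure \<mu>\<^sub>0) (?g n) = sintegral (?\<nu> n) f * y ^ n" for n
    proof -
      have "sintegral (?\<nu> n) f = (-1) ^ n / fact n * sintegral (size_weight n) f"
        by (rule sintegral_scaleR_on[OF interval_in_rplus concentrated_on_size_weight f])
      also have "sintegral (size_weight n) f = sintegral (of_measure \<mu>\<^sub>0) (\<lambda>l. rpow l \<gamma> ^ n * f l)"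
        by (rule sintegral_size_weight[OF f])
      finally have "sintegral (?\<nu> n) f * y ^ n =
          ((-1) ^ n / fact n * y ^ n) * sintegral (of_measure \<mu>\<^sub>0) (\<lambda>l. rpow l \<gamma> ^ n * f l)" by simp
      also have "\<dots> = sintegral (of_measure \<mu>\<^sub>0) (\<lambda>l. ((-1) ^ n / fact n * y ^ n) * (rpow l \<gamma> ^ n * f l))"
        by (rule sintegral_cmult[symmetric])
      also have "(\<lambda>l. ((-1) ^ n / fact n * y ^ n) * (rpow l \<gamma> ^ n * f l)) = ?g n"
        by (subst power_mult_distrib, subst power_minus) (simp add: fun_eq_iff)
      finally show ?thesis by simp
    qed
    moreover have "(\<lambda>n. sintegral (?\<nu> n) f * y ^ n) sums sintegral (power_sum ?\<nu> y) f"
      by (rule exp_series.sintegral_power_sum[OF f])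
    ultimately have "sintegral (power_sum ?\<nu> y) f = sintegral (of_measure \<mu>\<^sub>0) (\<lambda>l. ?w l * f l)"
      by (simp add: sums_iff)
    also have "\<dots> = sintegral (weight ?w (of_measure \<mu>\<^sub>0)) f"
      by (rule sintegral_weight[OF interval_in_rplus concentrated_on_datum mw _ bw f, symmetric]) simp
    finally show "sintegral (power_sum ?\<nu> y) f = sintegral (weight ?w (of_measure \<mu>\<^sub>0)) f" .
  qed
  moreover have "(\<lambda>n. y ^ n *\<^sub>R ?\<nu> n) sums power_sum ?\<nu> y"
    unfolding power_sum_def by (rule summable_sums[OF exp_series.summable_power_sum])
  moreover have "(\<lambda>n. y ^ n *\<^sub>R ?\<nu> n) = (\<lambda>n. ((- y) ^ n / fact n) *\<^sub>R size_weight n)"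
    unfolding power_minus[of y] by (simp add: mult.commute)
  ultimately show ?thesis by (simp only:)
qed

text \<open>
  Removing the Dirac part from \<open>b\<^sub>n\<close> removes the surviving mass from the sum and leaves the series in
  the coefficients \<open>a\<^sub>n\<close>.
\<close>

lemma solution_series_sums:
  "(\<lambda>n. y ^ n *\<^sub>R (frag_coeff \<gamma> \<kappa> n \<star> size_weight n)) sums
    (power_sum mixed_term y - weight (\<lambda>l. exp (- y * rpow l \<gamma>)) (of_measure \<mu>\<^sub>0))"
proof -
  have "(\<lambda>n. y ^ n *\<^sub>R mixed_term n) sums power_sum mixed_term y"
    unfolding power_sum_def by (rule summable_sums[OF mixed.summable_power_sum])
  from sums_diff[OF this size_weight_exp_sums[of y]]
  have "(\<lambda>n. y ^ n *\<^sub>R mixed_term n - ((- y) ^ n / fact n) *\<^sub>R size_weight n) sums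
      (power_sum mixed_term y - weight (\<lambda>l. exp (- y * rpow l \<gamma>)) (of_measure \<mu>\<^sub>0))" .
  moreover have "y ^ n *\<^sub>R mixed_term n - ((- y) ^ n / fact n) *\<^sub>R size_weight n =
      y ^ n *\<^sub>R (frag_coeff \<gamma> \<kappa> n \<star> size_weight n)" for n
  proof -
    have "(- y) ^ n / fact n = y ^ n * ((-1) ^ n / fact n)"
      by (subst power_minus) (simp add: mult.commute)
    then show ?thesis
      unfolding mixed_term_def frag_term_def mconv_dirac_one_add scaleR_add_right scaleR_scaleR by simp
  qed
  ultimately show ?thesis by simp
qed

text \<open>
  Summing over \<open>n\<close> inside the integral over \<open>l\<close> turns \<open>y\<^sup>n l\<^sup>n\<^sup>\<gamma>\<close> into the \<open>n\<close>-th power of the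
  rescaled time \<open>y l\<^sup>\<gamma>\<close>, at which the fundamental solution is then evaluated.
\<close>

lemma disintegration:
  fixes f :: "real \<Rightarrow> real" and c y :: real
  assumes f: "f \<in> borel_measurable rplus" "\<And>x. x \<in> {0..L} \<Longrightarrow> \<bar>f x\<bar> \<le> c"
  defines "H \<equiv> \<lambda>l. sintegral (power_sum frag_term (y * rpow l \<gamma>)) (\<lambda>x. indicator {0..1} x * f (l * x))"
  shows "set_integrable \<mu>\<^sub>0 {0..L} H"
    and "sintegral (power_sum mixed_term y) f = (LINT l:{0..L}|\<mu>\<^sub>0. H l)"
proof -
  define h where "h n l = y ^ n * (rpow l \<gamma> ^ n * sintegral (frag_term n) (\<lambda>x. f (x * l)))" for n l
  define \<beta> where "\<beta> n = c * ((\<bar>y\<bar> * (rpow L \<gamma> * rate)) ^ n / fact n)" for n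
  have \<beta>: "summable \<beta>"
    unfolding \<beta>_def using exp_converges[of "\<bar>y\<bar> * (rpow L \<gamma> * rate)"]
    by (intro summable_mult) (simp add: divide_inverse mult.commute sums_iff)
  have mh: "h n \<in> borel_measurable rplus" for n
    unfolding h_def
    by (intro borel_measurable_times borel_measurable_const measurable_rpow_power_times
        measurable_fragment_integral f(1))
  have bh: "\<bar>h n l\<bar> \<le> \<beta> n" if l: "l \<in> {0..L}" for n l
  proof -
    have "\<bar>h n l\<bar> \<le> \<bar>y ^ n\<bar> * (c * ((rpow L \<gamma> * rate) ^ n / fact n))"
      unfolding h_def abs_mult[of "y ^ n"] by (intro mult_left_mono mixed_integrand_le[OF f l]) auto
    also have "\<dots> = \<beta> n" unfolding \<beta>_def power_mult_distrib power_abs by simp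
    finally show ?thesis .
  qed
  have hH: "(\<lambda>n. h n l) sums H l" if l: "l \<in> {0..L}" for l
  proof -
    have g: "(\<lambda>x. f (l * x)) \<in> borel_measurable rplus" using l f(1) by (intro measurable_scale_arg(1)) auto
    have bg: "\<bar>f (l * x)\<bar> \<le> c" if "x \<in> {0..1}" for x
      using f(2)[OF mult_mem_interval[OF that l]] by (simp add: mult.commute)
    have "H l = sintegral (power_sum frag_term (y * rpow l \<gamma>)) (\<lambda>x. f (l * x))"
      unfolding H_def
      by (rule sintegral_truncate[OF interval_in_rplus fundamental.concentrated_on_power_sum g, symmetric])
    moreover have "(\<lambda>n. sintegral (frag_term n) (\<lambda>x. f (l * x)) * (y * rpow l \<gamma>) ^ n) sums
        sintegral (power_sum frag_term (y * rpow l \<gamma>)) (\<lambda>x. f (l * x))"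
      by (rule fundamental.sintegral_power_sum[OF g bg])
    moreover have "h n l = sintegral (frag_term n) (\<lambda>x. f (l * x)) * (y * rpow l \<gamma>) ^ n" for n
      unfolding h_def power_mult_distrib by (simp add: mult.commute)
    ultimately show ?thesis by simp
  qed
  \<comment> \<open>\<open>G\<close> equals \<open>H\<close> on \<open>[0,L]\<close>, and measurability is immediate for the sum of the series.\<close>
  define G where "G l = (\<Sum>n. h n l)" for l
  have GH: "G l = H l" if "l \<in> {0..L}" for l using hH[OF that] by (simp add: G_def sums_iff)
  have mG: "G \<in> borel_measurable rplus" unfolding G_def[abs_def] by (rule borel_measurable_suminf[OF mh])
  have bG: "\<bar>G l\<bar> \<le> suminf \<beta>" if "l \<in> {0..L}" for l
  proof -
    have "norm (h n l) \<le> \<beta> n" for n using bh[OF that] by simp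
    from norm_sums_le[of "\<lambda>n. h n l", OF hH[OF that] summable_sums[OF \<beta>] this]
    have "norm (G l) \<le> suminf \<beta>" unfolding GH[OF that] .
    then show ?thesis by simp
  qed
  have eq: "(\<lambda>l. indicator {0..L} l *\<^sub>R H l) = (\<lambda>l. indicator {0..L} l * G l)"
  proof
    show "indicator {0..L} l *\<^sub>R H l = indicator {0..L} l * G l" for l
      using GH[of l] by (cases "l \<in> {0..L}") simp_all
  qed
  have m: "(\<lambda>l. indicator {0..L} l * G l) \<in> borel_measurable rplus"
    by (rule measurable_indicator_times[OF interval_in_rplus mG])
  have b: "\<bar>indicator {0..L} l * G l\<bar> \<le> \<bar>suminf \<beta>\<bar>" for l
    by (rule abs_indicator_times_le[OF bG])
  show "set_integrable \<mu>\<^sub>0 {0..L} H"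
    unfolding set_integrable_def eq
    by (rule integrable_on_of_measure[OF datum interval_in_rplus AE_datum m b])
  have "(\<lambda>n. sintegral (of_measure \<mu>\<^sub>0) (h n)) sums sintegral (of_measure \<mu>\<^sub>0) G"
    unfolding G_def by (rule sintegral_sums[OF interval_in_rplus concentrated_on_datum mh bh \<beta>])
  moreover have "sintegral (of_measure \<mu>\<^sub>0) (h n) = sintegral (mixed_term n) f * y ^ n" for n
  proof -
    have "sintegral (mixed_term n) f =
        sintegral (of_measure \<mu>\<^sub>0) (\<lambda>l. rpow l \<gamma> ^ n * sintegral (frag_term n) (\<lambda>x. f (x * l)))"
      by (rule sintegral_mixed_term[OF f])
    then show ?thesis unfolding h_def sintegral_cmult by simp
  qed
  moreover have "(\<lambda>n. sintegral (mixed_term n) f * y ^ n) sums sintegral (power_sum mixed_term y) f"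
    by (rule mixed.sintegral_power_sum[OF f])
  ultimately have "sintegral (power_sum mixed_term y) f = sintegral (of_measure \<mu>\<^sub>0) G"
    by (simp add: sums_iff)
  also have "\<dots> = sintegral (of_measure \<mu>\<^sub>0) (\<lambda>l. indicator {0..L} l * G l)"
    by (rule sintegral_truncate[OF interval_in_rplus concentrated_on_datum mG])
  also have "\<dots> = (\<integral>l. indicator {0..L} l * G l \<partial>\<mu>\<^sub>0)"
    by (rule sintegral_of_measure_on[OF datum interval_in_rplus AE_datum m b])
  finally show "sintegral (power_sum mixed_term y) f = (LINT l:{0..L}|\<mu>\<^sub>0. H l)"
    unfolding set_lebesgue_integral_def eq .
qed

end

theorem theorem2:
  fixes \<alpha> \<gamma> L :: real and \<kappa> \<mu>\<^sub>0 :: "real measure"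
  assumes "\<alpha> > 0" and "\<gamma> \<ge> 0"
    and "fragmentation_kernel \<kappa>"
    and "admissible_datum \<mu>\<^sub>0" and "msupp \<mu>\<^sub>0 \<subseteq> {0..L}"
  shows "\<exists>\<mu> :: real \<Rightarrow> smeasure.
    continuous_on {0..} \<mu> \<and>
    weak_solution \<alpha> \<gamma> \<kappa> \<mu>\<^sub>0 \<mu> \<and>
    (\<forall>t\<ge>0. (\<lambda>n. (\<alpha> * t) ^ n *\<^sub>R
          (frag_coeff \<gamma> \<kappa> n \<star> weight (\<lambda>l. rpow l (real n * \<gamma>)) (of_measure \<mu>\<^sub>0)))
        sums (\<mu> t - weight (\<lambda>x. exp (- \<alpha> * rpow x \<gamma> * t)) (of_measure \<mu>\<^sub>0))) \<and>
    (\<forall>t\<ge>0. summable (\<lambda>n. (\<alpha> * t) ^ Suc n *\<^sub>R frag_coeff \<gamma> \<kappa> (Suc n))) \<and>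
    continuous_on {0..} (fundamental_solution \<alpha> \<gamma> \<kappa>) \<and>
    weak_solution \<alpha> \<gamma> \<kappa> dirac_one (fundamental_solution \<alpha> \<gamma> \<kappa>) \<and>
    (\<forall>\<phi>. continuous_on {0..} \<phi> \<longrightarrow> (\<forall>t\<ge>0.
        sintegrable (\<mu> t) \<phi> \<and>
        (\<forall>l\<in>{0..L}. sintegrable (fundamental_solution \<alpha> \<gamma> \<kappa> (t * rpow l \<gamma>))
            (\<lambda>x. indicator {0..1} x * \<phi> (l * x))) \<and>
        set_integrable \<mu>\<^sub>0 {0..L} (\<lambda>l. sintegral (fundamental_solution \<alpha> \<gamma> \<kappa> (t * rpow l \<gamma>))
            (\<lambda>x. indicator {0..1} x * \<phi> (l * x))) \<and>
        sintegral (\<mu> t) \<phi> =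
          (LINT l:{0..L}|\<mu>\<^sub>0. sintegral (fundamental_solution \<alpha> \<gamma> \<kappa> (t * rpow l \<gamma>))
            (\<lambda>x. indicator {0..1} x * \<phi> (l * x))))) \<and>
    (\<forall>t>0. ssupp (\<mu> t) \<subseteq> fragment_hull (msupp \<mu>\<^sub>0))"
proof -
  have \<mu>\<^sub>0: "\<mu>\<^sub>0 \<in> nonneg_measures" and compact: "compact (msupp \<mu>\<^sub>0)"
    using assms(4) by (auto simp: admissible_datum_def)
  have AE: "AE l in \<mu>\<^sub>0. l \<in> msupp \<mu>\<^sub>0"
    using \<mu>\<^sub>0 by (intro AE_msupp) (simp add: nonneg_measures_def)
  interpret fragmentation \<gamma> \<kappa> by unfold_locales (use assms in auto)
  have datum_on: "fragmentation_datum \<gamma> \<kappa> \<mu>\<^sub>0 M" if "msupp \<mu>\<^sub>0 \<subseteq> {0..M}" for M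
  proof unfold_locales
    show "AE l in \<mu>\<^sub>0. l \<in> {0..M}" using AE by eventually_elim (use that in blast)
  qed (rule \<mu>\<^sub>0)
  interpret fragmentation_datum \<gamma> \<kappa> \<mu>\<^sub>0 L by (rule datum_on[OF assms(5)])
  define \<mu> where "\<mu> t = power_sum mixed_term (\<alpha> * t)" for t
  have fundamental: "fundamental_solution \<alpha> \<gamma> \<kappa> = (\<lambda>t. power_sum frag_term (\<alpha> * t))"
    by (rule ext) (rule fundamental_solution_eq)
  have time: "continuous_on {0..} (\<lambda>t. \<alpha> * t)" "(\<lambda>t. \<alpha> * t) ` {0..} \<subseteq> {0..}"
    using assms(1) by (auto intro!: continuous_intros)
  show ?thesis
  proof (intro exI[of _ \<mu>] conjI allI impI ballI)
    show "continuous_on {0..} \<mu>"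
      unfolding \<mu>_def[abs_def] by (rule continuous_on_compose2[OF mixed.continuous_power_sum time])
    show "weak_solution \<alpha> \<gamma> \<kappa> \<mu>\<^sub>0 \<mu>"
      unfolding \<mu>_def[abs_def] by (rule weak_solution_mixed)
    show "continuous_on {0..} (fundamental_solution \<alpha> \<gamma> \<kappa>)"
      unfolding fundamental by (rule continuous_on_compose2[OF fundamental.continuous_power_sum time])
    show "weak_solution \<alpha> \<gamma> \<kappa> dirac_one (fundamental_solution \<alpha> \<gamma> \<kappa>)"
      unfolding fundamental by (rule weak_solution_fundamental)
    fix t :: real
    show "summable (\<lambda>n. (\<alpha> * t) ^ Suc n *\<^sub>R frag_coeff \<gamma> \<kappa> (Suc n))"
      by (rule summable_frag_coeff)
    have "(\<lambda>l. exp (- (\<alpha> * t) * rpow l \<gamma>)) = (\<lambda>x. exp (- \<alpha> * rpow x \<gamma> * t))"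
      by (simp add: mult_ac)
    then show "(\<lambda>n. (\<alpha> * t) ^ n *\<^sub>R
          (frag_coeff \<gamma> \<kappa> n \<star> weight (\<lambda>l. rpow l (real n * \<gamma>)) (of_measure \<mu>\<^sub>0)))
        sums (\<mu> t - weight (\<lambda>x. exp (- \<alpha> * rpow x \<gamma> * t)) (of_measure \<mu>\<^sub>0))"
      using solution_series_sums[of "\<alpha> * t"] unfolding \<mu>_def size_weight_def by (simp only:)
    fix \<phi> :: "real \<Rightarrow> real" assume cont: "continuous_on {0..} \<phi>"
    have m: "\<phi> \<in> borel_measurable rplus"
      using cont by (rule borel_measurable_continuous_on_restrict)
    obtain c where c: "\<And>x. x \<in> {0..L} \<Longrightarrow> \<bar>\<phi> x\<bar> \<le> c"
      using continuous_bounded_on_interval[OF cont] by blast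
    show "sintegrable (\<mu> t) \<phi>"
      unfolding \<mu>_def by (rule integrable_pos_neg(3)[OF interval_in_rplus mixed.concentrated_on_power_sum m c])
    show "sintegrable (fundamental_solution \<alpha> \<gamma> \<kappa> (t * rpow l \<gamma>)) (\<lambda>x. indicator {0..1} x * \<phi> (l * x))"
      if l: "l \<in> {0..L}" for l
    proof (rule sintegrable_bounded)
      have "(\<lambda>x. \<phi> (l * x)) \<in> borel_measurable rplus" using l m by (intro measurable_scale_arg(1)) auto
      then show "(\<lambda>x. indicator {0..1} x * \<phi> (l * x)) \<in> borel_measurable rplus"
        by (rule measurable_indicator_times[OF interval_in_rplus])
      show "\<bar>indicator {0..1} x * \<phi> (l * x)\<bar> \<le> \<bar>c\<bar>" for x
      proof (rule abs_indicator_times_le)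
        show "\<bar>\<phi> (l * x)\<bar> \<le> c" if "x \<in> {0..1}" for x
          using c[OF mult_mem_interval[OF that l]] by (simp add: mult.commute)
      qed
    qed
    note dis = disintegration[OF m c, of "\<alpha> * t"]
    have time_change: "\<alpha> * (t * rpow l \<gamma>) = \<alpha> * t * rpow l \<gamma>" for l by simp
    show "set_integrable \<mu>\<^sub>0 {0..L} (\<lambda>l. sintegral (fundamental_solution \<alpha> \<gamma> \<kappa> (t * rpow l \<gamma>))
            (\<lambda>x. indicator {0..1} x * \<phi> (l * x)))"
      unfolding fundamental time_change by (rule dis(1))
    show "sintegral (\<mu> t) \<phi> =
          (LINT l:{0..L}|\<mu>\<^sub>0. sintegral (fundamental_solution \<alpha> \<gamma> \<kappa> (t * rpow l \<gamma>))
            (\<lambda>x. indicator {0..1} x * \<phi> (l * x)))"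
      unfolding fundamental time_change \<mu>_def by (rule dis(2))
  next
    fix t :: real
    \<comment> \<open>The coefficients do not refer to \<open>L\<close>, so the interval can be shrunk to the largest size in the
      support of the datum.\<close>
    have ssupp: "ssupp (\<mu> t) \<subseteq> {0..M}" if M: "msupp \<mu>\<^sub>0 \<subseteq> {0..M}" for M
    proof -
      interpret on_M: fragmentation_datum \<gamma> \<kappa> \<mu>\<^sub>0 M by (rule datum_on[OF M])
      show ?thesis
        unfolding \<mu>_def by (rule ssupp_subset_interval[OF on_M.mixed.concentrated_on_power_sum])
    qed
    have nonneg: "msupp \<mu>\<^sub>0 \<subseteq> {0..}" using assms(5) by auto
    show "ssupp (\<mu> t) \<subseteq> fragment_hull (msupp \<mu>\<^sub>0)"
    proof (cases "msupp \<mu>\<^sub>0 = {}")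
      case True
      \<comment> \<open>The datum is zero; \<open>{0..-1}\<close> is empty.\<close>
      then show ?thesis using ssupp[of "-1"] by simp
    next
      case False
      then obtain M where M: "M \<in> msupp \<mu>\<^sub>0" "\<And>x. x \<in> msupp \<mu>\<^sub>0 \<Longrightarrow> x \<le> M"
        using compact_attains_sup[OF compact] by blast
      have "{0..M} \<subseteq> fragment_hull (msupp \<mu>\<^sub>0)"
      proof
        fix x assume x: "x \<in> {0..M}"
        show "x \<in> fragment_hull (msupp \<mu>\<^sub>0)"
        proof (cases "x = 0")
          case True
          then show ?thesis using M(1) unfolding fragment_hull_def by (intro CollectI exI[of _ 0] exI[of _ M]) auto
        next
          case False
          then show ?thesis
            using x M(1) unfolding fragment_hull_def by (intro CollectI exI[of _ "x / M"] exI[of _ M]) auto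
        qed
      qed
      moreover have "msupp \<mu>\<^sub>0 \<subseteq> {0..M}" using M(2) nonneg by auto
      ultimately show ?thesis using ssupp by blast
    qed
  qed
qed

end
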